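(* For all integers $m,n,i,j$ with $2\le m<n$ and $2\le i<j$ there is a commutative diagram of embeddings of cluster theories as follows. Each cluster theory is denoted by its compatibility condition (all defined in the context): $\mathbf N_n$ stands for $\mathscr T_{\mathbf N_n}(\mathcal C(A_n))$, $\mathbf N_\infty$ for $\mathscr T_{\mathbf N_\infty}(\mathcal C(A_\infty))$, $\mathbf N_{i,\infty}$ for $\mathscr T_{\mathbf N_{i,\infty}}(\mathcal C(A_{i,\infty}))$, $\mathbf N_{\overline{i,\infty}}$ for $\mathscr T_{\mathbf N_{\overline{i,\infty}}}(\mathcal C(A_{\overline{i,\infty}}))$, $\mathbf N_{\overline\infty}$ for $\mathscr T_{\mathbf N_{\overline\infty}}(\mathcal C(A_{\overline\infty}))$, $\mathbf N_\pi$ for $\mathscr T_{\mathbf N_\pi}(\mathcal C_\pi)$, $\mathbf E$ for $\mathscr T_{\mathbf E}(\mathcal C(A_{\mathbb R}))$ and $\mathbf T$ for $\mathscr T_{\mathbf T}(\mathcal C_{\mathcal Z})$. There is an isomorphism of cluster theories $\mathbf N_\infty\cong\mathbf N_{1,\infty}$ (through which these two are treated as a single vertex of the diagram), and the arrows of the diagram are embeddings of cluster theories (1) $\mathbf N_m\to\mathbf N_\infty\cong\mathbf N_{1,\infty}$, $\ \mathbf N_{1,\infty}\to\mathbf N_{i,\infty}$, $\ \mathbf N_{i,\infty}\to\mathbf N_{j,\infty}$, $\ \mathbf N_{j,\infty}\to\mathbf N_\pi$; (2) $\mathbf N_n\to\mathbf N_{\overline{1,\infty}}$, $\ \mathbf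 N_{\overline{1,\infty}}\to\mathbf N_{\overline{i,\infty}}$, $\ \mathbf N_{\overline{i,\infty}}\to\mathbf N_{\overline{j,\infty}}$, $\ \mathbf N_{\overline{j,\infty}}\to\mathbf E$; (3) $\mathbf N_m\to\mathbf N_n$, $\ \mathbf N_n\to\mathbf N_\infty$, $\ \mathbf N_{1,\infty}\to\mathbf N_{\overline{1,\infty}}$, $\ \mathbf N_{i,\infty}\to\mathbf N_{\overline{i,\infty}}$, $\ \mathbf N_{j,\infty}\to\mathbf N_{\overline{j,\infty}}$, $\ \mathbf N_\pi\to\mathbf E$, $\ \mathbf N_{\overline{j,\infty}}\to\mathbf N_\pi$; (4) $\mathbf N_{\overline{1,\infty}}\to\mathbf N_{\overline\infty}$, $\ \mathbf N_{\overline\infty}\to\mathbf N_{\overline{2,\infty}}$, $\ \mathbf N_{\overline{2,\infty}}\to\mathbf N_{\overline{i,\infty}}$; and, as a separate component of the diagram (whose arrow $\mathbf N_m\to\mathbf N_n$ need not be the one in (3)), (5) $\mathbf N_m\to\mathbf N_n$, $\ \mathbf N_n\to\mathbf T$, $\ \mathbf N_m\to\mathbf T$. Commutativity means that in each component any two directed paths with the same source and the same target have equal composites, as embeddings of cluster theories.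
   Context: Fix a field $\Bbbk$. A Krull--Schmidt category means a skeletally small Krull--Schmidt additive category; $\mathrm{Ind}(\mathcal C)$ is the set of isomorphism classes of indecomposable objects. **Cluster theories.** Let $\mathbf P$ be a pairwise compatibility condition on $\mathrm{Ind}(\mathcal C)$ (a symmetric relation); a subset is $\mathbf P$-compatible if its elements are pairwise $\mathbf P$-compatible. Suppose that for every maximally $\mathbf P$-compatible set $T\subset\mathrm{Ind}(\mathcal C)$ and every $X\in T$ there exist 0 or 1 indecomposables $Y$ such that $\{X,Y\}$ is not $\mathbf P$-compatible but $(T\setminus\{X\})\cup\{Y\}$ is $\mathbf P$-compatible. Then the maximally $\mathbf P$-compatible sets are called $\mathbf P$-clusters. For such $T,X,Y$, the function $\mu:T\to(T\setminus\{X\})\cup\{Y\}$ with $\mu(X)=Y$ and $\mu(Z)=Z$ for $Z\ne X$ is called a $\mathbf P$-mutation. The $\mathbf P$-cluster theory $\mathscr T_{\mathbf P}(\mathcal C)$ is the subcategory of the category of sets whose objects are the $\mathbf P$-clusters and whose morphisms are generated by $\mathbf P$-mutations and identity functions. Let $I_{\mathbf P,\mathcal C}:\mathscr T_{\mathbf P}(\mathcal C)\to\mathrm{Set}$ be the inclusion. We say that $\mathbf P$ induces $\mathscr T_{\mathbf P}(\mathcal C)$. It depends only on the set $\mathrm{Ind}(\mathcal C)$ and on $\mathbf P$. **Embeddings.** An embedding of cluster theories $(F,\eta):\mathscr T_{\mathbf P}(\mathcal C)\to\mathscr T_{\mathbf Q}(\mathcal D)$ is a functor $F$ which is injective on objects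 and which maps $\mathbf P$-mutations injectively to $\mathbf Q$-mutations, together with a natural transformation $\eta:I_{\mathbf P,\mathcal C}\to I_{\mathbf Q,\mathcal D}\circ F$ such that every $\eta_T:T\to F(T)$ is injective. It is an isomorphism of cluster theories if $F$ is an isomorphism of categories and every $\eta_T$ is a bijection. Composition: $(F',\eta')\circ(F,\eta)=(F'\circ F,\ (\eta'_{F(T)}\circ\eta_T)_T)$. **Cluster theories from arcs.** Let $\mathcal A$ be a set (of "arcs") and $\mathfrak c:\mathcal A\times\mathcal A\to\{0,1\}$ a symmetric function with $\mathfrak c(\alpha,\alpha)=1$ for all $\alpha$ (the crossing function). The additive categorification of $(\mathcal A,\mathfrak c)$ is the Krull--Schmidt category $\mathcal C$ with objects $0$ and the finite direct sums of elements of $\mathcal A=\mathrm{Ind}(\mathcal C)$, where $\mathrm{Hom}(\alpha,\beta)=\Bbbk$ if $\mathfrak c(\alpha,\beta)=1$ and $0$ otherwise, and the composite of nonzero $f:\alpha\to\beta$, $g:\beta\to\gamma$ is the product of scalars if $\alpha=\beta$ or $\beta=\gamma$ and is $0$ otherwise (extended bilinearly). The pairwise encoding of $\mathfrak c$ is the condition: $\alpha,\beta$ are compatible iff $\alpha=\beta$ or $\mathfrak c(\alpha,\beta)=0$. If $\mathcal E$ is a totally ordered set and $\mathcal A\subset\mathcal E\times\mathcal E$ is such that every $(a,b)\in\mathcal A$ admits $\ell\in\mathcal E$ with $a<\ell<b$, the type $A$ crossing function on $\mathcal A$ is given by: $\mathfrak c((a,b),(a',b'))=1$ iff $(a,b)=(a',b')$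 or $a<a'<b<b'$ or $a'<a<b'<b$. In each of the following cases the category is the additive categorification of $\mathcal A$ with its type $A$ crossing function, and the compatibility condition is the pairwise encoding of that function. - $\mathcal C(A_n)$, $\mathbf N_n$ ($n\ge2$): $\mathcal E_n=\{1,\dots,n\}$, $\mathcal A_n=\{(a,b)\in\mathcal E_n\times\mathcal E_n: 2\le b-a\le n-2\}$. - $\mathcal C(A_\infty)$, $\mathbf N_\infty$: $\mathcal E_\infty=\mathbb Z$, $\mathcal A_\infty=\{(a,b)\in\mathbb Z\times\mathbb Z: 2\le b-a\}$. - $\mathcal C(A_{\overline\infty})$, $\mathbf N_{\overline\infty}$: $\mathcal E=\mathbb Z\cup\{-\infty,+\infty\}$ with the usual order, $\mathcal A_{\overline\infty}=\{(a,b)\in\mathcal E\times\mathcal E:\exists\,\ell\in\mathbb Z,\ a<\ell<b\}\setminus\{(-\infty,+\infty)\}$. - $\mathcal C(A_{i,\infty})$, $\mathbf N_{i,\infty}$ ($i\ge1$): $\mathcal E_{i,\infty}=\mathbb Z\times\{1,\dots,i\}$ with $(p,\ell)\le(q,r)$ iff $\ell<r$, or $\ell=r$ and $p\le q$; $\mathcal A_{i,\infty}=\{(a,b)\in\mathcal E_{i,\infty}\times\mathcal E_{i,\infty}:\exists\,c\in\mathcal E_{i,\infty},\ a<c<b\}$. - $\mathcal C(A_{\overline{i,\infty}})$, $\mathbf N_{\overline{i,\infty}}$ ($i\ge1$): $\mathcal E_{\overline{i,\infty}}=(\mathbb Z\cup\{+\infty\})\times\{1,\dots,i\}$ with the order defined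 by the same rule, $\mathcal A_{\overline{i,\infty}}=\{(a,b)\in\mathcal E_{\overline{i,\infty}}\times\mathcal E_{\overline{i,\infty}}:\exists\,c\in\mathcal E_{\overline{i,\infty}},\ a<c<b\}$. - $\mathcal C_\pi$, $\mathbf N_\pi$: $\mathcal E_\pi=(-\frac\pi2,\frac\pi2]$ with the order of $\mathbb R$, $\mathcal A_\pi=\{(x,y)\in\mathcal E_\pi\times\mathcal E_\pi: x<y\}$. **$\mathcal C_{\mathcal Z}$ and $\mathbf T$.** Let $\mathcal Z=\{(x,x):-\frac\pi2<x<\frac\pi2\}$ and $\mathcal Z[1]=\{(x+\pi,-x):(x,x)\in\mathcal Z\}$. Then $\mathrm{Ind}(\mathcal C_{\mathcal Z})$ is the set of $(x,y)\in\mathbb R\times(-\frac\pi2,\frac\pi2)$ for which there are $(x_0,y)\in\mathcal Z$ and $(x_1,y)\in\mathcal Z[1]$ with $x_0\le x\le x_1$ (equivalently $y\le x\le\pi-y$). Two elements $(x,y),(z,w)$ are not $\mathbf T$-compatible iff there is a (nondegenerate) rectangle contained in $\mathrm{Ind}(\mathcal C_{\mathcal Z})\cup\{(\frac\pi2,\frac\pi2)\}\cup\{(x,-\frac\pi2):-\frac\pi2\le x\le\frac{3\pi}2\}$, with sides of slope $\pm1$, whose left and right corners are the two points $(x,y),(z,w)$. **$\mathcal C(A_{\mathbb R})$ and $\mathbf E$.** View $\mathbb R$ as a category with a unique morphism $x\to y$ when $x\ge y$ and none otherwise; representations are functors to finite-dimensional $\Bbbk$-vector spaces. For a nonempty interval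 $I\subset\mathbb R$ (bounded or not, endpoints included or not, one-point intervals included) let $M_I$ be the indecomposable representation which is $\Bbbk$ on $I$, with identity maps inside $I$, and $0$ elsewhere. The indecomposable projectives are $P_x=M_{(-\infty,x]}$, $P_{x)}=M_{(-\infty,x)}$ ($x\in\mathbb R$) and $P_{+\infty)}=M_{\mathbb R}$. The category $\mathrm{rep}_\Bbbk(A_{\mathbb R})$ of finitely generated representations has $\{M_I\}$ as its indecomposables, and $\mathcal C(A_{\mathbb R})$ is a triangulated orbit category of its bounded derived category with $\mathrm{Ind}(\mathcal C(A_{\mathbb R}))=\mathrm{Ind}(\mathrm{rep}_\Bbbk(A_{\mathbb R}))$. For indecomposable projectives $P,Q$, $\dim_\Bbbk\mathrm{Hom}_{\mathcal C(A_{\mathbb R})}(P,Q)$ is $1$ if the support of $P$ is contained in the support of $Q$ and $0$ otherwise. Each $M_I$ has a projective resolution $P'\to P\to M_I$: $P$ has support $\{x:\exists\,y\in I,\ x\le y\}$, and $P'$ has support $\{x: x<y\ \forall y\in I\}$ if this is nonempty, and $P'=0$ otherwise. The $g$-vector of $M_I$ is $[P]-[P']$ in the split Grothendieck group $K_0^{\mathrm{split}}(\mathcal C(A_{\mathbb R}))$. For $[V]=\sum_s m_s[V_s]$, $[W]=\sum_t n_t[W_t]$ put $\langle[V],[W]\rangle=\sum_{s,t}m_sn_t\dim_\Bbbk\mathrm{Hom}_{\mathcal C(A_{\mathbb R})}(V_s,W_t)$. Indecomposables $V,W$ with $g$-vectors $g_V,g_W$ are $\mathbf E$-compatible iff $\langle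 g_V,g_W\rangle\ge0$ and $\langle g_W,g_V\rangle\ge0$. It is known that each of these compatibility conditions induces a cluster theory. *)

theory Defs
  imports "HOL-Analysis.Analysis" "HOL-Library.Extended" "HOL-Library.Poly_Mapping"
begin

section \<open>Cluster theories\<close>

text \<open>A cluster theory depends on its Krull--Schmidt category only through the set of
  (isomorphism classes of) indecomposables and on the compatibility condition.\<close>

record 'a pcond =
  Ind :: "'a set"
  compat :: "'a \<Rightarrow> 'a \<Rightarrow> bool"

definition compatible :: "'a pcond \<Rightarrow> 'a set \<Rightarrow> bool" where
  "compatible P T \<longleftrightarrow> T \<subseteq> Ind P \<and> pairwise (compat P) T"

definition cluster :: "'a pcond \<Rightarrow> 'a set \<Rightarrow> bool" where
  "cluster P T \<longleftrightarrow> compatible P T \<and> (\<forall>S. compatible P S \<and> T \<subseteq> S \<longrightarrow> S = T)"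

definition exchange :: "'a pcond \<Rightarrow> 'a set \<Rightarrow> 'a \<Rightarrow> 'a \<Rightarrow> bool" where
  "exchange P T X Y \<longleftrightarrow> cluster P T \<and> X \<in> T \<and> Y \<in> Ind P \<and>
     \<not> compatible P {X, Y} \<and> compatible P ((T - {X}) \<union> {Y})"

definition induces_cluster_theory :: "'a pcond \<Rightarrow> bool" where
  "induces_cluster_theory P \<longleftrightarrow>
     (\<forall>X\<in>Ind P. \<forall>Y\<in>Ind P. compat P X Y \<longleftrightarrow> compat P Y X) \<and>
     (\<forall>T X Y Y'. exchange P T X Y \<and> exchange P T X Y' \<longrightarrow> Y = Y')"

text \<open>Morphisms of sets are triples (domain, function, codomain) whose function is
  extensional on its domain, so that equality of triples is equality of morphisms.\<close>

type_synonym 'a arrow = "'a set \<times> ('a \<Rightarrow> 'a) \<times> 'a set"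

definition adom :: "'a arrow \<Rightarrow> 'a set" where "adom f = fst f"
definition afun :: "'a arrow \<Rightarrow> 'a \<Rightarrow> 'a" where "afun f = fst (snd f)"
definition acod :: "'a arrow \<Rightarrow> 'a set" where "acod f = snd (snd f)"

definition aid :: "'a set \<Rightarrow> 'a arrow" where
  "aid T = (T, restrict (\<lambda>X. X) T, T)"

definition acomp :: "'a arrow \<Rightarrow> 'a arrow \<Rightarrow> 'a arrow" where
  "acomp g f = (adom f, compose (adom f) (afun g) (afun f), acod g)"

definition mutation :: "'a set \<Rightarrow> 'a \<Rightarrow> 'a \<Rightarrow> 'a arrow" where
  "mutation T X Y = (T, restrict (\<lambda>Z. if Z = X then Y else Z) T, (T - {X}) \<union> {Y})"

definition mutations :: "'a pcond \<Rightarrow> 'a arrow set" where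
  "mutations P = {mutation T X Y | T X Y. exchange P T X Y}"

text \<open>The objects of the cluster theory of \<open>P\<close> are the sets \<open>T\<close> with \<open>cluster P T\<close>;
  its morphisms are the following. Codomains of mutations are clusters as soon as \<open>P\<close> induces
  a cluster theory; see the lemma below.\<close>

inductive_set arrows :: "'a pcond \<Rightarrow> 'a arrow set" for P where
  aid: "cluster P T \<Longrightarrow> aid T \<in> arrows P"
| mut: "f \<in> mutations P \<Longrightarrow> f \<in> arrows P"
| acomp: "f \<in> arrows P \<Longrightarrow> g \<in> arrows P \<Longrightarrow> acod f = adom g \<Longrightarrow> acomp g f \<in> arrows P"

lemma cluster_exchange:
  assumes P: "induces_cluster_theory P" and ex: "exchange P T X Y"
  shows "cluster P ((T - {X}) \<union> {Y})"
proof -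
  let ?T' = "(T - {X}) \<union> {Y}"
  have sym: "compat P U V \<longleftrightarrow> compat P V U" if "U \<in> Ind P" "V \<in> Ind P" for U V
    using P that unfolding induces_cluster_theory_def by blast
  have uniq: "Z = Y" if "exchange P T X Z" for Z
    using P ex that unfolding induces_cluster_theory_def by blast
  have T: "cluster P T" "X \<in> T" "Y \<in> Ind P" "\<not> compatible P {X, Y}" "compatible P ?T'"
    using ex by (auto simp: exchange_def)
  have TI: "T \<subseteq> Ind P" and Tp: "pairwise (compat P) T"
    using T(1) by (auto simp: cluster_def compatible_def)
  have "Z \<in> ?T'" if S: "compatible P S" "?T' \<subseteq> S" and Z: "Z \<in> S" for S Z
  proof (rule ccontr)
    assume nZ: "Z \<notin> ?T'"
    have ZI: "Z \<in> Ind P" and Sp: "pairwise (compat P) S"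
      using S Z by (auto simp: compatible_def)
    have sub: "(T - {X}) \<union> {Z} \<subseteq> S"
      using S(2) Z by auto
    have TZ: "compatible P ((T - {X}) \<union> {Z})"
      using S(1) pairwise_subset[OF Sp sub] sub by (auto simp: compatible_def)
    have YZ: "compatible P {Y, Z}"
      using S Z pairwise_subset[OF Sp, of "{Y, Z}"] by (auto simp: compatible_def)
    have "Z \<noteq> X"
      using YZ T(4) by (auto simp: insert_commute)
    then have nT: "Z \<notin> T"
      using nZ by auto
    show False
    proof (cases "compatible P {X, Z}")
      case True
      have "pairwise (compat P) (insert Z T)"
        unfolding pairwise_insert
      proof (intro conjI allI impI Tp)
        fix W assume W: "W \<in> T \<and> W \<noteq> Z"
        have "compat P W Z"
          using W True TZ by (cases "W = X") (auto simp: compatible_def pairwise_def)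
        then show "compat P Z W" "compat P W Z"
          using W sym ZI TI by blast+
      qed
      then have "compatible P (insert Z T)"
        using TI ZI by (auto simp: compatible_def)
      then show False
        using T(1) nT by (auto simp: cluster_def)
    next
      case False
      then have "exchange P T X Z"
        using T TZ ZI by (auto simp: exchange_def)
      then show False
        using uniq nZ by auto
    qed
  qed
  then show ?thesis
    using T(5) unfolding cluster_def by blast
qed


section \<open>Embeddings\<close>

record ('a, 'b) ct_functor =
  obj :: "'a set \<Rightarrow> 'b set"
  mor :: "'a arrow \<Rightarrow> 'b arrow"

record ('a, 'b) ct_embedding = "('a, 'b) ct_functor" +
  eta :: "'a set \<Rightarrow> 'a \<Rightarrow> 'b"

definition is_functor ::
  "'a pcond \<Rightarrow> 'b pcond \<Rightarrow> ('a, 'b, 'z) ct_functor_scheme \<Rightarrow> bool" where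
  "is_functor P Q F \<longleftrightarrow>
     (\<forall>T. cluster P T \<longrightarrow> cluster Q (obj F T) \<and> mor F (aid T) = aid (obj F T)) \<and>
     (\<forall>f\<in>arrows P. mor F f \<in> arrows Q \<and>
        adom (mor F f) = obj F (adom f) \<and> acod (mor F f) = obj F (acod f)) \<and>
     (\<forall>f\<in>arrows P. \<forall>g\<in>arrows P. acod f = adom g \<longrightarrow>
        mor F (acomp g f) = acomp (mor F g) (mor F f))"

definition is_embedding :: "'a pcond \<Rightarrow> 'b pcond \<Rightarrow> ('a, 'b) ct_embedding \<Rightarrow> bool" where
  "is_embedding P Q F \<longleftrightarrow>
     is_functor P Q F \<and>
     inj_on (obj F) {T. cluster P T} \<and>
     mor F ` mutations P \<subseteq> mutations Q \<and> inj_on (mor F) (mutations P) \<and>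
     (\<forall>T. cluster P T \<longrightarrow> eta F T ` T \<subseteq> obj F T \<and> inj_on (eta F T) T) \<and>
     (\<forall>f\<in>arrows P. \<forall>X\<in>adom f.
        eta F (acod f) (afun f X) = afun (mor F f) (eta F (adom f) X))"

definition is_category_iso ::
  "'a pcond \<Rightarrow> 'b pcond \<Rightarrow> ('a, 'b, 'z) ct_functor_scheme \<Rightarrow> bool" where
  "is_category_iso P Q F \<longleftrightarrow>
     is_functor P Q F \<and>
     (\<exists>G :: ('b, 'a) ct_functor. is_functor Q P G \<and>
        (\<forall>T. cluster P T \<longrightarrow> obj G (obj F T) = T) \<and>
        (\<forall>f\<in>arrows P. mor G (mor F f) = f) \<and>
        (\<forall>T. cluster Q T \<longrightarrow> obj F (obj G T) = T) \<and>
        (\<forall>f\<in>arrows Q. mor F (mor G f) = f))"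

definition is_isomorphism :: "'a pcond \<Rightarrow> 'b pcond \<Rightarrow> ('a, 'b) ct_embedding \<Rightarrow> bool" where
  "is_isomorphism P Q F \<longleftrightarrow>
     is_embedding P Q F \<and> is_category_iso P Q F \<and>
     (\<forall>T. cluster P T \<longrightarrow> bij_betw (eta F T) T (obj F T))"

definition id_emb :: "('a, 'a) ct_embedding" where
  "id_emb = \<lparr>obj = (\<lambda>T. T), mor = (\<lambda>f. f), eta = (\<lambda>T X. X)\<rparr>"

definition comp_emb ::
  "('b, 'c) ct_embedding \<Rightarrow> ('a, 'b) ct_embedding \<Rightarrow> ('a, 'c) ct_embedding" where
  "comp_emb G F = \<lparr>obj = (\<lambda>T. obj G (obj F T)), mor = (\<lambda>f. mor G (mor F f)),
     eta = (\<lambda>T X. eta G (obj F T) (eta F T X))\<rparr>"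

text \<open>Equality of embeddings with source \<open>P\<close>; values outside the source category are
  irrelevant.\<close>

definition emb_eq :: "'a pcond \<Rightarrow> ('a, 'b) ct_embedding \<Rightarrow> ('a, 'b) ct_embedding \<Rightarrow> bool" where
  "emb_eq P F G \<longleftrightarrow>
     (\<forall>T. cluster P T \<longrightarrow> obj F T = obj G T \<and> (\<forall>X\<in>T. eta F T X = eta G T X)) \<and>
     (\<forall>f\<in>arrows P. mor F f = mor G f)"


section \<open>Cluster theories from arcs\<close>

definition pairwise_encoding :: "'a set \<Rightarrow> ('a \<Rightarrow> 'a \<Rightarrow> nat) \<Rightarrow> 'a pcond" where
  "pairwise_encoding A c = \<lparr>Ind = A, compat = (\<lambda>\<alpha> \<beta>. \<alpha> = \<beta> \<or> c \<alpha> \<beta> = 0)\<rparr>"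

definition crossing_A :: "('e \<Rightarrow> 'e \<Rightarrow> bool) \<Rightarrow> 'e \<times> 'e \<Rightarrow> 'e \<times> 'e \<Rightarrow> nat" where
  "crossing_A lt = (\<lambda>(a, b) (a', b').
     if (a, b) = (a', b') \<or> lt a a' \<and> lt a' b \<and> lt b b' \<or> lt a' a \<and> lt a b' \<and> lt b' b
     then 1 else 0)"

definition cond_N :: "nat \<Rightarrow> (int \<times> int) pcond" where
  "cond_N n = pairwise_encoding
     {(a, b). a \<in> {1..int n} \<and> b \<in> {1..int n} \<and> 2 \<le> b - a \<and> b - a \<le> int n - 2}
     (crossing_A (<))"

definition cond_N_inf :: "(int \<times> int) pcond" where
  "cond_N_inf = pairwise_encoding {(a, b). 2 \<le> b - a} (crossing_A (<))"

definition cond_N_extbar :: "(int extended \<times> int extended) pcond" where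
  "cond_N_extbar = pairwise_encoding
     ({(a, b). \<exists>l::int. a < Fin l \<and> Fin l < b} - {(Minf, Pinf)}) (crossing_A (<))"

text \<open>The strict order on copies of a linear order indexed by the second component.\<close>

definition copies_less :: "('p::linorder) \<times> nat \<Rightarrow> 'p \<times> nat \<Rightarrow> bool" where
  "copies_less = (\<lambda>(p, l) (q, r). l < r \<or> l = r \<and> p < q)"

definition arcs_over :: "('e \<Rightarrow> 'e \<Rightarrow> bool) \<Rightarrow> 'e set \<Rightarrow> ('e \<times> 'e) set" where
  "arcs_over lt E = {(a, b). a \<in> E \<and> b \<in> E \<and> (\<exists>c\<in>E. lt a c \<and> lt c b)}"

definition cond_N_copies :: "nat \<Rightarrow> ((int \<times> nat) \<times> (int \<times> nat)) pcond" where
  "cond_N_copies i = pairwise_encoding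
     (arcs_over copies_less (UNIV \<times> {1..i})) (crossing_A copies_less)"

definition cond_N_copiesbar ::
  "nat \<Rightarrow> ((int extended \<times> nat) \<times> (int extended \<times> nat)) pcond" where
  "cond_N_copiesbar i = pairwise_encoding
     (arcs_over copies_less ((UNIV - {Minf}) \<times> {1..i})) (crossing_A copies_less)"

definition cond_N_pi :: "(real \<times> real) pcond" where
  "cond_N_pi = pairwise_encoding
     {(x, y). x \<in> {- pi/2 <.. pi/2} \<and> y \<in> {- pi/2 <.. pi/2} \<and> x < y} (crossing_A (<))"


section \<open>The condition T\<close>

definition Z_zero :: "(real \<times> real) set" where
  "Z_zero = {(x, x) | x. - pi/2 < x \<and> x < pi/2}"

definition Z_one :: "(real \<times> real) set" where
  "Z_one = {(x + pi, - x) | x. (x, x) \<in> Z_zero}"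

definition Ind_Z :: "(real \<times> real) set" where
  "Ind_Z = {(x, y). - pi/2 < y \<and> y < pi/2 \<and>
     (\<exists>x0 x1. (x0, y) \<in> Z_zero \<and> (x1, y) \<in> Z_one \<and> x0 \<le> x \<and> x \<le> x1)}"

text \<open>The filled rectangle with left corner \<open>p\<close>, sides of slope 1 with horizontal extent \<open>s\<close>
  and sides of slope -1 with horizontal extent \<open>t\<close>; its right corner is
  \<open>p + (s + t, s - t)\<close>.\<close>

definition slope_rectangle :: "real \<times> real \<Rightarrow> real \<Rightarrow> real \<Rightarrow> (real \<times> real) set" where
  "slope_rectangle p s t =
     {(fst p + a + b, snd p + a - b) | a b. 0 \<le> a \<and> a \<le> s \<and> 0 \<le> b \<and> b \<le> t}"

definition rectangle_between :: "real \<times> real \<Rightarrow> real \<times> real \<Rightarrow> bool" where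
  "rectangle_between p q \<longleftrightarrow> (\<exists>s t. 0 < s \<and> 0 < t \<and>
     q = (fst p + s + t, snd p + s - t) \<and>
     slope_rectangle p s t \<subseteq>
       Ind_Z \<union> {(pi/2, pi/2)} \<union> {(x, - pi/2) | x. - pi/2 \<le> x \<and> x \<le> 3 * pi/2})"

definition cond_T :: "(real \<times> real) pcond" where
  "cond_T = \<lparr>Ind = Ind_Z,
     compat = (\<lambda>p q. \<not> (rectangle_between p q \<or> rectangle_between q p))\<rparr>"


section \<open>The condition E\<close>

text \<open>An interval \<open>I\<close> stands for the indecomposable representation \<open>M_I\<close>; the indecomposable
  projectives are those whose interval is a nonempty lower set. The split Grothendieck group is free on the indecomposables.\<close>

type_synonym K0_split = "real set \<Rightarrow>\<^sub>0 int"

definition gvec :: "real set \<Rightarrow> K0_split" where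
  "gvec I = (let P = {x. \<exists>y\<in>I. x \<le> y}; P' = {x. \<forall>y\<in>I. x < y} in
     Poly_Mapping.single P 1 - (if P' = {} then 0 else Poly_Mapping.single P' 1))"

text \<open>The dimension of the space of morphisms between two indecomposable projectives. All
  g-vectors are supported on projectives, so the pairing is only ever needed there.\<close>

definition hom_dim :: "real set \<Rightarrow> real set \<Rightarrow> int" where
  "hom_dim P Q = (if P \<subseteq> Q then 1 else 0)"

definition pairing :: "K0_split \<Rightarrow> K0_split \<Rightarrow> int" where
  "pairing v w = (\<Sum>P\<in>Poly_Mapping.keys v. \<Sum>Q\<in>Poly_Mapping.keys w.
     Poly_Mapping.lookup v P * Poly_Mapping.lookup w Q * hom_dim P Q)"

definition cond_E :: "real set pcond" where
  "cond_E = \<lparr>Ind = {I. is_interval I \<and> I \<noteq> {}},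
     compat = (\<lambda>I J. pairing (gvec I) (gvec J) \<ge> 0 \<and> pairing (gvec J) (gvec I) \<ge> 0)\<rparr>"


section \<open>Diagrams of cluster theories\<close>

text \<open>To speak about arbitrary directed paths through cluster theories on different types of
  indecomposables, all of them are moved to one type by tagging the indecomposables with an
  injective constructor.\<close>

datatype indec =
    Int_Arc "int \<times> int"
  | Ext_Arc "int extended \<times> int extended"
  | Copies_Arc "(int \<times> nat) \<times> (int \<times> nat)"
  | Copiesbar_Arc "(int extended \<times> nat) \<times> (int extended \<times> nat)"
  | Pi_Arc "real \<times> real"
  | Z_Point "real \<times> real"
  | Interval "real set"

definition relabel :: "('a \<Rightarrow> 'b) \<Rightarrow> 'a pcond \<Rightarrow> 'b pcond" where
  "relabel c P = \<lparr>Ind = c ` Ind P,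
     compat = (\<lambda>U V. \<exists>X\<in>Ind P. \<exists>Y\<in>Ind P. U = c X \<and> V = c Y \<and> compat P X Y)\<rparr>"

datatype vertex =
    N nat
  | N_inf
  | N_extbar
  | N_copies nat
  | N_copiesbar nat
  | N_pi
  | E_R
  | T_Z

fun cond :: "vertex \<Rightarrow> indec pcond" where
  "cond (N n) = relabel Int_Arc (cond_N n)"
| "cond N_inf = relabel Int_Arc cond_N_inf"
| "cond N_extbar = relabel Ext_Arc cond_N_extbar"
| "cond (N_copies i) = relabel Copies_Arc (cond_N_copies i)"
| "cond (N_copiesbar i) = relabel Copiesbar_Arc (cond_N_copiesbar i)"
| "cond N_pi = relabel Pi_Arc cond_N_pi"
| "cond E_R = relabel Interval cond_E"
| "cond T_Z = relabel Z_Point cond_T"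

type_synonym diagram = "vertex \<Rightarrow> vertex \<Rightarrow> (indec, indec) ct_embedding"

text \<open>\<open>path_composite A D u v F\<close>: \<open>F\<close> is the composite of \<open>D\<close> along some directed path from \<open>u\<close>
  to \<open>v\<close> with arrows in \<open>A\<close>. The empty path is included, so a loop has to be the identity.\<close>

inductive path_composite ::
  "(vertex \<times> vertex) set \<Rightarrow> diagram \<Rightarrow> vertex \<Rightarrow> vertex \<Rightarrow> (indec, indec) ct_embedding \<Rightarrow> bool"
  for A D where
  empty: "path_composite A D u u id_emb"
| step: "path_composite A D u v F \<Longrightarrow> (v, w) \<in> A \<Longrightarrow>
    path_composite A D u w (comp_emb (D v w) F)"

definition commutative_diagram :: "(vertex \<times> vertex) set \<Rightarrow> diagram \<Rightarrow> bool" where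
  "commutative_diagram A D \<longleftrightarrow>
     (\<forall>(u, v)\<in>A. is_embedding (cond u) (cond v) (D u v)) \<and>
     (\<forall>u v F G. path_composite A D u v F \<and> path_composite A D u v G \<longrightarrow> emb_eq (cond u) F G)"

end

theory Submission
  imports Defs
begin

text \<open>Every condition of the diagram is a noncrossing condition: its indecomposables are arcs, that is
pairs of points of a linear order, and two arcs are incompatible iff their end points interlace.
For \<open>E\<close> the arc of an interval joins its lower cut to its upper cut, and for \<open>T\<close> the arc of \<open>(x, y)\<close>
joins \<open>x - y\<close> to \<open>x + y + pi\<close>. In these two cases arcs that merely touch are incompatible too,
which becomes ordinary crossing once the left end at a point is placed just before the right end at
the same point.

An embedding is built from an injection \<open>f\<close> of arcs that preserves and reflects crossing, and from
a way to complete \<open>f ` T\<close> to a cluster \<open>K T\<close> of the target for each cluster \<open>T\<close> of the source. All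
that is needed is that \<open>K T - f ` T\<close> does not change when \<open>T\<close> is mutated (\<open>is_embedding_emb_of\<close>).
The completion is greedy: a fixed set \<open>R\<close> of arcs is adjoined to \<open>f ` T\<close>, and then every arc compatible
with \<open>f ` T \<union> R\<close> is admitted that is compatible with the arcs admitted before it, relative to a
well-founded relation. This depends on \<open>T\<close> only through the set of arcs compatible with
\<open>f ` T \<union> R\<close>. A mutation exchanges the two diagonals of a quadrilateral whose sides are in \<open>T\<close> or
crossed by no candidate, and an arc that crosses one diagonal and no side is the other diagonal; hence the
candidates other than the two diagonals are the same before and after the mutation
(\<open>greedy_cluster_map\<close>).

Commutativity comes from a cocone. All vertices of a component are completed into one ambient
condition, \<open>E\<close> respectively \<open>T\<close>, by maps \<open>(k v, K v)\<close>, and the arrow from \<open>v\<close> to \<open>w\<close> sends \<open>T\<close> to the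
preimage of \<open>K v T\<close> under \<open>k w\<close>. Since \<open>K w\<close> is injective on clusters, parallel paths then agree
automatically (\<open>cocone_commutes\<close>). What remains for an arrow is that this preimage is a cluster of
\<open>w\<close> and that its completion is \<open>K v T\<close> again; this property is transitive, so it suffices to
consider a few short arrows.

The vertices other than \<open>N_pi\<close>, \<open>E_R\<close> and \<open>T_Z\<close> live in one descending chain of copies of the
integers, each with a limit point at its upper end. Copies are counted from the top, so passing
to more copies adds copies below and moves nothing. Unused copies are filled with zigzags, which cut them off
from all other arcs. The limit points are then added one after the other, starting at the top.
Arcs at a common limit point share an end and so do not cross; therefore these additions involve no
choice, and the result does not depend on the intermediate vertices through which one passes
(\<open>complete_factors\<close>).\<close>

section \<open>Embeddings from maps of indecomposables\<close>

text \<open>The data from which embeddings are made: a map on indecomposables and a compatible map on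
clusters. Demanding that \<open>K T\<close> meets the image of \<open>f\<close> only in \<open>f ` T\<close> makes \<open>K\<close> injective and keeps
the added elements of \<open>K T\<close> apart from those that get mutated.\<close>

definition cluster_map ::
  "'a pcond \<Rightarrow> 'b pcond \<Rightarrow> ('a \<Rightarrow> 'b) \<Rightarrow> ('a set \<Rightarrow> 'b set) \<Rightarrow> bool" where
  "cluster_map P Q f K \<longleftrightarrow>
     f ` Ind P \<subseteq> Ind Q \<and> inj_on f (Ind P) \<and>
     (\<forall>X\<in>Ind P. \<forall>Y\<in>Ind P. compat Q (f X) (f Y) \<longleftrightarrow> compat P X Y) \<and>
     (\<forall>T. cluster P T \<longrightarrow> cluster Q (K T) \<and> K T \<inter> f ` Ind P = f ` T) \<and>
     (\<forall>T X Y. exchange P T X Y \<longrightarrow> exchange Q (K T) (f X) (f Y) \<and>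
        K ((T - {X}) \<union> {Y}) = (K T - {f X}) \<union> {f Y})"

definition mutation_closed :: "'a pcond \<Rightarrow> bool" where
  "mutation_closed P \<longleftrightarrow> (\<forall>T X Y. exchange P T X Y \<longrightarrow> cluster P ((T - {X}) \<union> {Y}))"

text \<open>On an arrow the elements \<open>f X\<close> move as \<open>X\<close> does, while the added elements stay fixed.\<close>

definition emb_of :: "('a \<Rightarrow> 'b) \<Rightarrow> ('a set \<Rightarrow> 'b set) \<Rightarrow> ('a, 'b) ct_embedding" where
  "emb_of f K = \<lparr>obj = K,
     mor = (\<lambda>a. (K (adom a),
       restrict (\<lambda>Z. if Z \<in> f ` adom a then f (afun a (inv_into (adom a) f Z)) else Z)
         (K (adom a)),
       K (acod a))),
     eta = (\<lambda>T. f)\<rparr>"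

lemma induces_mutation_closed: "induces_cluster_theory P \<Longrightarrow> mutation_closed P"
  using cluster_exchange by (auto simp: mutation_closed_def)

lemma clusterD:
  assumes "cluster P T"
  shows "T \<subseteq> Ind P" "X \<in> T \<Longrightarrow> Y \<in> T \<Longrightarrow> X \<noteq> Y \<Longrightarrow> compat P X Y"
  using assms by (auto simp: cluster_def compatible_def pairwise_def)

lemma exchangeD:
  assumes "exchange P T X Y"
  shows "cluster P T" "X \<in> T" "Y \<in> Ind P" "X \<in> Ind P" "X \<noteq> Y" "Y \<notin> T"
proof -
  show T: "cluster P T" "X \<in> T" "Y \<in> Ind P"
    using assms by (auto simp: exchange_def)
  show "X \<in> Ind P"
    using T clusterD(1) by blast
  then show "X \<noteq> Y"
    using assms by (auto simp: exchange_def compatible_def pairwise_def)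
  then show "Y \<notin> T"
    using assms T clusterD[OF T(1)] by (auto simp: exchange_def compatible_def pairwise_def)
qed

lemma cluster_mapD:
  assumes "cluster_map P Q f K"
  shows "f ` Ind P \<subseteq> Ind Q" "inj_on f (Ind P)"
    "cluster P T \<Longrightarrow> cluster Q (K T)" "cluster P T \<Longrightarrow> K T \<inter> f ` Ind P = f ` T"
    "X \<in> Ind P \<Longrightarrow> Y \<in> Ind P \<Longrightarrow> compat Q (f X) (f Y) \<longleftrightarrow> compat P X Y"
    "exchange P T X Y \<Longrightarrow> exchange Q (K T) (f X) (f Y)"
    "exchange P T X Y \<Longrightarrow> K ((T - {X}) \<union> {Y}) = (K T - {f X}) \<union> {f Y}"
  using assms by (auto simp: cluster_map_def)

lemma cluster_map_subset: "cluster_map P Q f K \<Longrightarrow> cluster P T \<Longrightarrow> f ` T \<subseteq> K T"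
  using cluster_mapD(4) by blast

lemma cluster_map_inj_cluster:
  assumes P: "cluster_map P Q f K" and "cluster P S" "cluster P T" "K S = K T"
  shows "S = T"
proof -
  have "f ` S = f ` T"
    using assms cluster_mapD(4)[OF P] by metis
  then show ?thesis
    using inj_on_image_eq_iff[OF cluster_mapD(2)[OF P]] clusterD(1) assms by metis
qed

lemma cluster_map_id: "cluster_map P P (\<lambda>X. X) (\<lambda>T. T)"
  by (auto simp: cluster_map_def dest: clusterD)

lemma cluster_map_comp:
  assumes P: "cluster_map P Q f K" and Q: "cluster_map Q M g L"
  shows "cluster_map P M (g \<circ> f) (L \<circ> K)"
proof -
  note p = cluster_mapD[OF P] and q = cluster_mapD[OF Q]
  have 1: "(g \<circ> f) ` Ind P \<subseteq> Ind M"
    using p(1) q(1) by fastforce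
  have 2: "inj_on (g \<circ> f) (Ind P)"
    using p(1,2) q(2) by (meson comp_inj_on inj_on_subset)
  have 3: "L (K T) \<inter> (g \<circ> f) ` Ind P = (g \<circ> f) ` T" if T: "cluster P T" for T
  proof -
    have a: "L (K T) \<inter> g ` Ind Q = g ` K T"
      by (rule q(4)[OF p(3)[OF T]])
    have b: "K T \<inter> f ` Ind P = f ` T"
      by (rule p(4)[OF T])
    have "K T \<subseteq> Ind Q"
      using clusterD(1)[OF p(3)[OF T]] .
    then have "g ` K T \<inter> g ` f ` Ind P = g ` (K T \<inter> f ` Ind P)"
      using p(1) inj_on_image_Int[OF q(2)] by metis
    moreover have "L (K T) \<inter> g ` f ` Ind P = (L (K T) \<inter> g ` Ind Q) \<inter> g ` f ` Ind P"
      using p(1) by blast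
    ultimately show ?thesis
      unfolding a b image_comp[symmetric] by simp
  qed
  show ?thesis
    unfolding cluster_map_def
    using 1 2 3 p q by (auto simp: image_subset_iff)
qed

lemma compatible_pair:
  "compatible P {X, Y} \<longleftrightarrow> X \<in> Ind P \<and> Y \<in> Ind P \<and> (X \<noteq> Y \<longrightarrow> compat P X Y \<and> compat P Y X)"
  by (auto simp: compatible_def pairwise_def)

text \<open>An isomorphism of conditions needs no added elements; this serves to rename indecomposables.\<close>

lemma cluster_map_iso:
  assumes f: "bij_betw f (Ind P) (Ind Q)"
    and c: "\<And>X Y. X \<in> Ind P \<Longrightarrow> Y \<in> Ind P \<Longrightarrow> compat Q (f X) (f Y) \<longleftrightarrow> compat P X Y"
  shows "cluster_map P Q f (image f)"
proof -
  have inj: "inj_on f (Ind P)" and im: "f ` Ind P = Ind Q"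
    using f by (auto simp: bij_betw_def)
  have comp: "compatible Q (f ` T) \<longleftrightarrow> compatible P T" if "T \<subseteq> Ind P" for T
  proof -
    have "pairwise (compat Q) (f ` T) \<longleftrightarrow> pairwise (compat P) T"
      unfolding pairwise_image
      using that c inj_on_subset[OF inj that] by (auto simp: pairwise_def inj_on_eq_iff subset_iff)
    then show ?thesis
      using that im by (auto simp: compatible_def)
  qed
  have clus: "cluster Q (f ` T)" if T: "cluster P T" for T
    unfolding cluster_def
  proof (intro conjI allI impI)
    have TI: "T \<subseteq> Ind P"
      using T clusterD(1) by blast
    then show "compatible Q (f ` T)"
      using comp T by (auto simp: cluster_def)
    fix S assume S: "compatible Q S \<and> f ` T \<subseteq> S"
    then have "S \<subseteq> f ` Ind P"
      using im by (auto simp: compatible_def)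
    then obtain S' where S': "S' \<subseteq> Ind P" "S = f ` S'"
      by (rule subset_imageE)
    then have "compatible P S'" "T \<subseteq> S'"
      using S comp inj_on_image_subset_iff[OF inj TI S'(1)] by auto
    then show "S = f ` T"
      using T S' by (auto simp: cluster_def)
  qed
  have im_diff: "f ` ((T - {X}) \<union> {Y}) = (f ` T - {f X}) \<union> {f Y}" 
    if "T \<subseteq> Ind P" "X \<in> T" for T X Y
    using inj_on_image_set_diff[OF inj, of T "{X}"] that by auto
  have ex: "exchange Q (f ` T) (f X) (f Y)" if e: "exchange P T X Y" for T X Y
  proof -
    note x = exchangeD[OF e]
    have TI: "T \<subseteq> Ind P"
      using clusterD(1)[OF x(1)] .
    have "compatible Q (f ` {X, Y}) \<longleftrightarrow> compatible P {X, Y}"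
      using x by (intro comp) auto
    moreover have "compatible Q (f ` ((T - {X}) \<union> {Y})) \<longleftrightarrow> compatible P ((T - {X}) \<union> {Y})"
      using x TI by (intro comp) auto
    ultimately show ?thesis
      using e x im_diff[OF TI x(2), of Y] im clus by (auto simp: exchange_def)
  qed
  show ?thesis
    unfolding cluster_map_def
  proof (intro conjI allI impI ballI)
    show "f ` Ind P \<subseteq> Ind Q" "inj_on f (Ind P)"
      using im inj by auto
    show "compat Q (f X) (f Y) = compat P X Y" if "X \<in> Ind P" "Y \<in> Ind P" for X Y
      using c that by blast
    show "f ` T \<inter> f ` Ind P = f ` T" if "cluster P T" for T
      using clusterD(1)[OF that] by auto
    show "f ` (T - {X} \<union> {Y}) = f ` T - {f X} \<union> {f Y}" if "exchange P T X Y" for T X Y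
      using im_diff exchangeD[OF that] clusterD(1) by metis
  qed (use clus ex in auto)
qed

lemma mutation_closed_iso:
  assumes f: "bij_betw f (Ind P) (Ind Q)"
    and c: "\<And>X Y. X \<in> Ind P \<Longrightarrow> Y \<in> Ind P \<Longrightarrow> compat Q (f X) (f Y) \<longleftrightarrow> compat P X Y"
    and Q: "mutation_closed Q"
  shows "mutation_closed P"
  unfolding mutation_closed_def
proof (intro allI impI)
  fix T X Y assume e: "exchange P T X Y"
  let ?g = "inv_into (Ind P) f"
  have g: "bij_betw ?g (Ind Q) (Ind P)"
    using f bij_betw_inv_into by blast
  have cg: "compat P (?g X) (?g Y) \<longleftrightarrow> compat Q X Y" if "X \<in> Ind Q" "Y \<in> Ind Q" for X Y
    using c[of "?g X" "?g Y"] that g f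
    by (metis bij_betw_inv_into_right bij_betwE)
  note F = cluster_map_iso[OF f c, simplified]
  have "exchange Q (f ` T) (f X) (f Y)" and eq: "f ` ((T - {X}) \<union> {Y}) = (f ` T - {f X}) \<union> {f Y}"
    using cluster_mapD(6,7)[OF F e] by auto
  then have "cluster Q (f ` ((T - {X}) \<union> {Y}))"
    using Q unfolding mutation_closed_def by metis
  then have "cluster P (?g ` f ` ((T - {X}) \<union> {Y}))"
    using cluster_mapD(3)[OF cluster_map_iso[OF g cg]] by blast
  moreover have "(T - {X}) \<union> {Y} \<subseteq> Ind P"
    using exchangeD[OF e] clusterD(1) by fastforce
  then have "?g ` f ` ((T - {X}) \<union> {Y}) = (T - {X}) \<union> {Y}"
    using f inv_into_image_cancel[of f "Ind P"] by (auto simp: bij_betw_def)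
  ultimately show "cluster P ((T - {X}) \<union> {Y})"
    by simp
qed

lemma arrow_simps [simp]:
  "adom (aid T) = T" "acod (aid T) = T" "afun (aid T) = restrict (\<lambda>X. X) T"
  "adom (mutation T X Y) = T" "acod (mutation T X Y) = (T - {X}) \<union> {Y}"
  "afun (mutation T X Y) = restrict (\<lambda>Z. if Z = X then Y else Z) T"
  "adom (acomp b a) = adom a" "acod (acomp b a) = acod b"
  "afun (acomp b a) = compose (adom a) (afun b) (afun a)"
  by (simp_all add: aid_def mutation_def acomp_def adom_def acod_def afun_def)

text \<open>The last conjunct is the invariant that makes \<open>emb_of\<close> functorial: the elements added to a
cluster depend only on its mutation class. It holds for one mutation because \<open>K\<close> exchanges only
\<open>f X\<close> for \<open>f Y\<close>, and it propagates along composites.\<close>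

lemma arrows_props:
  assumes m: "mutation_closed P" and K: "cluster_map P Q f K" and a: "a \<in> arrows P"
  shows "cluster P (adom a) \<and> cluster P (acod a) \<and> afun a \<in> extensional (adom a) \<and>
    afun a ` adom a \<subseteq> acod a \<and> K (adom a) - f ` adom a = K (acod a) - f ` acod a"
  using a
proof induction
  case (aid T)
  then show ?case
    by (simp add: extensional_def)
next
  case (mut a)
  then obtain T X Y where a: "a = mutation T X Y" and e: "exchange P T X Y"
    by (auto simp: mutations_def)
  note x = exchangeD[OF e]
  have TI: "T \<subseteq> Ind P"
    using clusterD(1)[OF x(1)] .
  note int = cluster_mapD(4)[OF K x(1)] and inj = cluster_mapD(2)[OF K]
  have fY: "f Y \<notin> K T"
    using int x TI inj by (metis IntI imageI inj_on_image_mem_iff)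
  have fT: "f ` (T - {X}) = f ` T - {f X}"
    using inj_on_image_set_diff[OF inj, of T "{X}"] TI x by auto
  have "f X \<in> f ` T"
    using x by auto
  then have "K T - f ` T = K ((T - {X}) \<union> {Y}) - f ` ((T - {X}) \<union> {Y})"
    unfolding cluster_mapD(7)[OF K e] image_Un fT using fY by auto
  then show ?case
    using m x e unfolding a mutation_closed_def by (auto simp: extensional_def)
next
  case (acomp a b)
  then have "afun b (afun a X) \<in> acod b" if "X \<in> adom a" for X
    using that by blast
  with acomp show ?case
    by (auto simp: compose_def extensional_def)
qed

lemma arrow_eqI: "adom a = adom b \<Longrightarrow> acod a = acod b \<Longrightarrow> afun a = afun b \<Longrightarrow> a = b"
  by (auto simp: adom_def acod_def afun_def prod_eq_iff)

lemma emb_of_simps [simp]: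
  "obj (emb_of f K) = K"
  "adom (mor (emb_of f K) a) = K (adom a)"
  "acod (mor (emb_of f K) a) = K (acod a)"
  "eta (emb_of f K) T = f"
  by (auto simp: emb_of_def adom_def acod_def)

lemma afun_emb_of:
  "afun (mor (emb_of f K) a) =
     restrict (\<lambda>Z. if Z \<in> f ` adom a then f (afun a (inv_into (adom a) f Z)) else Z) (K (adom a))"
  by (auto simp: emb_of_def afun_def)

lemma afun_emb_of_image:
  assumes "cluster_map P Q f K" "cluster P (adom a)" "X \<in> adom a"
  shows "afun (mor (emb_of f K) a) (f X) = f (afun a X)"
proof -
  have "inj_on f (adom a)"
    using assms clusterD(1) cluster_mapD(2) by (meson inj_on_subset)
  moreover have "f X \<in> K (adom a)"
    using assms cluster_map_subset by blast
  ultimately show ?thesis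
    using assms by (auto simp: afun_emb_of)
qed

lemma emb_of_aid:
  assumes K: "cluster_map P Q f K" and T: "cluster P T"
  shows "mor (emb_of f K) (aid T) = aid (K T)"
proof (rule arrow_eqI)
  have "f (inv_into T f Z) = Z" "inv_into T f Z \<in> T" if "Z \<in> f ` T" for Z
    using that f_inv_into_f inv_into_into by metis+
  then show "afun (mor (emb_of f K) (aid T)) = afun (aid (K T))"
    unfolding afun_emb_of by (auto intro!: restrict_ext)
qed auto

lemma emb_of_mutation:
  assumes K: "cluster_map P Q f K" and e: "exchange P T X Y"
  shows "mor (emb_of f K) (mutation T X Y) = mutation (K T) (f X) (f Y)"
proof (rule arrow_eqI)
  note x = exchangeD[OF e]
  have TI: "T \<subseteq> Ind P"
    using clusterD(1)[OF x(1)] .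
  have inj: "inj_on f T"
    using inj_on_subset[OF cluster_mapD(2)[OF K] TI] .
  have "(if Z \<in> f ` T then f (restrict (\<lambda>Z. if Z = X then Y else Z) T (inv_into T f Z)) else Z) =
      (if Z = f X then f Y else Z)" if "Z \<in> K T" for Z
    using inj x(2) by (auto simp: inj_on_eq_iff)
  then show "afun (mor (emb_of f K) (mutation T X Y)) = afun (mutation (K T) (f X) (f Y))"
    unfolding afun_emb_of arrow_simps by (intro restrict_ext)
  show "acod (mor (emb_of f K) (mutation T X Y)) = acod (mutation (K T) (f X) (f Y))"
    using cluster_mapD(7)[OF K e] by simp
qed simp

lemma emb_of_acomp:
  assumes m: "mutation_closed P" and K: "cluster_map P Q f K"
    and a: "a \<in> arrows P" and b: "b \<in> arrows P" and ab: "acod a = adom b"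
  shows "mor (emb_of f K) (acomp b a) = acomp (mor (emb_of f K) b) (mor (emb_of f K) a)"
proof (rule arrow_eqI)
  note pa = arrows_props[OF m K a] and pb = arrows_props[OF m K b]
  have inj: "inj_on f (adom a)" "inj_on f (adom b)"
    using clusterD(1) cluster_mapD(2)[OF K] inj_on_subset pa pb by metis+
  have ext: "K (adom a) - f ` adom a = K (adom b) - f ` adom b" and im: "afun a ` adom a \<subseteq> adom b"
    using pa ab by auto
  have sub: "f ` adom b \<subseteq> K (adom b)"
    using cluster_map_subset[OF K] pb by blast
  show "afun (mor (emb_of f K) (acomp b a)) =
      afun (acomp (mor (emb_of f K) b) (mor (emb_of f K) a))"
  proof
    fix Z
    have l: "afun (mor (emb_of f K) (acomp b a)) Z = (if Z \<in> K (adom a) then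
       if Z \<in> f ` adom a then f (compose (adom a) (afun b) (afun a) (inv_into (adom a) f Z)) else Z
       else undefined)"
      unfolding afun_emb_of by (simp add: restrict_def)
    have r: "afun (acomp (mor (emb_of f K) b) (mor (emb_of f K) a)) Z = (if Z \<in> K (adom a) then
       afun (mor (emb_of f K) b) (afun (mor (emb_of f K) a) Z) else undefined)"
      by (simp add: compose_def)
    consider "Z \<notin> K (adom a)" | X where "X \<in> adom a" "Z = f X" | "Z \<in> K (adom a) - f ` adom a"
      by auto
    then show "afun (mor (emb_of f K) (acomp b a)) Z =
        afun (acomp (mor (emb_of f K) b) (mor (emb_of f K) a)) Z"
    proof cases
      case 1
      then show ?thesis unfolding l r by simp
    next
      case 2
      have "f X \<in> K (adom a)"
        using cluster_map_subset[OF K] pa 2 by blast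
      moreover have "afun a X \<in> adom b"
        using im 2 by auto
      ultimately show ?thesis
        unfolding l r using 2 inj pa pb
        by (simp add: afun_emb_of_image[OF K] compose_def)
    next
      case 3
      then have "Z \<in> K (adom b) - f ` adom b"
        using ext by simp
      then show ?thesis
        unfolding l r using 3 by (simp add: afun_emb_of)
    qed
  qed
qed auto

lemma emb_of_mor_inj:
  assumes m: "mutation_closed P" and K: "cluster_map P Q f K"
  shows "inj_on (mor (emb_of f K)) (arrows P)"
proof (rule inj_onI)
  fix a b assume a: "a \<in> arrows P" and b: "b \<in> arrows P"
    and eq: "mor (emb_of f K) a = mor (emb_of f K) b"
  note pa = arrows_props[OF m K a] and pb = arrows_props[OF m K b]
  have "K (adom a) = K (adom b)" "K (acod a) = K (acod b)"
    using arg_cong[OF eq, of adom] arg_cong[OF eq, of acod] by auto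
  then have d: "adom a = adom b" and c: "acod a = acod b"
    using cluster_map_inj_cluster[OF K] pa pb by auto
  have "afun a = afun b"
  proof
    fix X show "afun a X = afun b X"
    proof (cases "X \<in> adom a")
      case True
      then have "f (afun a X) = f (afun b X)"
        using afun_emb_of_image[OF K, of a X] afun_emb_of_image[OF K, of b X] pa pb d eq by simp
      moreover have "afun a X \<in> Ind P" "afun b X \<in> Ind P"
        using True pa pb d clusterD(1) by blast+
      ultimately show ?thesis
        using cluster_mapD(2)[OF K] by (auto dest: inj_onD)
    next
      case False
      then show ?thesis
        using pa pb d by (auto simp: extensional_def)
    qed
  qed
  then show "a = b"
    using c d arrow_eqI by metis
qed

lemma is_functor_emb_of:
  assumes m: "mutation_closed P" and K: "cluster_map P Q f K"
  shows "is_functor P Q (emb_of f K)"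
proof -
  have "mor (emb_of f K) a \<in> arrows Q" if "a \<in> arrows P" for a
    using that
  proof induction
    case (aid T)
    then show ?case
      using emb_of_aid[OF K] cluster_mapD(3)[OF K] arrows.aid by metis
  next
    case (mut a)
    then obtain T X Y where a: "a = mutation T X Y" and e: "exchange P T X Y"
      by (auto simp: mutations_def)
    show ?case
      using cluster_mapD(6)[OF K e] unfolding a emb_of_mutation[OF K e]
      by (intro arrows.mut) (auto simp: mutations_def)
  next
    case (acomp a b)
    then show ?case
      using emb_of_acomp[OF m K] arrows.acomp[of _ Q] by simp
  qed
  then show ?thesis
    unfolding is_functor_def
    using emb_of_aid[OF K] emb_of_acomp[OF m K] cluster_mapD(3)[OF K] by auto
qed

lemma is_embedding_emb_of:
  assumes m: "mutation_closed P" and K: "cluster_map P Q f K"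
  shows "is_embedding P Q (emb_of f K)"
  unfolding is_embedding_def
proof (intro conjI allI impI ballI)
  show "is_functor P Q (emb_of f K)"
    using is_functor_emb_of assms .
  show "inj_on (obj (emb_of f K)) {T. cluster P T}"
    using cluster_map_inj_cluster[OF K] by (auto simp: inj_on_def)
  show "mor (emb_of f K) ` mutations P \<subseteq> mutations Q"
    using emb_of_mutation[OF K] cluster_mapD(6)[OF K] by (fastforce simp: mutations_def)
  show "inj_on (mor (emb_of f K)) (mutations P)"
    using emb_of_mor_inj[OF m K] by (rule inj_on_subset) (auto intro: arrows.mut)
  fix T assume T: "cluster P T"
  show "eta (emb_of f K) T ` T \<subseteq> obj (emb_of f K) T"
    using cluster_map_subset[OF K T] by simp
  show "inj_on (eta (emb_of f K) T) T"
    using inj_on_subset[OF cluster_mapD(2)[OF K] clusterD(1)[OF T]] by simp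
next
  fix a X assume a: "a \<in> arrows P" "X \<in> adom a"
  show "eta (emb_of f K) (acod a) (afun a X) =
      afun (mor (emb_of f K) a) (eta (emb_of f K) (adom a) X)"
    using afun_emb_of_image[OF K _ a(2)] arrows_props[OF m K a(1)] by simp
qed

lemma mor_emb_of_cong:
  assumes m: "mutation_closed P" and f: "cluster_map P Q f K" and g: "cluster_map P Q g L"
    and fg: "\<And>X. X \<in> Ind P \<Longrightarrow> f X = g X" and KL: "\<And>T. cluster P T \<Longrightarrow> K T = L T"
    and a: "a \<in> arrows P"
  shows "mor (emb_of f K) a = mor (emb_of g L) a"
proof (rule arrow_eqI)
  note p = arrows_props[OF m f a]
  have sub: "adom a \<subseteq> Ind P" "acod a \<subseteq> Ind P"
    using p clusterD(1) by metis+
  have im: "f ` adom a = g ` adom a"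
    using fg sub by (intro image_cong) auto
  show "afun (mor (emb_of f K) a) = afun (mor (emb_of g L) a)"
  proof
    fix Z
    have K: "K (adom a) = L (adom a)"
      using KL[of "adom a"] p by simp
    consider X where "X \<in> adom a" "Z = f X" | "Z \<notin> f ` adom a"
      by auto
    then show "afun (mor (emb_of f K) a) Z = afun (mor (emb_of g L) a) Z"
    proof cases
      case 1
      then have "X \<in> Ind P" "afun a X \<in> Ind P"
        using sub p by blast+
      then have "Z = g X" "f (afun a X) = g (afun a X)"
        using fg 1 by auto
      then show ?thesis
        using 1 afun_emb_of_image[OF f _ 1(1)] afun_emb_of_image[OF g _ 1(1)] p by metis
    next
      case 2
      then show ?thesis
        using K im by (simp add: afun_emb_of)
    qed
  qed
qed (use arrows_props[OF m f a] KL in auto)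

lemma comp_emb_of_mor:
  assumes m: "mutation_closed P" and K: "cluster_map P Q f K" and L: "cluster_map Q M g L"
    and a: "a \<in> arrows P"
  shows "mor (emb_of g L) (mor (emb_of f K) a) = mor (emb_of (g \<circ> f) (L \<circ> K)) a"
proof (rule arrow_eqI)
  note p = arrows_props[OF m K a]
  note GF = cluster_map_comp[OF K L]
  have d: "cluster Q (K (adom a))"
    using cluster_mapD(3)[OF K] p by blast
  show "afun (mor (emb_of g L) (mor (emb_of f K) a)) = afun (mor (emb_of (g \<circ> f) (L \<circ> K)) a)"
  proof
    fix Z
    consider X where "X \<in> adom a" "Z = g (f X)"
      | W where "W \<in> K (adom a)" "W \<notin> f ` adom a" "Z = g W"
      | "Z \<notin> g ` K (adom a)"
      by auto
    then show "afun (mor (emb_of g L) (mor (emb_of f K) a)) Z =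
        afun (mor (emb_of (g \<circ> f) (L \<circ> K)) a) Z"
    proof cases
      case 1
      have "f X \<in> K (adom a)"
        using 1 cluster_map_subset[OF K] p by blast
      then show ?thesis
        using 1 p d afun_emb_of_image[OF K] afun_emb_of_image[OF L, of "mor (emb_of f K) a" "f X"]
          afun_emb_of_image[OF GF, of a X]
        by simp
    next
      case 2
      have "Z \<in> L (K (adom a))"
        using 2 cluster_map_subset[OF L d] by blast
      moreover have "Z \<notin> (g \<circ> f) ` adom a"
      proof
        assume "Z \<in> (g \<circ> f) ` adom a"
        then obtain X where X: "X \<in> adom a" "g W = g (f X)"
          using 2 by auto
        then have "f X \<in> K (adom a)"
          using cluster_map_subset[OF K] p by blast
        then have "W = f X"
          using 2 X clusterD(1)[OF d] inj_onD[OF cluster_mapD(2)[OF L]] by blast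
        then show False
          using 2 X by blast
      qed
      ultimately show ?thesis
        using 2 d afun_emb_of_image[OF L, of "mor (emb_of f K) a" W]
        by (simp add: afun_emb_of)
    next
      case 3
      moreover have "Z \<notin> (g \<circ> f) ` adom a"
        using 3 cluster_map_subset[OF K] p by fastforce
      ultimately show ?thesis
        by (simp add: afun_emb_of)
    qed
  qed
qed (auto simp: comp_def)

lemma emb_of_id_mor:
  assumes m: "mutation_closed P" and a: "a \<in> arrows P"
  shows "mor (emb_of (\<lambda>X. X) (\<lambda>T. T)) a = a"
proof (rule arrow_eqI)
  have "inv_into (adom a) (\<lambda>x. x) Z = Z" if "Z \<in> adom a" for Z
    using that inv_into_f_f[of "\<lambda>x. x"] by auto
  then show "afun (mor (emb_of (\<lambda>X. X) (\<lambda>T. T)) a) = afun a"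
    using arrows_props[OF m cluster_map_id a] unfolding afun_emb_of
    by (auto simp: restrict_def extensional_def)
qed auto

lemma is_isomorphism_emb_of:
  assumes f: "bij_betw f (Ind P) (Ind Q)" and m: "mutation_closed P"
    and K: "cluster_map P Q f K"
  shows "is_isomorphism P Q (emb_of f K)"
proof -
  let ?g = "inv_into (Ind P) f"
  have im: "f ` Ind P = Ind Q"
    using f by (auto simp: bij_betw_def)
  have KT: "K T = f ` T" if T: "cluster P T" for T
  proof -
    have "K T \<subseteq> Ind Q"
      using clusterD(1)[OF cluster_mapD(3)[OF K T]] .
    then show ?thesis
      using cluster_mapD(4)[OF K T] im by auto
  qed
  note c = cluster_mapD(5)[OF K]
  have g: "bij_betw ?g (Ind Q) (Ind P)"
    using f bij_betw_inv_into by blast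
  have gf: "?g (f X) = X" if "X \<in> Ind P" for X
    using bij_betw_inv_into_left[OF f that] .
  have fg: "f (?g X) = X" if "X \<in> Ind Q" for X
    using f that bij_betw_inv_into_right by metis
  have cg: "compat P (?g X) (?g Y) \<longleftrightarrow> compat Q X Y" if "X \<in> Ind Q" "Y \<in> Ind Q" for X Y
    using c[of "?g X" "?g Y"] that fg bij_betwE[OF g] by metis
  have G: "cluster_map Q P ?g (image ?g)"
    using cluster_map_iso[OF g cg] .
  have mQ: "mutation_closed Q"
    using mutation_closed_iso[OF g cg m] .
  have gfT: "?g ` K T = T" if T: "cluster P T" for T
    using KT[OF T] clusterD(1)[OF T] gf by (force simp: image_image)
  have fgT: "K (?g ` T) = T" if T: "cluster Q T" for T
    using KT[OF cluster_mapD(3)[OF G T]] clusterD(1)[OF T] fg by (force simp: image_image)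
  have 1: "mor (emb_of ?g (image ?g)) (mor (emb_of f K) a) = a" if a: "a \<in> arrows P" for a
    using comp_emb_of_mor[OF m K G a] emb_of_id_mor[OF m a]
      mor_emb_of_cong[OF m cluster_map_comp[OF K G] cluster_map_id _ _ a] gf gfT
    by simp
  have 2: "mor (emb_of f K) (mor (emb_of ?g (image ?g)) a) = a" if a: "a \<in> arrows Q" for a
    using comp_emb_of_mor[OF mQ G K a] emb_of_id_mor[OF mQ a]
      mor_emb_of_cong[OF mQ cluster_map_comp[OF G K] cluster_map_id _ _ a] fg fgT
    by simp
  let ?G = "\<lparr>obj = obj (emb_of ?g (image ?g)), mor = mor (emb_of ?g (image ?g))\<rparr>"
  have "is_functor Q P ?G"
    using is_functor_emb_of[OF mQ G] by (simp add: is_functor_def)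
  then have "is_category_iso P Q (emb_of f K)"
    unfolding is_category_iso_def
    using is_functor_emb_of[OF m K] 1 2 gfT fgT by (intro conjI exI[of _ ?G]) auto
  moreover have "bij_betw (eta (emb_of f K) T) T (obj (emb_of f K) T)" if T: "cluster P T" for T
    using KT[OF T] inj_on_subset[OF cluster_mapD(2)[OF K] clusterD(1)[OF T]]
    by (simp add: bij_betw_def)
  ultimately show ?thesis
    using is_embedding_emb_of[OF m K] by (auto simp: is_isomorphism_def)
qed

section \<open>Diagrams from cocones\<close>

text \<open>Here \<open>(k, K)\<close> and \<open>(l, L)\<close> are completions of \<open>P\<close> and \<open>Q\<close> in the same ambient condition. The completion
of \<open>P\<close> passes through \<open>Q\<close> if what a completed cluster leaves in \<open>Q\<close> is already a cluster and knows
the whole completion.\<close>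

definition factors ::
  "'a pcond \<Rightarrow> ('a \<Rightarrow> 'm) \<Rightarrow> ('a set \<Rightarrow> 'm set) \<Rightarrow> 'b pcond \<Rightarrow> ('b \<Rightarrow> 'm) \<Rightarrow> ('b set \<Rightarrow> 'm set) \<Rightarrow> bool"
  where
  "factors P k K Q l L \<longleftrightarrow> k ` Ind P \<subseteq> l ` Ind Q \<and>
     (\<forall>T. cluster P T \<longrightarrow>
        cluster Q {Z \<in> Ind Q. l Z \<in> K T} \<and> L {Z \<in> Ind Q. l Z \<in> K T} = K T)"

lemma factorsD:
  assumes "factors P k K Q l L"
  shows "k ` Ind P \<subseteq> l ` Ind Q" "cluster P T \<Longrightarrow> cluster Q {Z \<in> Ind Q. l Z \<in> K T}"
    "cluster P T \<Longrightarrow> L {Z \<in> Ind Q. l Z \<in> K T} = K T"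
  using assms by (auto simp: factors_def)

lemma cluster_map_preimage:
  assumes "cluster_map P M k K" "cluster P T"
  shows "{Z \<in> Ind P. k Z \<in> K T} = T"
proof -
  have "X \<in> T \<longleftrightarrow> k X \<in> k ` T" if "X \<in> Ind P" for X
    using inj_on_image_mem_iff[OF cluster_mapD(2)[OF assms(1)] that clusterD(1)[OF assms(2)]] by simp
  then show ?thesis
    using cluster_mapD(4)[OF assms] clusterD(1)[OF assms(2)] by blast
qed

text \<open>The map into \<open>Q\<close> inherits everything from the ambient condition: an exchange there restricts to an
exchange in \<open>Q\<close> because \<open>l\<close> reflects compatibility.\<close>

lemma cluster_map_of_factors:
  assumes P: "cluster_map P M k K" and Q: "cluster_map Q M l L" and F: "factors P k K Q l L"
  shows "cluster_map P Q (inv_into (Ind Q) l \<circ> k) (\<lambda>T. {Z \<in> Ind Q. l Z \<in> K T})"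
proof -
  let ?f = "inv_into (Ind Q) l \<circ> k" and ?G = "\<lambda>T. {Z \<in> Ind Q. l Z \<in> K T}"
  note p = cluster_mapD[OF P] and q = cluster_mapD[OF Q] and d = factorsD[OF F]
  have f: "?f X \<in> Ind Q" "l (?f X) = k X" if "X \<in> Ind P" for X
    using d(1) that f_inv_into_f[of "k X" l "Ind Q"] inv_into_into[of "k X" l "Ind Q"] by auto
  have iff: "Z = ?f X \<longleftrightarrow> l Z = k X" if "X \<in> Ind P" "Z \<in> Ind Q" for X Z
    using f[OF that(1)] q(2) that(2) by (metis inj_onD)
  have c: "compat Q (?f X) (?f Y) \<longleftrightarrow> compat P X Y" if "X \<in> Ind P" "Y \<in> Ind P" for X Y
    using q(5)[of "?f X" "?f Y"] p(5) f that by simp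
  show ?thesis
    unfolding cluster_map_def
  proof (intro conjI allI impI ballI)
    show "?f ` Ind P \<subseteq> Ind Q"
      using f by blast
    show "inj_on ?f (Ind P)"
      using f(2) p(2) by (metis inj_onD inj_onI)
    show "compat Q (?f X) (?f Y) = compat P X Y" if "X \<in> Ind P" "Y \<in> Ind P" for X Y
      using c that .
    show "cluster Q (?G T)" if "cluster P T" for T
      using d(2) that .
    show "?G T \<inter> ?f ` Ind P = ?f ` T" if T: "cluster P T" for T
    proof -
      have "X \<in> T \<longleftrightarrow> X \<in> Ind P \<and> k X \<in> K T" for X
        using cluster_map_preimage[OF P T] by blast
      then show ?thesis
        using f by auto
    qed
    fix T X Y assume e: "exchange P T X Y"
    note x = exchangeD[OF e] and e' = p(6)[OF e] and K' = p(7)[OF e]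
    show G: "?G (T - {X} \<union> {Y}) = ?G T - {?f X} \<union> {?f Y}"
      unfolding K' using iff[OF x(4)] iff[OF x(3)] f x by auto
    have "cluster Q (?G T)"
      using d(2) x(1) .
    moreover have "\<not> compatible Q {?f X, ?f Y}"
      using e' x c f p(5) unfolding exchange_def compatible_pair
      by (metis clusterD(1) exchangeD(2) e' subsetD)
    moreover have "compatible Q (?G T - {?f X} \<union> {?f Y})"
    proof -
      have "cluster M (K T)" "K T - {k X} \<union> {k Y} \<subseteq> Ind M" "pairwise (compat M) (K T - {k X} \<union> {k Y})"
        using e' by (auto simp: exchange_def compatible_def)
      have "pairwise (compat Q) (?G (T - {X} \<union> {Y}))"
      proof (rule pairwiseI)
        fix U W assume UW: "U \<in> ?G (T - {X} \<union> {Y})" "W \<in> ?G (T - {X} \<union> {Y})" "U \<noteq> W"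
        then have "l U \<in> K T - {k X} \<union> {k Y}" "l W \<in> K T - {k X} \<union> {k Y}" "l U \<noteq> l W"
          using inj_onD[OF q(2)] unfolding K' by blast+
        then have "compat M (l U) (l W)"
          using \<open>pairwise (compat M) _\<close> unfolding pairwise_def by blast
        then show "compat Q U W"
          using UW q(5) by simp
      qed
      then show ?thesis
        unfolding G using f x by (auto simp: compatible_def)
    qed
    ultimately show "exchange Q (?G T) (?f X) (?f Y)"
      using f x cluster_map_preimage[OF P x(1)] by (auto simp: exchange_def)
  qed
qed

lemma factors_trans:
  assumes 1: "factors P k K Q l L" and 2: "factors Q l L R h H"
  shows "factors P k K R h H"
proof -
  have "cluster R {Z \<in> Ind R. h Z \<in> K T} \<and> H {Z \<in> Ind R. h Z \<in> K T} = K T"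
    if "cluster P T" for T
    using factorsD(2,3)[OF 2 factorsD(2)[OF 1 that]] unfolding factorsD(3)[OF 1 that] by simp
  moreover have "k ` Ind P \<subseteq> h ` Ind R"
    using factorsD(1)[OF 1] factorsD(1)[OF 2] by (rule subset_trans)
  ultimately show ?thesis
    by (simp add: factors_def)
qed

text \<open>A composite completion passes through its middle term.\<close>

lemma factors_comp:
  assumes P: "cluster_map P Q f K" and Q: "cluster_map Q M l L"
  shows "factors P (l \<circ> f) (L \<circ> K) Q l L"
  using cluster_map_preimage[OF Q cluster_mapD(3)[OF P]] cluster_mapD(1,3)[OF P]
  by (auto simp: factors_def)

text \<open>Enlarging the ambient condition along \<open>(h, H)\<close> adds nothing inside the image of \<open>h\<close>, so the
preimages in \<open>Q\<close> do not change.\<close>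

lemma factors_push:
  assumes Q: "cluster_map Q B l L" and M: "cluster_map B M h H" and F: "factors P k K Q l L"
    and P: "cluster_map P B k K"
  shows "factors P (h \<circ> k) (H \<circ> K) Q (h \<circ> l) (H \<circ> L)"
proof -
  have "{Z \<in> Ind Q. (h \<circ> l) Z \<in> (H \<circ> K) T} = {Z \<in> Ind Q. l Z \<in> K T}" if T: "cluster P T" for T
    using cluster_mapD(1)[OF Q] cluster_map_preimage[OF M cluster_mapD(3)[OF P T]] by auto
  then show ?thesis
    using factorsD[OF F] unfolding factors_def by (auto simp: image_comp[symmetric] intro: image_mono)
qed

lemma factors_pull:
  assumes P: "bij_betw a (Ind P') (Ind P)" "\<And>X Y. X \<in> Ind P' \<Longrightarrow> Y \<in> Ind P' \<Longrightarrow> compat P (a X) (a Y) \<longleftrightarrow> compat P' X Y"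
    and Q: "bij_betw b (Ind Q') (Ind Q)" "\<And>X Y. X \<in> Ind Q' \<Longrightarrow> Y \<in> Ind Q' \<Longrightarrow> compat Q (b X) (b Y) \<longleftrightarrow> compat Q' X Y"
    and F: "factors P k K Q l L"
  shows "factors P' (k \<circ> a) (K \<circ> image a) Q' (l \<circ> b) (L \<circ> image b)"
proof -
  note A = cluster_map_iso[OF P]
  let ?c = "inv_into (Ind Q') b"
  have c: "bij_betw ?c (Ind Q) (Ind Q')"
    using bij_betw_inv_into[OF Q(1)] .
  have bc: "b (?c X) = X" if "X \<in> Ind Q" for X
    using bij_betw_inv_into_right[OF Q(1) that] .
  have cc: "compat Q' (?c X) (?c Y) \<longleftrightarrow> compat Q X Y" if "X \<in> Ind Q" "Y \<in> Ind Q" for X Y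
    using Q(2)[of "?c X" "?c Y"] that bc bij_betwE[OF c] by simp
  note C = cluster_map_iso[OF c cc]
  have im: "a ` Ind P' = Ind P" "b ` Ind Q' = Ind Q" "?c ` Ind Q = Ind Q'"
    using P(1) Q(1) c by (auto simp: bij_betw_def)
  have "cluster Q' {Z \<in> Ind Q'. l (b Z) \<in> K (a ` T)} \<and> L (b ` {Z \<in> Ind Q'. l (b Z) \<in> K (a ` T)}) = K (a ` T)"
    if T: "cluster P' T" for T
  proof -
    have T': "cluster P (a ` T)"
      using cluster_mapD(3)[OF A T] .
    have e: "b ` {Z \<in> Ind Q'. l (b Z) \<in> K (a ` T)} = {Z \<in> Ind Q. l Z \<in> K (a ` T)}"
      using im by auto
    have "?c ` {Z \<in> Ind Q. l Z \<in> K (a ` T)} = {Z \<in> Ind Q'. l (b Z) \<in> K (a ` T)}"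
      unfolding e[symmetric] using inv_into_image_cancel[of b "Ind Q'"] Q(1) by (auto simp: bij_betw_def)
    then show ?thesis
      using cluster_mapD(3)[OF C factorsD(2)[OF F T']] factorsD(3)[OF F T'] e by simp
  qed
  then show ?thesis
    using factorsD(1)[OF F] im unfolding factors_def image_comp[symmetric] by auto
qed

definition cocone_diagram ::
  "(vertex \<Rightarrow> indec \<Rightarrow> 'm) \<Rightarrow> (vertex \<Rightarrow> indec set \<Rightarrow> 'm set) \<Rightarrow> diagram" where
  "cocone_diagram k K v w = emb_of (inv_into (Ind (cond w)) (k w) \<circ> k v)
     (\<lambda>T. {Z \<in> Ind (cond w). k w Z \<in> K v T})"

lemma path_composite_from_sink:
  "path_composite A D u v F \<Longrightarrow> u \<notin> fst ` A \<Longrightarrow> v = u \<and> F = id_emb"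
  by (induction rule: path_composite.induct) (auto simp: rev_image_eqI)

text \<open>Along a path from \<open>u\<close> to \<open>v\<close> the composite is \<open>emb_of f G\<close> with \<open>k v \<circ> f = k u\<close> and \<open>K v \<circ> G = K u\<close>.
As \<open>k v\<close> and \<open>K v\<close> are injective, these equations determine \<open>f\<close> and \<open>G\<close>, whatever the path.\<close>

lemma cocone_commutes:
  assumes V: "\<And>v. v \<in> fst ` A \<union> snd ` A \<Longrightarrow> cluster_map (cond v) M (k v) (K v)"
    and m: "\<And>v. v \<in> fst ` A \<Longrightarrow> mutation_closed (cond v)"
    and F: "\<And>v w. (v, w) \<in> A \<Longrightarrow> factors (cond v) (k v) (K v) (cond w) (k w) (K w)"
  shows "commutative_diagram A (cocone_diagram k K)"
proof -
  let ?D = "cocone_diagram k K"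
  let ?f = "\<lambda>v w. inv_into (Ind (cond w)) (k w) \<circ> k v"
  let ?G = "\<lambda>v w T. {Z \<in> Ind (cond w). k w Z \<in> K v T}"
  have D: "?D v w = emb_of (?f v w) (?G v w)" for v w
    by (simp add: cocone_diagram_def)
  have map: "cluster_map (cond v) (cond w) (?f v w) (?G v w)" if "(v, w) \<in> A" for v w
    by (rule cluster_map_of_factors[OF V V F[OF that]]) (use that in \<open>auto simp: rev_image_eqI\<close>)
  define lifted where "lifted u v F f G \<longleftrightarrow>
      cluster_map (cond u) (cond v) f G \<and> emb_eq (cond u) F (emb_of f G) \<and>
      (\<forall>X\<in>Ind (cond u). k v (f X) = k u X) \<and> (\<forall>T. cluster (cond u) T \<longrightarrow> K v (G T) = K u T)"
    for u v F f G
  have liftedD: "cluster_map (cond u) (cond v) f G" "emb_eq (cond u) F (emb_of f G)"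
    "X \<in> Ind (cond u) \<Longrightarrow> k v (f X) = k u X" "cluster (cond u) T \<Longrightarrow> K v (G T) = K u T"
    if "lifted u v F f G" for u v F f G X T
    using that unfolding lifted_def by simp_all
  have path: "v \<in> fst ` A \<union> snd ` A \<and> (\<exists>f G. lifted u v F f G)"
    if "path_composite A ?D u v F" "u \<in> fst ` A" for u v F
    using that
  proof (induction rule: path_composite.induct)
    case (empty u)
    have "mor (emb_of (\<lambda>X. X) (\<lambda>T. T)) a = a" if a: "a \<in> arrows (cond u)" for a
      using emb_of_id_mor[OF m[OF empty] a] .
    then have "emb_eq (cond u) id_emb (emb_of (\<lambda>X. X) (\<lambda>T. T))"
      unfolding emb_eq_def id_emb_def by simp
    then have "lifted u u id_emb (\<lambda>X. X) (\<lambda>T. T)"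
      unfolding lifted_def using cluster_map_id by simp
    then show ?case
      using empty by blast
  next
    case (step u v F w)
    note IH = step.IH[OF step.prems] and vw = map[OF step.hyps(2)]
      and fa = factorsD[OF F[OF step.hyps(2)]]
    obtain f G where fG: "lifted u v F f G"
      using IH by blast
    note f = liftedD[OF fG]
    have "emb_eq (cond u) (comp_emb (?D v w) F) (emb_of (?f v w \<circ> f) (?G v w \<circ> G))"
      using f(2) comp_emb_of_mor[OF m[OF step.prems] f(1) vw]
      unfolding emb_eq_def D comp_emb_def by simp
    moreover have "k w ((?f v w \<circ> f) X) = k u X" if X: "X \<in> Ind (cond u)" for X
    proof -
      have "f X \<in> Ind (cond v)"
        using cluster_mapD(1)[OF f(1)] X by blast
      then have "k v (f X) \<in> k w ` Ind (cond w)"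
        using fa(1) by blast
      then show ?thesis
        using f(3)[OF X] f_inv_into_f[of "k v (f X)" "k w" "Ind (cond w)"] by simp
    qed
    moreover have "K w ((?G v w \<circ> G) T) = K u T" if T: "cluster (cond u) T" for T
      using fa(3)[OF cluster_mapD(3)[OF f(1) T]] f(4)[OF T] by simp
    ultimately have "lifted u w (comp_emb (?D v w) F) (?f v w \<circ> f) (?G v w \<circ> G)"
      unfolding lifted_def using cluster_map_comp[OF f(1) vw] by blast
    moreover have "w \<in> fst ` A \<union> snd ` A"
      using step.hyps(2) by (auto simp: rev_image_eqI)
    ultimately show ?case
      by blast
  qed
  have uniq: "emb_eq (cond u) F G" if F: "path_composite A ?D u v F" and G: "path_composite A ?D u v G" for u v F G
  proof (cases "u \<in> fst ` A")
    case False
    then have "F = id_emb" "G = id_emb"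
      using path_composite_from_sink[OF F] path_composite_from_sink[OF G] by auto
    then show ?thesis
      unfolding emb_eq_def by simp
  next
    case True
    obtain f L where "lifted u v F f L"
      using path[OF F True] by blast
    note f = liftedD[OF this]
    obtain g H where "lifted u v G g H"
      using path[OF G True] by blast
    note g = liftedD[OF this]
    have v: "cluster_map (cond v) M (k v) (K v)"
      by (rule V[OF conjunct1[OF path[OF F True]]])
    have fg: "f X = g X" if X: "X \<in> Ind (cond u)" for X
    proof -
      have "f X \<in> Ind (cond v)" "g X \<in> Ind (cond v)"
        using cluster_mapD(1)[OF f(1)] cluster_mapD(1)[OF g(1)] X by blast+
      then show ?thesis
        using inj_onD[OF cluster_mapD(2)[OF v]] f(3) g(3) X by simp
    qed
    have LH: "L T = H T" if T: "cluster (cond u) T" for T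
      using cluster_map_inj_cluster[OF v cluster_mapD(3)[OF f(1) T] cluster_mapD(3)[OF g(1) T]]
        f(4) g(4) T by simp
    have "mor (emb_of f L) a = mor (emb_of g H) a" if a: "a \<in> arrows (cond u)" for a
      using mor_emb_of_cong[OF m[OF True] f(1) g(1) fg LH a] .
    moreover have "\<forall>X\<in>T. f X = g X" if "cluster (cond u) T" for T
      using fg clusterD(1)[OF that] by blast
    ultimately show ?thesis
      using f(2) g(2) LH unfolding emb_eq_def by simp
  qed
  show ?thesis
    unfolding commutative_diagram_def
    using is_embedding_emb_of[OF m map] uniq D by (force simp: rev_image_eqI)
qed

section \<open>Greedy completion\<close>

text \<open>An element is admitted iff it is compatible with \<open>S\<close> and with all elements admitted before it. The
recursion is through negative occurrences as well, so it is well-founded recursion and not an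
inductive definition; the equation it satisfies is the next lemma.\<close>

definition greedy :: "'a pcond \<Rightarrow> 'a rel \<Rightarrow> 'a set \<Rightarrow> 'a set" where
  "greedy M r S = {Z. wfrec r (\<lambda>h Z. Z \<in> Ind M \<and> (\<forall>X\<in>S. compat M X Z) \<and>
     (\<forall>Y. (Y, Z) \<in> r \<and> h Y \<longrightarrow> compat M Y Z)) Z}"

lemma greedy_iff:
  assumes "wf r"
  shows "Z \<in> greedy M r S \<longleftrightarrow> Z \<in> Ind M \<and> (\<forall>X\<in>S. compat M X Z) \<and>
    (\<forall>Y\<in>greedy M r S. (Y, Z) \<in> r \<longrightarrow> compat M Y Z)"
proof -
  let ?F = "\<lambda>h Z. Z \<in> Ind M \<and> (\<forall>X\<in>S. compat M X Z) \<and> (\<forall>Y. (Y, Z) \<in> r \<and> h Y \<longrightarrow> compat M Y Z)"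
  have "wfrec r ?F Z = ?F (cut (wfrec r ?F) r Z) Z"
    using wfrec[OF assms] .
  also have "\<dots> = ?F (wfrec r ?F) Z"
    by (auto simp: cut_apply)
  finally show ?thesis
    unfolding greedy_def mem_Collect_eq by blast
qed

context
  fixes M :: "'a pcond" and r :: "'a rel"
  assumes wf: "wf r"
    and compat_refl: "\<And>X. compat M X X"
    and compat_sym: "\<And>X Y. compat M X Y \<Longrightarrow> compat M Y X"
begin

lemma greedy_subset_Ind: "greedy M r S \<subseteq> Ind M"
  using greedy_iff[OF wf] by blast

lemma greedy_compat: "X \<in> S \<Longrightarrow> Z \<in> greedy M r S \<Longrightarrow> compat M X Z"
  using greedy_iff[OF wf] by metis

lemma subset_greedy:
  assumes "S \<subseteq> Ind M" "\<And>X Y. X \<in> S \<Longrightarrow> Y \<in> S \<Longrightarrow> compat M X Y"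
  shows "S \<subseteq> greedy M r S"
proof
  fix X assume "X \<in> S"
  then show "X \<in> greedy M r S"
    unfolding greedy_iff[OF wf, of X] using assms greedy_compat compat_sym by blast
qed

text \<open>Only conflicts among the candidates have to be decided by \<open>r\<close>. A relation that leaves other pairs
incomparable is allowed, and this freedom is used for the ranks below.\<close>

lemma cluster_greedy:
  assumes S: "S \<subseteq> Ind M" "\<And>X Y. X \<in> S \<Longrightarrow> Y \<in> S \<Longrightarrow> compat M X Y"
    and r: "\<And>Y Z. Y \<in> Ind M \<Longrightarrow> Z \<in> Ind M \<Longrightarrow> \<forall>X\<in>S. compat M X Y \<and> compat M X Z \<Longrightarrow>
      \<not> compat M Y Z \<Longrightarrow> (Y, Z) \<in> r \<or> (Z, Y) \<in> r"
  shows "cluster M (greedy M r S)"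
proof -
  have c: "compat M Y Z" if YZ: "Y \<in> greedy M r S" "Z \<in> greedy M r S" for Y Z
  proof (rule ccontr)
    assume n: "\<not> compat M Y Z"
    have "(Y, Z) \<in> r \<or> (Z, Y) \<in> r"
      using r[OF _ _ _ n] YZ greedy_compat greedy_subset_Ind by blast
    then have "compat M Y Z \<or> compat M Z Y"
      using YZ greedy_iff[OF wf] by metis
    then show False
      using n compat_sym by blast
  qed
  have "Z \<in> greedy M r S" if Z: "Z \<in> S'" "compatible M S'" "greedy M r S \<subseteq> S'" for S' Z
  proof -
    have "compat M Y Z" if "Y \<in> S'" for Y
      using Z that compat_refl by (cases "Y = Z") (auto simp: compatible_def pairwise_def)
    then show ?thesis
      unfolding greedy_iff[OF wf, of Z] using Z subset_greedy[OF S] by (auto simp: compatible_def)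
  qed
  then show ?thesis
    unfolding cluster_def compatible_def pairwise_def using c greedy_subset_Ind
    by (auto simp: compatible_def pairwise_def)
qed

text \<open>Adjoining in advance something that would be admitted anyway does not influence the greedy choice.
This is why completions can be done in stages.\<close>

lemma greedy_eq_of_between:
  assumes "cluster M (greedy M r S)" "S \<subseteq> S'" "S' \<subseteq> greedy M r S"
  shows "greedy M r S' = greedy M r S"
proof -
  have c: "compat M Y Z" if "Y \<in> greedy M r S" "Z \<in> greedy M r S" for Y Z
    using clusterD(2)[OF assms(1)] that compat_refl by metis
  have "Z \<in> greedy M r S' \<longleftrightarrow> Z \<in> greedy M r S" for Z
  proof (induction Z rule: wf_induct_rule[OF wf])
    case (1 Z)
    show ?case
    proof
      assume "Z \<in> greedy M r S'"
      then show "Z \<in> greedy M r S"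
        unfolding greedy_iff[OF wf, of Z] using assms(2) 1 by blast
    next
      assume Z: "Z \<in> greedy M r S"
      then show "Z \<in> greedy M r S'"
        unfolding greedy_iff[OF wf, of Z _ S'] using assms(3) 1 c greedy_subset_Ind by blast
    qed
  qed
  then show ?thesis
    by blast
qed

text \<open>Elements other than \<open>X\<close> and \<open>Y\<close> are candidates for \<open>insert X U\<close> iff they are candidates for
\<open>insert Y U\<close>, and neither \<open>X\<close> nor \<open>Y\<close> conflicts with such a candidate. So the same elements are
admitted in both cases.\<close>

lemma greedy_exchange:
  assumes XY: "X \<in> Ind M" "Y \<in> Ind M" "\<And>W. W \<in> U \<Longrightarrow> compat M W X \<and> compat M W Y" "\<not> compat M X Y"
    and only: "\<And>Z. Z \<in> Ind M \<Longrightarrow> \<forall>W\<in>U. compat M W Z \<Longrightarrow>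
      (\<not> compat M X Z \<longrightarrow> Z = Y) \<and> (\<not> compat M Y Z \<longrightarrow> Z = X)"
  shows "greedy M r (insert Y U) = (greedy M r (insert X U) - {X}) \<union> {Y}"
proof -
  have in1: "X \<in> greedy M r (insert X U)"
    unfolding greedy_iff[OF wf, of X] using XY compat_refl greedy_compat compat_sym by blast
  have in2: "Y \<in> greedy M r (insert Y U)"
    unfolding greedy_iff[OF wf, of Y] using XY compat_refl greedy_compat compat_sym by blast
  \<comment> \<open>Conflicting with each other, they cannot be admitted together.\<close>
  have notin: "Y \<notin> greedy M r (insert X U)" "X \<notin> greedy M r (insert Y U)"
    using XY(4) greedy_compat compat_sym by blast+
  have "Z \<in> greedy M r (insert Y U) \<longleftrightarrow> Z \<in> greedy M r (insert X U)" if "Z \<noteq> X" "Z \<noteq> Y" for Z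
    using that
  proof (induction Z rule: wf_induct_rule[OF wf])
    case (1 Z)
    have iff: "(\<forall>W\<in>insert X U. compat M W Z) \<longleftrightarrow> (\<forall>W\<in>insert Y U. compat M W Z)" if "Z \<in> Ind M"
      using only[OF that] 1(2,3) by blast
    have IH: "W \<in> greedy M r (insert Y U) \<longleftrightarrow> W \<in> greedy M r (insert X U)"
      if "(W, Z) \<in> r" "W \<noteq> X" "W \<noteq> Y" for W
      using 1(1) that by blast
    show ?case
    proof
      assume Z: "Z \<in> greedy M r (insert Y U)"
      then have "Z \<in> Ind M"
        using greedy_subset_Ind by blast
      with Z iff have c: "\<forall>W\<in>insert X U. compat M W Z" "Z \<in> Ind M"
        using greedy_compat by blast+
      then show "Z \<in> greedy M r (insert X U)"
        unfolding greedy_iff[OF wf, of Z _ "insert X U"]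
        using IH Z greedy_iff[OF wf, of Z M "insert Y U"] notin by blast
    next
      assume Z: "Z \<in> greedy M r (insert X U)"
      then have "Z \<in> Ind M"
        using greedy_subset_Ind by blast
      with Z iff have c: "\<forall>W\<in>insert Y U. compat M W Z" "Z \<in> Ind M"
        using greedy_compat by blast+
      then show "Z \<in> greedy M r (insert Y U)"
        unfolding greedy_iff[OF wf, of Z _ "insert Y U"]
        using IH Z greedy_iff[OF wf, of Z M "insert X U"] notin by blast
    qed
  qed
  then have "Z \<in> greedy M r (insert Y U) \<longleftrightarrow> Z \<in> (greedy M r (insert X U) - {X}) \<union> {Y}" for Z
    using in1 in2 notin by (cases "Z = X"; cases "Z = Y") auto
  then show ?thesis
    by (rule set_eqI)
qed

end

section \<open>Noncrossing arcs\<close>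

definition crossing :: "'l::linorder \<times> 'l \<Rightarrow> 'l \<times> 'l \<Rightarrow> bool" where
  "crossing = (\<lambda>(a, b) (c, d). a < c \<and> c < b \<and> b < d \<or> c < a \<and> a < d \<and> d < b)"

definition noncrossing :: "('l::linorder \<times> 'l) set \<Rightarrow> ('l \<times> 'l) pcond" where
  "noncrossing A = \<lparr>Ind = A, compat = (\<lambda>X Y. \<not> crossing X Y)\<rparr>"

lemma crossing_Pair [simp]:
  "crossing (a, b) (c, d) \<longleftrightarrow> a < c \<and> c < b \<and> b < d \<or> c < a \<and> a < d \<and> d < b"
  by (simp add: crossing_def)

lemma noncrossing_simps [simp]:
  "Ind (noncrossing A) = A" "compat (noncrossing A) X Y \<longleftrightarrow> \<not> crossing X Y"
  by (auto simp: noncrossing_def)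

lemma crossing_irrefl [simp]: "\<not> crossing X X"
  by (cases X) auto

lemma crossing_sym: "crossing X Y \<longleftrightarrow> crossing Y X"
  by (cases X; cases Y) auto

lemma crossing_symD: "crossing X Y \<Longrightarrow> crossing Y X"
  using crossing_sym by blast

text \<open>The four sides of the quadrilateral with vertices \<open>a < c < b < d\<close>, whose diagonals are \<open>(a, b)\<close>
and \<open>(c, d)\<close>.\<close>

definition sides :: "'l::linorder \<Rightarrow> 'l \<Rightarrow> 'l \<Rightarrow> 'l \<Rightarrow> ('l \<times> 'l) set" where
  "sides a c b d = {(a, c), (c, b), (b, d), (a, d)}"

lemma sides_mem:
  "(a, c) \<in> sides a c b d" "(c, b) \<in> sides a c b d" "(b, d) \<in> sides a c b d" "(a, d) \<in> sides a c b d"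
  by (auto simp: sides_def)

lemma crossing_side:
  assumes "a < c" "c < b" "b < d" "E \<in> sides a c b d" "crossing Z E"
  shows "crossing Z (a, b) \<or> crossing Z (c, d)"
proof (cases Z)
  case (Pair p q)
  then show ?thesis
    using assms unfolding sides_def by auto
qed

lemma crossing_cases:
  assumes "crossing X Y"
  obtains a b c d where "a < c" "c < b" "b < d" "X = (a, b)" "Y = (c, d)"
    | a b c d where "a < c" "c < b" "b < d" "Y = (a, b)" "X = (c, d)"
  using assms by (cases X; cases Y) auto

lemma exchange_noncrossing:
  assumes "exchange (noncrossing A) T X Y"
  shows "crossing X Y" "\<And>Z. Z \<in> T \<Longrightarrow> Z \<noteq> X \<Longrightarrow> \<not> crossing Z X \<and> \<not> crossing Z Y" "X \<in> A" "Y \<in> A"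
proof -
  note x = exchangeD[OF assms]
  show "X \<in> A" "Y \<in> A"
    using x by auto
  then show "crossing X Y"
    using assms x(2) unfolding exchange_def compatible_pair
    by (auto dest: crossing_symD)
  fix Z assume Z: "Z \<in> T" "Z \<noteq> X"
  then have "\<not> crossing Z X"
    using clusterD(2)[OF x(1) Z(1) x(2)] by simp
  moreover have "Z \<noteq> Y"
    using Z x by auto
  then have "\<not> crossing Z Y"
    using assms Z by (auto simp: exchange_def compatible_def pairwise_def)
  ultimately show "\<not> crossing Z X \<and> \<not> crossing Z Y"
    by simp
qed

lemma cluster_noncrossing_mem:
  assumes "cluster (noncrossing A) T" "Z \<in> A" "\<And>X. X \<in> T \<Longrightarrow> \<not> crossing X Z"
  shows "Z \<in> T"
proof -
  have "compatible (noncrossing A) (insert Z T)"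
    using assms by (auto simp: cluster_def compatible_def pairwise_insert dest: crossing_symD)
  then have "insert Z T = T"
    using assms(1) unfolding cluster_def by blast
  then show ?thesis
    by auto
qed

text \<open>A side crosses neither diagonal, and an arc that crosses a side crosses a diagonal. So a side is
compatible with the whole cluster and belongs to it by maximality.\<close>

lemma exchange_side_mem:
  assumes e: "exchange (noncrossing A) T X Y" and ord: "a < c" "c < b" "b < d"
    and XY: "X = (a, b) \<and> Y = (c, d) \<or> X = (c, d) \<and> Y = (a, b)" and E: "E \<in> sides a c b d" "E \<in> A"
  shows "E \<in> T - {X}"
proof -
  have n: "\<not> crossing (a, b) E" "\<not> crossing (c, d) E" "E \<noteq> (a, b)" "E \<noteq> (c, d)"
    using ord E(1) unfolding sides_def by auto
  have "\<not> crossing Z E" if Z: "Z \<in> T" for Z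
  proof (cases "Z = X")
    case True
    then show ?thesis
      using n XY by blast
  next
    case False
    then have "\<not> crossing Z (a, b)" "\<not> crossing Z (c, d)"
      using exchange_noncrossing(2)[OF e Z] XY by blast+
    then show ?thesis
      using crossing_side[OF ord E(1)] by blast
  qed
  then have "E \<in> T"
    using cluster_noncrossing_mem[OF exchangeD(1)[OF e] E(2)] by blast
  moreover have "E \<noteq> X"
    using n XY by blast
  ultimately show ?thesis
    by simp
qed

text \<open>If \<open>Y\<close> and \<open>Y'\<close> can both replace \<open>X\<close>, then neither crosses a side of the quadrilateral that the
other one forms with \<open>X\<close>. Two opposite sides already force the quadrilaterals to coincide.\<close>

lemma induces_noncrossing:
  assumes A: "\<And>a b c d E. (a, b) \<in> A \<Longrightarrow> (c, d) \<in> A \<Longrightarrow> a < c \<Longrightarrow> c < b \<Longrightarrow> b < d \<Longrightarrow>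
      E \<in> sides a c b d \<Longrightarrow> E \<in> A \<or> (\<forall>Z\<in>A. \<not> crossing Z E)"
  shows "induces_cluster_theory (noncrossing A)"
proof -
  have side: "\<not> crossing Y' E"
    if e: "exchange (noncrossing A) T X Y" and e': "exchange (noncrossing A) T X Y'"
      and ord: "a < c" "c < b" "b < d" and XY: "X = (a, b) \<and> Y = (c, d) \<or> X = (c, d) \<and> Y = (a, b)" and E: "E \<in> sides a c b d"
    for T X Y Y' a b c d E
  proof (cases "E \<in> A")
    case True
    then have "E \<in> T" "E \<noteq> X"
      using exchange_side_mem[OF e ord XY E] by auto
    then show ?thesis
      using exchange_noncrossing(2)[OF e'] crossing_sym by blast
  next
    case False
    have "(a, b) \<in> A" "(c, d) \<in> A"
      using exchange_noncrossing(3,4)[OF e] XY by blast+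
    then show ?thesis
      using A[OF _ _ ord E] exchange_noncrossing(4)[OF e'] False by blast
  qed
  have "Y = Y'" if e: "exchange (noncrossing A) T X Y" and e': "exchange (noncrossing A) T X Y'"
    for T X Y Y'
  proof -
    obtain x1 x2 y1 y2 z1 z2 where p: "X = (x1, x2)" "Y = (y1, y2)" "Y' = (z1, z2)"
      by (cases X; cases Y; cases Y') auto
    have c: "crossing X Y" "crossing X Y'"
      using exchange_noncrossing(1) e e' by blast+
    have 1: "\<not> crossing (z1, z2) (x1, y2) \<and> \<not> crossing (z1, z2) (y1, x2)" if "x1 < y1"
      using side[OF e e' _ _ _ _ sides_mem(2), of x1 y1 x2 y2]
        side[OF e e' _ _ _ _ sides_mem(4), of x1 y1 x2 y2] c that unfolding p by auto
    have 2: "\<not> crossing (z1, z2) (y1, x2) \<and> \<not> crossing (z1, z2) (x1, y2)" if "y1 < x1"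
      using side[OF e e' _ _ _ _ sides_mem(2), of y1 x1 y2 x2]
        side[OF e e' _ _ _ _ sides_mem(4), of y1 x1 y2 x2] c that unfolding p by auto
    have 3: "\<not> crossing (y1, y2) (x1, z2) \<and> \<not> crossing (y1, y2) (z1, x2)" if "x1 < z1"
      using side[OF e' e _ _ _ _ sides_mem(2), of x1 z1 x2 z2]
        side[OF e' e _ _ _ _ sides_mem(4), of x1 z1 x2 z2] c that unfolding p by auto
    have 4: "\<not> crossing (y1, y2) (z1, x2) \<and> \<not> crossing (y1, y2) (x1, z2)" if "z1 < x1"
      using side[OF e' e _ _ _ _ sides_mem(2), of z1 x1 z2 x2]
        side[OF e' e _ _ _ _ sides_mem(4), of z1 x1 z2 x2] c that unfolding p by auto
    from c consider "x1 < y1" "y1 < x2" "x2 < y2" "x1 < z1" "z1 < x2" "x2 < z2"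
      | "x1 < y1" "y1 < x2" "x2 < y2" "z1 < x1" "x1 < z2" "z2 < x2"
      | "y1 < x1" "x1 < y2" "y2 < x2" "x1 < z1" "z1 < x2" "x2 < z2"
      | "y1 < x1" "x1 < y2" "y2 < x2" "z1 < x1" "x1 < z2" "z2 < x2"
      unfolding p by auto
    then show "Y = Y'"
      by cases (use 1 2 3 4 in \<open>auto simp: p\<close>)
  qed
  then show ?thesis
    unfolding induces_cluster_theory_def using crossing_symD by auto
qed

text \<open>Here and in the next lemma each vertex \<open>v\<close> of the quadrilateral has two positions, \<open>ve\<close> for arcs that
end at \<open>v\<close> and \<open>vs\<close> for arcs that start at \<open>v\<close>, with \<open>ve \<le> vs\<close>. An arc that crosses one
diagonal and no side has to be the other diagonal, provided that it does not end or start in the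
gap between the two positions of a vertex.\<close>

lemma quad_outer:
  fixes p q as ce cs be bs de :: "'k::linorder"
  assumes o: "as < ce" "ce \<le> cs" "cs < be" "be \<le> bs" "bs < de"
    and n: "\<not> crossing (as, ce) (p, q)" "\<not> crossing (cs, be) (p, q)" "\<not> crossing (bs, de) (p, q)"
      "\<not> crossing (as, de) (p, q)"
    and c: "crossing (cs, de) (p, q)"
    and gap: "p < ce \<or> cs \<le> p" "q \<le> be \<or> bs < q"
  shows "p = as \<and> q = be"
proof -
  have "\<not> (cs < p \<and> p < de \<and> de < q)"
    using n(4) o by auto
  then have 1: "p < cs" "cs < q" "q < de"
    using c by auto
  then have "be \<le> q"
    using n(2) by auto
  moreover have "\<not> bs < q"
    using n(3) 1 o by auto
  ultimately have q: "q = be"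
    using gap(2) by auto
  have p: "p < ce"
    using gap(1) 1 by auto
  have "\<not> as < p"
    using n(1) p q o by auto
  moreover have "\<not> p < as"
    using n(4) p q o 1 by auto
  ultimately show ?thesis
    using q by auto
qed

lemma quad_inner:
  fixes p q as ce cs be bs de :: "'k::linorder"
  assumes o: "as < ce" "ce \<le> cs" "cs < be" "be \<le> bs" "bs < de"
    and n: "\<not> crossing (as, ce) (p, q)" "\<not> crossing (cs, be) (p, q)" "\<not> crossing (bs, de) (p, q)"
      "\<not> crossing (as, de) (p, q)"
    and c: "crossing (as, be) (p, q)"
    and gap: "p < ce \<or> cs \<le> p" "q \<le> be \<or> bs < q"
  shows "p = cs \<and> q = de"
proof -
  have "\<not> (p < as \<and> as < q \<and> q < be)"
    using n(4) o by auto
  then have 1: "as < p" "p < be" "be < q"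
    using c by auto
  then have "bs < q"
    using gap(2) by auto
  then have "\<not> q < de"
    using n(3) 1 o by auto
  moreover have "\<not> de < q"
    using n(4) 1 o by auto
  ultimately have q: "q = de"
    by auto
  have "\<not> p < ce"
    using n(1) 1 o by auto
  then have "cs \<le> p"
    using gap(1) by auto
  moreover have "\<not> cs < p"
    using n(2) 1 by auto
  ultimately show ?thesis
    using q by auto
qed

(* Below, crossing is an opaque symmetric relation that is unfolded on request only. *)
declare crossing_Pair [simp del]

text \<open>The vertex \<open>v\<close> is realised by \<open>s v\<close> as a left end and by \<open>e v\<close> as a right end, so that in the target
consecutive arcs can be kept from touching. The set \<open>R\<close> has to close the two leaks of this construction: it
protects the sides of quadrilaterals that are not arcs of the source (assumption \<open>sides\<close>), and it
keeps other arcs from ending inside the gap between \<open>e v\<close> and \<open>s v\<close> (assumption \<open>gap\<close>).\<close>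

lemma greedy_cluster_map:
  fixes A :: "('l::linorder \<times> 'l) set" and B :: "('k::linorder \<times> 'k) set" and s e :: "'l \<Rightarrow> 'k"
  defines "f \<equiv> map_prod s e"
  assumes m: "mutation_closed (noncrossing A)" and wf: "wf r"
    and V: "A \<subseteq> V \<times> V"
    and pos: "\<And>x. x \<in> V \<Longrightarrow> e x \<le> s x" "\<And>x y. x \<in> V \<Longrightarrow> y \<in> V \<Longrightarrow> x < y \<Longrightarrow> s x < e y"
    and sub: "f ` A \<subseteq> B" "R \<subseteq> B"
    and R: "\<And>U W. U \<in> R \<Longrightarrow> W \<in> R \<Longrightarrow> \<not> crossing U W"
      "\<And>U X. U \<in> R \<Longrightarrow> X \<in> A \<Longrightarrow> \<not> crossing U (f X)"
    and r: "\<And>T Y Z. cluster (noncrossing A) T \<Longrightarrow> Y \<in> B \<Longrightarrow> Z \<in> B \<Longrightarrow>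
      \<forall>W\<in>f ` T \<union> R. \<not> crossing W Y \<and> \<not> crossing W Z \<Longrightarrow> crossing Y Z \<Longrightarrow> (Y, Z) \<in> r \<or> (Z, Y) \<in> r"
    and gap: "\<And>p q X v. (p, q) \<in> B \<Longrightarrow> \<forall>W\<in>R. \<not> crossing W (p, q) \<Longrightarrow> X \<in> A \<Longrightarrow>
      crossing (f X) (p, q) \<Longrightarrow> v \<in> V \<Longrightarrow> (p < e v \<or> s v \<le> p) \<and> (q \<le> e v \<or> s v < q)"
    and sides: "\<And>a b c d E. (a, b) \<in> A \<Longrightarrow> (c, d) \<in> A \<Longrightarrow> a < c \<Longrightarrow> c < b \<Longrightarrow> b < d \<Longrightarrow>
      E \<in> sides a c b d \<Longrightarrow> E \<in> A \<or> (\<forall>Z\<in>B. (\<forall>W\<in>R. \<not> crossing W Z) \<longrightarrow> \<not> crossing (f E) Z)"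
  shows "cluster_map (noncrossing A) (noncrossing B) f (\<lambda>T. greedy (noncrossing B) r (f ` T \<union> R))"
proof -
  let ?B = "noncrossing B" and ?A = "noncrossing A"
  let ?K = "\<lambda>T. greedy ?B r (f ` T \<union> R)"
  have f [simp]: "f (x, y) = (s x, e y)" for x y
    by (simp add: f_def)
  have ss: "s x < s y \<longleftrightarrow> x < y" and ee: "e x < e y \<longleftrightarrow> x < y" and se: "s x < e y \<longleftrightarrow> x < y"
    if "x \<in> V" "y \<in> V" for x y
    using pos(1)[OF that(1)] pos(1)[OF that(2)] pos(2)[OF that] pos(2)[OF that(2,1)]
    by (cases x y rule: linorder_cases; force)+
  have crs: "crossing (f X) (f Y) \<longleftrightarrow> crossing X Y" if XY: "X \<in> A" "Y \<in> A" for X Y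
  proof -
    obtain a b c d where p: "X = (a, b)" "Y = (c, d)"
      by (cases X; cases Y) auto
    then have "a \<in> V" "b \<in> V" "c \<in> V" "d \<in> V"
      using XY V by auto
    then show ?thesis
      unfolding p using ss ee se by (simp add: crossing_Pair)
  qed
  have inj: "inj_on f A"
  proof (rule inj_onI)
    fix X Y assume XY: "X \<in> A" "Y \<in> A" "f X = f Y"
    obtain a b c d where p: "X = (a, b)" "Y = (c, d)"
      by (cases X; cases Y) auto
    then have "a \<in> V" "b \<in> V" "c \<in> V" "d \<in> V"
      using XY V by auto
    then show "X = Y"
      using XY(3) ss[of a c] ss[of c a] ee[of b d] ee[of d b] unfolding p by auto
  qed
  note G = wf noncrossing_simps(2)
  have refl: "compat ?B X X" and sym: "compat ?B X Y \<Longrightarrow> compat ?B Y X" for X Y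
    by (auto dest: crossing_symD)
  have TA: "T \<subseteq> A" and Tn: "X \<in> T \<Longrightarrow> Y \<in> T \<Longrightarrow> \<not> crossing X Y" if T: "cluster ?A T" for T X Y
    using clusterD(2)[OF T, of X Y] clusterD(1)[OF T] by (cases "X = Y"; simp)+
  have S: "f ` T \<union> R \<subseteq> B" "X \<in> f ` T \<union> R \<Longrightarrow> Y \<in> f ` T \<union> R \<Longrightarrow> \<not> crossing X Y"
    if T: "cluster ?A T" for T X Y
  proof -
    show "f ` T \<union> R \<subseteq> B"
      using TA[OF T] sub by auto
    have "\<not> crossing (f U) (f W)" if "U \<in> T" "W \<in> T" for U W
      using crs Tn[OF T that] TA[OF T] that by blast
    moreover have "\<not> crossing (f U) W" "\<not> crossing W (f U)" if "U \<in> T" "W \<in> R" for U W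
      using R(2) TA[OF T] that crossing_sym by blast+
    ultimately show "\<not> crossing X Y" if "X \<in> f ` T \<union> R" "Y \<in> f ` T \<union> R"
      using R(1) that by blast
  qed
  have K: "cluster ?B (?K T)" and KS: "f ` T \<union> R \<subseteq> ?K T" if T: "cluster ?A T" for T
  proof -
    have 1: "f ` T \<union> R \<subseteq> Ind ?B"
      using S(1)[OF T] by simp
    have 2: "compat ?B X Y" if "X \<in> f ` T \<union> R" "Y \<in> f ` T \<union> R" for X Y
      using S(2)[OF T that] by simp
    have 3: "(Y, Z) \<in> r \<or> (Z, Y) \<in> r" if "Y \<in> Ind ?B" "Z \<in> Ind ?B"
      "\<forall>X\<in>f ` T \<union> R. compat ?B X Y \<and> compat ?B X Z" "\<not> compat ?B Y Z" for Y Z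
      using r[OF T, of Y Z] that unfolding noncrossing_simps by blast
    show "cluster ?B (?K T)"
      by (rule cluster_greedy[OF wf refl sym 1 2 3])
    show "f ` T \<union> R \<subseteq> ?K T"
      by (rule subset_greedy[OF wf refl sym 1 2])
  qed
  \<comment> \<open>The only arc that crosses the new diagonal and nothing else is the old diagonal.\<close>
  have quad: "Z = f X" if ex: "exchange ?A T X Y" and Z: "Z \<in> B" "crossing (f Y) Z"
      "\<forall>W\<in>f ` (T - {X}) \<union> R. \<not> crossing W Z" for T X Y Z
  proof -
    note x = exchange_noncrossing[OF ex]
    obtain p q where pq: "Z = (p, q)"
      by (cases Z)
    have gap': "(p < e v \<or> s v \<le> p) \<and> (q \<le> e v \<or> s v < q)" if "v \<in> V" for v
      using gap[of p q Y v] that Z x pq by blast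
    have side: "\<not> crossing (f E) Z"
      if ord: "a < c" "c < b" "b < d" and XY: "X = (a, b) \<and> Y = (c, d) \<or> X = (c, d) \<and> Y = (a, b)" and E: "E \<in> sides a c b d"
      for a b c d E
    proof (cases "E \<in> A")
      case True
      then have "E \<in> T - {X}"
        using exchange_side_mem[OF ex ord XY E] by auto
      then show ?thesis
        using Z(3) by blast
    next
      case False
      have "(a, b) \<in> A" "(c, d) \<in> A"
        using x(3,4) XY by blast+
      then show ?thesis
        using sides[OF _ _ ord E] Z False by blast
    qed
    show ?thesis
      using x(1)
    proof (cases rule: crossing_cases)
      case (1 a b c d)
      then have v: "a \<in> V" "b \<in> V" "c \<in> V" "d \<in> V"
        using x(3,4) V by auto
      have s: "\<not> crossing (s a, e c) (p, q)" "\<not> crossing (s c, e b) (p, q)"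
        "\<not> crossing (s b, e d) (p, q)" "\<not> crossing (s a, e d) (p, q)"
        using side[OF 1(1-3)] 1(4,5) unfolding pq sides_def by auto
      have o: "s a < e c" "e c \<le> s c" "s c < e b" "e b \<le> s b" "s b < e d"
        using 1 pos v by auto
      have c: "crossing (s c, e d) (p, q)"
        using Z(2) 1 pq by simp
      have "p = s a \<and> q = e b"
        by (rule quad_outer[OF o s c]) (use gap'[OF v(2)] gap'[OF v(3)] in auto)
      then show ?thesis
        using 1 pq by simp
    next
      case (2 a b c d)
      then have v: "a \<in> V" "b \<in> V" "c \<in> V" "d \<in> V"
        using x(3,4) V by auto
      have s: "\<not> crossing (s a, e c) (p, q)" "\<not> crossing (s c, e b) (p, q)"
        "\<not> crossing (s b, e d) (p, q)" "\<not> crossing (s a, e d) (p, q)"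
        using side[OF 2(1-3)] 2(4,5) unfolding pq sides_def by auto
      have o: "s a < e c" "e c \<le> s c" "s c < e b" "e b \<le> s b" "s b < e d"
        using 2 pos v by auto
      have c: "crossing (s a, e b) (p, q)"
        using Z(2) 2 pq by simp
      have "p = s c \<and> q = e d"
        by (rule quad_inner[OF o s c]) (use gap'[OF v(2)] gap'[OF v(3)] in auto)
      then show ?thesis
        using 2 pq by simp
    qed
  qed
  show ?thesis
    unfolding cluster_map_def noncrossing_simps
  proof (intro conjI allI impI ballI)
    show "f ` A \<subseteq> B" "inj_on f A"
      using sub inj by auto
    show "(\<not> crossing (f X) (f Y)) = (\<not> crossing X Y)" if "X \<in> A" "Y \<in> A" for X Y
      using crs that by blast
    show "cluster ?B (?K T)" if "cluster ?A T" for T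
      using K that .
    show "?K T \<inter> f ` A = f ` T" if T: "cluster ?A T" for T
    proof -
      have "X \<in> T" if "X \<in> A" "f X \<in> ?K T" for X
      proof (rule cluster_noncrossing_mem[OF T that(1)])
        fix Y assume Y: "Y \<in> T"
        then have "\<not> crossing (f Y) (f X)"
          using greedy_compat[OF wf refl sym, of "f Y" "f ` T \<union> R" "f X"] that by simp
        then show "\<not> crossing Y X"
          using crs Y TA[OF T] that by blast
      qed
      then show ?thesis
        using KS[OF T] TA[OF T] by auto
    qed
    fix T X Y assume ex: "exchange ?A T X Y"
    note x = exchangeD[OF ex] and y = exchange_noncrossing[OF ex]
    let ?T' = "(T - {X}) \<union> {Y}" and ?U = "f ` (T - {X}) \<union> R"
    have T': "cluster ?A ?T'"
      using m ex unfolding mutation_closed_def by blast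
    have e1: "f ` T \<union> R = insert (f X) ?U" and e2: "f ` ?T' \<union> R = insert (f Y) ?U"
      using x by auto
    have cU: "\<not> crossing W (f X) \<and> \<not> crossing W (f Y)" if "W \<in> ?U" for W
      using S(2)[OF x(1), of W "f X", unfolded e1] S(2)[OF T', of W "f Y", unfolded e2] that by blast
    \<comment> \<open>Mutations are reversible, which gives the same statement with the diagonals swapped.\<close>
    have ex': "exchange ?A ?T' Y X"
    proof -
      have "?T' - {Y} \<union> {X} = T"
        using x by auto
      then show ?thesis
        using T' ex x by (auto simp: exchange_def insert_commute cluster_def)
    qed
    have d: "?T' - {Y} = T - {X}"
      using x by auto
    have only: "(crossing (f X) Z \<longrightarrow> Z = f Y) \<and> (crossing (f Y) Z \<longrightarrow> Z = f X)"
      if "Z \<in> B" "\<forall>W\<in>?U. \<not> crossing W Z" for Z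
      using quad[OF ex that(1) _ that(2)] quad[OF ex' that(1), unfolded d, OF _ that(2)] by blast
    show eq: "?K ?T' = ?K T - {f X} \<union> {f Y}"
      unfolding e1 e2
    proof (rule greedy_exchange[OF wf refl sym])
      show "f X \<in> Ind ?B" "f Y \<in> Ind ?B"
        using y(3,4) sub(1) by auto
      show "\<not> compat ?B (f X) (f Y)"
        using crs[OF y(3,4)] y(1) by simp
      show "compat ?B W (f X) \<and> compat ?B W (f Y)" if "W \<in> ?U" for W
        using cU[OF that] by simp
      show "(\<not> compat ?B (f X) Z \<longrightarrow> Z = f Y) \<and> (\<not> compat ?B (f Y) Z \<longrightarrow> Z = f X)"
        if "Z \<in> Ind ?B" "\<forall>W\<in>?U. compat ?B W Z" for Z
        using only[of Z] that unfolding noncrossing_simps by blast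
    qed
    show "exchange ?B (?K T) (f X) (f Y)"
      unfolding exchange_def
    proof (intro conjI)
      show "cluster ?B (?K T)"
        using K x(1) .
      show "f X \<in> ?K T" "f Y \<in> Ind ?B"
        using KS[OF x(1)] x(2) y(4) sub(1) by auto
      show "\<not> compatible ?B {f X, f Y}"
        using crs[OF y(3,4)] y(1) unfolding compatible_pair by auto
      show "compatible ?B (?K T - {f X} \<union> {f Y})"
        using K[OF T'] unfolding eq cluster_def by blast
    qed
  qed
qed

text \<open>An arc of \<open>A'\<close> that crosses nothing of \<open>T \<union> R\<close> is refused by the greedy choice only because of an
arc admitted before it. The assumption
\<open>late\<close> says that this obstacle lies in \<open>A'\<close> itself, so the refusal is visible in \<open>A'\<close> and the trace
of the completion on \<open>A'\<close> is maximal.\<close>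

lemma greedy_factors:
  fixes A A' B :: "('l::linorder \<times> 'l) set"
  assumes wf: "wf r" and sub: "A \<subseteq> A'" "A' \<subseteq> B"
    and K: "cluster_map (noncrossing A) (noncrossing B) (\<lambda>X. X) (\<lambda>T. greedy (noncrossing B) r (T \<union> R))"
    and R: "R \<subseteq> B" "\<And>U W. U \<in> R \<Longrightarrow> W \<in> R \<union> A \<Longrightarrow> \<not> crossing U W"
    and R': "\<And>U W. U \<in> R' \<Longrightarrow> W \<in> A' \<Longrightarrow> \<not> crossing U W" "R \<subseteq> A' \<union> R'"
      "\<And>T. cluster (noncrossing A) T \<Longrightarrow> R' \<subseteq> greedy (noncrossing B) r (T \<union> R)"
    and late: "\<And>Y Z. Z \<in> A' \<Longrightarrow> Y \<in> B \<Longrightarrow> \<forall>W\<in>R. \<not> crossing W Y \<Longrightarrow> (Y, Z) \<in> r \<Longrightarrow> crossing Y Z \<Longrightarrow> Y \<in> A'"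
  shows "factors (noncrossing A) (\<lambda>X. X) (\<lambda>T. greedy (noncrossing B) r (T \<union> R))
     (noncrossing A') (\<lambda>X. X) (\<lambda>T. greedy (noncrossing B) r (T \<union> R'))"
  unfolding factors_def
proof (intro conjI allI impI)
  let ?B = "noncrossing B"
  have refl: "compat ?B X X" and sym: "compat ?B X Y \<Longrightarrow> compat ?B Y X" for X Y
    by (auto dest: crossing_symD)
  show "(\<lambda>X. X) ` Ind (noncrossing A) \<subseteq> (\<lambda>X. X) ` Ind (noncrossing A')"
    using sub by simp
  fix T assume T: "cluster (noncrossing A) T"
  let ?C = "greedy ?B r (T \<union> R)"
  note C = cluster_mapD(3)[OF K T]
  have CB: "?C \<subseteq> B"
    using clusterD(1)[OF C] by simp
  have Cn: "\<not> crossing X Y" if "X \<in> ?C" "Y \<in> ?C" for X Y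
    using clusterD(2)[OF C that] by (cases "X = Y") auto
  have TC: "T \<subseteq> ?C" and TA: "T \<subseteq> A"
    using cluster_map_subset[OF K T] clusterD(1)[OF T] by auto
  have RC: "R \<subseteq> ?C"
  proof
    fix U assume U: "U \<in> R"
    have "\<not> crossing W U" if "W \<in> ?C" for W
      using that U greedy_compat[OF wf refl sym, of U "T \<union> R" W] crossing_sym[of W U] by simp
    then show "U \<in> ?C"
      using cluster_noncrossing_mem[OF C] U R(1) by blast
  qed
  let ?D = "{Z \<in> Ind (noncrossing A'). Z \<in> ?C}"
  show "cluster (noncrossing A') ?D"
    unfolding cluster_def
  proof (intro conjI allI impI)
    show "compatible (noncrossing A') ?D"
      using Cn by (auto simp: compatible_def pairwise_def)
    fix S assume S: "compatible (noncrossing A') S \<and> ?D \<subseteq> S"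
    have Sn: "\<not> crossing X Y" if "X \<in> S" "Y \<in> S" for X Y
      using S that by (cases "X = Y") (auto simp: compatible_def pairwise_def)
    have "Z \<in> ?C" if Z: "Z \<in> S" for Z
    proof -
      have ZA: "Z \<in> A'"
        using S Z by (auto simp: compatible_def)
      have n: "\<not> crossing Y Z" if "Y \<in> ?C" "Y \<in> A'" for Y
        using that S Z Sn by (metis (mono_tags, lifting) mem_Collect_eq noncrossing_simps(1) subsetD)
      have 1: "\<not> crossing X Z" if X: "X \<in> T \<union> R" for X
      proof (cases "X \<in> A'")
        case True
        then show ?thesis
          using n X TC RC by blast
      next
        case False
        then show ?thesis
          using X R' TA sub ZA by blast
      qed
      have "\<not> crossing Y Z" if Y: "Y \<in> ?C" "(Y, Z) \<in> r" for Y
      proof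
        assume c: "crossing Y Z"
        have "\<forall>W\<in>R. \<not> crossing W Y"
          using Y Cn RC by blast
        then have "Y \<in> A'"
          using late ZA CB Y c by blast
        then show False
          using n Y c by blast
      qed
      then show ?thesis
        unfolding greedy_iff[OF wf, of Z] using 1 ZA sub by auto
    qed
    then show "S = ?D"
      using S by (auto simp: compatible_def)
  qed
  show "greedy ?B r (?D \<union> R') = ?C"
    by (rule greedy_eq_of_between[OF wf refl sym C])
      (use TA TC RC R' T sub in auto)
qed

section \<open>Chords of chains of copies of the integers\<close>

text \<open>Any order embedding of the integers into the open interval from -1 to 1 would do.\<close>

fun height :: "int extended \<Rightarrow> real" where
  "height (Fin k) = arctan (of_int k) / 2"
| "height Pinf = 1"
| "height Minf = -1"

lemma height_Fin_bounds: "-1 < height (Fin k)" "height (Fin k) < 1"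
  using arctan_lbound[of "of_int k"] arctan_ubound[of "of_int k"] pi_less_4 by auto

lemma height_less [simp]: "height p < height q \<longleftrightarrow> p < q"
  using height_Fin_bounds less_asym[OF height_Fin_bounds(1)] less_asym[OF height_Fin_bounds(2)]
  by (cases p; cases q) (auto simp: arctan_less_iff)

text \<open>The point \<open>p\<close> of the copy at depth \<open>r\<close>. Depth is counted from the top copy, which lets chains of
different lengths share their upper parts.\<close>

definition pt :: "int extended \<Rightarrow> nat \<Rightarrow> real" where
  "pt p r = height p - 2 * real r"

lemma pt_less [simp]:
  assumes "p \<noteq> Minf" "q \<noteq> Minf"
  shows "pt p r < pt q s \<longleftrightarrow> s < r \<or> s = r \<and> p < q"
proof -
  have p: "-1 < height p" "height p \<le> 1" and q: "-1 < height q" "height q \<le> 1"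
    using assms height_Fin_bounds by (cases p; cases q; auto simp: less_imp_le)+
  consider "s < r" | "s = r" | "r < s"
    by linarith
  then show ?thesis
  proof cases
    case 1
    then have "real s + 1 \<le> real r"
      by linarith
    then show ?thesis
      using p q 1 unfolding pt_def by auto
  next
    case 3
    then have "real r + 1 \<le> real s"
      by linarith
    then show ?thesis
      using p q 3 unfolding pt_def by auto
  qed (simp add: pt_def)
qed

lemma pt_eq [simp]:
  assumes "p \<noteq> Minf" "q \<noteq> Minf"
  shows "pt p r = pt q s \<longleftrightarrow> r = s \<and> p = q"
proof
  assume "pt p r = pt q s"
  then have "\<not> pt p r < pt q s" "\<not> pt q s < pt p r"
    by auto
  then show "r = s \<and> p = q"
    using assms by auto
qed simp

text \<open>The lower end of a copy is the limit point of the copy below it.\<close>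

lemma pt_Minf: "pt Minf r = pt Pinf (Suc r)"
  by (simp add: pt_def)

definition open_chain :: "nat \<Rightarrow> real set" where
  "open_chain i = {pt (Fin k) r | k r. r < i}"

text \<open>Each copy comes with its upper limit point; the lowest copy has no lower limit point.\<close>

definition closed_chain :: "nat \<Rightarrow> real set" where
  "closed_chain i = {pt p r | p r. p \<noteq> Minf \<and> r < i}"

definition chords :: "real set \<Rightarrow> (real \<times> real) set" where
  "chords S = {(x, y). x \<in> S \<and> y \<in> S \<and> (\<exists>c\<in>S. x < c \<and> c < y)}"

lemma open_chain_subset: "open_chain i \<subseteq> closed_chain i"
  by (auto simp: open_chain_def closed_chain_def)

lemma closed_chain_mono: "i \<le> j \<Longrightarrow> closed_chain i \<subseteq> closed_chain j"
  by (auto simp: closed_chain_def) (metis order_less_le_trans)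

lemma open_chain_mono: "i \<le> j \<Longrightarrow> open_chain i \<subseteq> open_chain j"
  by (auto simp: open_chain_def)

lemma chords_mono: "S \<subseteq> S' \<Longrightarrow> chords S \<subseteq> chords S'"
  by (auto simp: chords_def)

lemma closed_chainE:
  assumes "x \<in> closed_chain i"
  obtains k r where "x = pt (Fin k) r" "r < i" | r where "x = pt Pinf r" "r < i"
proof -
  obtain p r where "x = pt p r" "p \<noteq> Minf" "r < i"
    using assms by (auto simp: closed_chain_def)
  then show thesis
    using that by (cases p) auto
qed

lemma pt_mem_chain [simp]:
  "pt (Fin k) r \<in> open_chain i \<longleftrightarrow> r < i"
  "pt Pinf r \<notin> open_chain i"
  "pt (Fin k) r \<in> closed_chain i \<longleftrightarrow> r < i"
  "pt Pinf r \<in> closed_chain i \<longleftrightarrow> r < i"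
proof -
  show "pt (Fin k) r \<in> open_chain i \<longleftrightarrow> r < i" "pt Pinf r \<notin> open_chain i"
    by (auto simp: open_chain_def)
  have "pt p r \<in> closed_chain i \<longleftrightarrow> r < i" if "p \<noteq> Minf" for p
    using that by (auto simp: closed_chain_def)
  then show "pt (Fin k) r \<in> closed_chain i \<longleftrightarrow> r < i" "pt Pinf r \<in> closed_chain i \<longleftrightarrow> r < i"
    by auto
qed

text \<open>A pair of points of \<open>S\<close> without a point of \<open>S\<close> between them has nothing of any chain between them.
So it is a side that no chord crosses.\<close>

definition fills_gaps :: "real set \<Rightarrow> bool" where
  "fills_gaps S \<longleftrightarrow> (\<forall>x\<in>S. \<forall>y\<in>S. \<forall>j. \<forall>c\<in>closed_chain j. x < c \<and> c < y \<longrightarrow> (\<exists>c'\<in>S. x < c' \<and> c' < y))"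

lemma chords_restrict:
  assumes "fills_gaps S" "Z \<in> chords (closed_chain j)" "fst Z \<in> S" "snd Z \<in> S"
  shows "Z \<in> chords S"
  using assms unfolding fills_gaps_def chords_def by fastforce

lemma successor_least:
  assumes "x = pt (Fin k) r" "c \<in> closed_chain j" "x < c"
  shows "pt (Fin (k + 1)) r \<le> c"
  using assms(2)
proof (cases rule: closed_chainE)
  case (1 l s)
  then have "\<not> c < pt (Fin (k + 1)) r"
    using assms by auto
  then show ?thesis by simp
next
  case (2 s)
  then have "\<not> c < pt (Fin (k + 1)) r"
    using assms by auto
  then show ?thesis by simp
qed

lemma predecessor_greatest:
  assumes "x = pt (Fin k) r" "c \<in> closed_chain j" "c < x"
  shows "c \<le> pt (Fin (k - 1)) r"
  using assms(2)
proof (cases rule: closed_chainE)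
  case (1 l s)
  then have "\<not> pt (Fin (k - 1)) r < c"
    using assms by auto
  then show ?thesis by simp
next
  case (2 s)
  then have "\<not> pt (Fin (k - 1)) r < c"
    using assms by auto
  then show ?thesis by simp
qed

text \<open>A point that is not a limit point has a neighbour on either side, and between two limit points lies a whole
copy.\<close>

lemma fills_gapsI:
  assumes S: "open_chain i \<subseteq> S" "\<And>x. x \<in> S \<Longrightarrow> x \<in> open_chain i \<or> (\<exists>r\<le>i. x = pt Pinf r)"
  shows "fills_gaps S"
  unfolding fills_gaps_def
proof (intro ballI allI impI)
  fix x y j c assume xy: "x \<in> S" "y \<in> S" and c: "c \<in> closed_chain j" "x < c \<and> c < y"
  have open_chain: "pt (Fin k) r \<in> S" if "r < i" for k r
    using S(1) that by (auto simp: open_chain_def)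
  consider k r where "r < i" "x = pt (Fin k) r" | k r where "r < i" "y = pt (Fin k) r"
    | r s where "r \<le> i" "s \<le> i" "x = pt Pinf r" "y = pt Pinf s"
    using S(2)[OF xy(1)] S(2)[OF xy(2)] unfolding open_chain_def by blast
  then show "\<exists>c'\<in>S. x < c' \<and> c' < y"
  proof cases
    case (1 k r)
    then have "x < pt (Fin (k + 1)) r" "pt (Fin (k + 1)) r < y"
      using successor_least[OF 1(2) c(1)] c by auto
    then show ?thesis
      using open_chain 1 by blast
  next
    case (2 k r)
    then have "pt (Fin (k - 1)) r < y" "x < pt (Fin (k - 1)) r"
      using predecessor_greatest[OF 2(2) c(1)] c by auto
    then show ?thesis
      using open_chain 2 by blast
  next
    case (3 r s)
    have "pt Pinf r < pt Pinf s"
      using order.strict_trans[of x c y] c unfolding 3 by blast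
    then have "s < r"
      by simp
    then have "x < pt (Fin 0) s" "pt (Fin 0) s < y" "s < i"
      using 3 by auto
    then show ?thesis
      using open_chain by blast
  qed
qed

lemma fills_gaps_segment: "fills_gaps {pt (Fin k) 0 | k. 1 \<le> k \<and> k \<le> n}"
  unfolding fills_gaps_def
proof (intro ballI allI impI)
  fix x y j c assume "x \<in> {pt (Fin k) 0 | k. 1 \<le> k \<and> k \<le> n}" "y \<in> {pt (Fin k) 0 | k. 1 \<le> k \<and> k \<le> n}"
    and c: "c \<in> closed_chain j" "x < c \<and> c < y"
  then obtain a b where x: "x = pt (Fin a) 0" "1 \<le> a" and y: "y = pt (Fin b) 0" "b \<le> n"
    by auto
  have "pt (Fin (a + 1)) 0 < y"
    using successor_least[OF x(1) c(1)] c by auto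
  then show "\<exists>c'\<in>{pt (Fin k) 0 | k. 1 \<le> k \<and> k \<le> n}. x < c' \<and> c' < y"
    using x y by (intro bexI[of _ "pt (Fin (a + 1)) 0"]) auto
qed

text \<open>A triangulation of one copy in which every vertex lies strictly below some chord. So no arc can
leave the copy, not even to a limit point.\<close>

definition zigzag :: "nat \<Rightarrow> (real \<times> real) set" where
  "zigzag r = {(pt (Fin (- k)) r, pt (Fin l) r) | k l. 1 \<le> k \<and> (l = k \<or> l = k + 1)}"

definition zigzags :: "nat \<Rightarrow> nat \<Rightarrow> (real \<times> real) set" where
  "zigzags i j = (\<Union>r\<in>{i..<j}. zigzag r)"

lemma zigzags_iff: "W \<in> zigzags i j \<longleftrightarrow> (\<exists>r. i \<le> r \<and> r < j \<and> W \<in> zigzag r)"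
  by (auto simp: zigzags_def)

lemma zigzag_noncrossing: "X \<in> zigzag r \<Longrightarrow> Y \<in> zigzag r \<Longrightarrow> \<not> crossing X Y"
  by (auto simp: zigzag_def crossing_Pair)

text \<open>A chord \<open>(a, b)\<close> of the zigzag has \<open>a + b = 0\<close> or \<open>a + b = 1\<close>. For any other sum some chord
of the zigzag separates its end points.\<close>

lemma zigzag_maximal:
  fixes a b :: int
  assumes ab: "a + 2 \<le> b"
    and n: "\<And>W. W \<in> zigzag r \<Longrightarrow> \<not> crossing W (pt (Fin a) r, pt (Fin b) r)"
  shows "(pt (Fin a) r, pt (Fin b) r) \<in> zigzag r"
proof -
  have z: "\<not> (- k < a \<and> a < l \<and> l < b) \<and> \<not> (a < - k \<and> - k < b \<and> b < l)"
    if "1 \<le> k" "l = k \<or> l = k + 1" for k l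
    using n[of "(pt (Fin (- k)) r, pt (Fin l) r)"] that by (auto simp: zigzag_def crossing_Pair)
  have "a + b = 0 \<or> a + b = 1"
  proof (rule ccontr)
    assume "\<not> ?thesis"
    then consider "2 \<le> a + b" "0 \<le> a" | "2 \<le> a + b" "a < 0" | "a + b < 0" "b \<le> 0" | "a + b < 0" "0 < b"
      by linarith
    then show False
    proof cases
      case 1 then show ?thesis using z[of "a + 1" "a + 1"] ab by auto
    next
      case 2 then show ?thesis using z[of "1 - a" "1 - a"] ab by auto
    next
      case 3 then show ?thesis using z[of "1 - b" "1 - b"] ab by auto
    next
      case 4 then show ?thesis using z[of b "b + 1"] ab by auto
    qed
  qed
  then show ?thesis
    using ab by (auto simp: zigzag_def intro!: exI[of _ "- a"])
qed

lemma zigzag_between: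
  assumes "W \<in> zigzag r" "x \<in> closed_chain j" "fst W < x" "x < snd W"
  shows "\<exists>k. x = pt (Fin k) r"
  using assms(2)
proof (cases rule: closed_chainE)
  case (1 k s)
  then show ?thesis
    using assms by (auto simp: zigzag_def)
next
  case (2 s)
  then show ?thesis
    using assms by (auto simp: zigzag_def)
qed

lemma chordsD:
  assumes "Z \<in> chords S"
  shows "fst Z \<in> S" "snd Z \<in> S" "fst Z < snd Z"
  using assms by (auto simp: chords_def)

lemma crossing_between:
  assumes "crossing W Z"
  shows "fst W < fst Z \<and> fst Z < snd W \<or> fst W < snd Z \<and> snd Z < snd W"
  using assms by (cases W; cases Z) (auto simp: crossing_Pair)

lemma zigzag_noncrossing_chord:
  assumes "W \<in> zigzag r" "fst Z \<in> closed_chain j" "snd Z \<in> closed_chain j"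
    "\<And>k. fst Z \<noteq> pt (Fin k) r" "\<And>k. snd Z \<noteq> pt (Fin k) r"
  shows "\<not> crossing W Z"
  using crossing_between[of W Z] zigzag_between[OF assms(1)] assms by blast

text \<open>The chord from \<open>- (\<bar>k\<bar> + 1)\<close> to \<open>\<bar>k\<bar> + 1\<close> passes over \<open>k\<close>, so an arc ending at \<open>k\<close> that does not
cross it stays inside the copy, where the zigzag is maximal.\<close>

lemma zigzag_absorbs:
  assumes Z: "Z \<in> chords (closed_chain j)" and n: "\<And>W. W \<in> zigzag r \<Longrightarrow> \<not> crossing W Z"
    and k: "fst Z = pt (Fin k) r \<or> snd Z = pt (Fin k) r"
  shows "Z \<in> zigzag r"
proof -
  obtain x y c where Zc: "Z = (x, y)" "x \<in> closed_chain j" "y \<in> closed_chain j"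
    "c \<in> closed_chain j" "x < c" "c < y"
    using Z by (auto simp: chords_def)
  obtain u v where uv: "(u, v) \<in> zigzag r" "u < pt (Fin k) r" "pt (Fin k) r < v"
  proof
    show "(pt (Fin (- (\<bar>k\<bar> + 1))) r, pt (Fin (\<bar>k\<bar> + 1)) r) \<in> zigzag r"
      unfolding zigzag_def by (intro CollectI exI[of _ "\<bar>k\<bar> + 1"]) auto
  qed auto
  have ends: "\<exists>l. u = pt (Fin l) r" "\<exists>l. v = pt (Fin l) r"
    using uv(1) by (auto simp: zigzag_def)
  have in_copy: "\<exists>l. z = pt (Fin l) r" if z: "z \<in> closed_chain j" "u \<le> z" "z \<le> v" for z
    using z ends zigzag_between[OF uv(1) z(1)] by (cases "z = u \<or> z = v") auto
  have "u \<le> x" "y \<le> v"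
    using n[OF uv(1)] k uv(2,3) Zc(5,6) unfolding Zc(1) crossing_Pair fst_conv snd_conv by linarith+
  then obtain a b l where "x = pt (Fin a) r" "y = pt (Fin b) r" "c = pt (Fin l) r"
    using in_copy[of x] in_copy[of y] in_copy[of c] Zc by force
  then show ?thesis
    using zigzag_maximal[of a b r] n Zc by auto
qed

lemma zigzag_chord: "zigzag r \<subseteq> chords (open_chain (Suc r))"
proof
  fix Z assume "Z \<in> zigzag r"
  then obtain k l where "Z = (pt (Fin (- k)) r, pt (Fin l) r)" "1 \<le> k" "k \<le> l"
    by (auto simp: zigzag_def)
  moreover have "pt (Fin l) r \<in> open_chain (Suc r)" for l
    by (auto simp: open_chain_def)
  ultimately show "Z \<in> chords (open_chain (Suc r))"
    unfolding chords_def by (auto intro!: bexI[of _ "pt (Fin 0) r"])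
qed

lemma zigzags_chord: "r < i \<Longrightarrow> zigzag r \<subseteq> chords (open_chain i)"
  using zigzag_chord[of r] chords_mono[OF open_chain_mono[of "Suc r" i]] by auto

section \<open>Completing by increasing depth of the limit points\<close>

text \<open>The depth of a limit point, shifted by one so that 0 is left for the other points.\<close>

definition level :: "real \<Rightarrow> nat" where
  "level x = (if \<exists>r. x = pt Pinf r then Suc (THE r. x = pt Pinf r) else 0)"

lemma level_Pinf [simp]: "level (pt Pinf r) = Suc r"
  by (auto simp: level_def)

lemma level_Fin [simp]: "level (pt (Fin k) r) = 0"
  by (auto simp: level_def)

text \<open>A chord has rank \<open>Suc r\<close> if the limit point of depth \<open>r\<close> is the deepest one among its ends. Completing in the order of
the rank means adding the limit points one after the other from the top.\<close>

definition chord_rank :: "real \<times> real \<Rightarrow> nat" where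
  "chord_rank Z = max (level (fst Z)) (level (snd Z))"

lemma level_Suc_inj: "level x = Suc s \<Longrightarrow> level y = Suc s \<Longrightarrow> x = y"
  unfolding level_def by (auto split: if_splits)

text \<open>Two chords of the same positive rank have a limit point in common.\<close>

lemma same_rank_noncrossing:
  assumes "chord_rank Y = chord_rank Z" "chord_rank Z \<noteq> 0"
  shows "\<not> crossing Y Z"
proof -
  obtain s where s: "chord_rank Y = Suc s" "chord_rank Z = Suc s"
    using assms by (metis not0_implies_Suc)
  then have "level (fst Y) = Suc s \<or> level (snd Y) = Suc s" "level (fst Z) = Suc s \<or> level (snd Z) = Suc s"
    by (auto simp: chord_rank_def max_def split: if_splits)
  then have "fst Y = fst Z \<or> fst Y = snd Z \<or> snd Y = fst Z \<or> snd Y = snd Z"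
    using level_Suc_inj by metis
  then show ?thesis
    by (cases Y; cases Z) (auto simp: crossing_Pair)
qed

definition chord_completion :: "nat \<Rightarrow> (real \<times> real) set \<Rightarrow> (real \<times> real) set \<Rightarrow> (real \<times> real) set" where
  "chord_completion j R T = greedy (noncrossing (chords (closed_chain j))) (Wellfounded.measure chord_rank) (T \<union> R)"

text \<open>The requirements under which adjoining \<open>R\<close> and completing by rank turns the clusters of
\<open>chords S - X\<close> into clusters of a closed chain. The set \<open>X\<close> takes care of pairs like \<open>(1, n)\<close> which are sides and
not arcs; they have to be in \<open>R\<close>. Chords of rank 0 are the only ones that could conflict
without being ordered, and by the last requirement there is no such conflict.\<close>

definition completable :: "nat \<Rightarrow> real set \<Rightarrow> (real \<times> real) set \<Rightarrow> (real \<times> real) set \<Rightarrow> bool" where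
  "completable j S X R \<longleftrightarrow> S \<subseteq> closed_chain j \<and> fills_gaps S \<and> X \<inter> chords S \<subseteq> R \<and>
     R \<subseteq> chords (closed_chain j) \<and> (\<forall>U\<in>R. \<forall>W\<in>R \<union> chords S. \<not> crossing U W) \<and>
     (\<forall>Z\<in>chords (closed_chain j). chord_rank Z = 0 \<longrightarrow> (\<forall>W\<in>R. \<not> crossing W Z) \<longrightarrow> Z \<in> chords S \<union> R)"

lemma completableD:
  assumes "completable j S X R"
  shows "S \<subseteq> closed_chain j" "fills_gaps S" "X \<inter> chords S \<subseteq> R" "R \<subseteq> chords (closed_chain j)"
    "U \<in> R \<Longrightarrow> W \<in> R \<union> chords S \<Longrightarrow> \<not> crossing U W"
    "Z \<in> chords (closed_chain j) \<Longrightarrow> chord_rank Z = 0 \<Longrightarrow> \<forall>W\<in>R. \<not> crossing W Z \<Longrightarrow> Z \<in> chords S \<union> R"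
  using assms unfolding completable_def by blast+

lemma completable_sides:
  assumes c: "completable j S X R" and ab: "(a, b) \<in> chords S - X" "(c, d) \<in> chords S - X"
    and ord: "a < c" "c < b" "b < d" and E: "E \<in> sides a c b d"
  shows "E \<in> chords S - X \<or>
    (\<forall>Z\<in>chords (closed_chain j). (\<forall>W\<in>R. \<not> crossing W Z) \<longrightarrow> \<not> crossing E Z)"
proof -
  obtain x y where xy: "E = (x, y)" "x \<in> S" "y \<in> S" "x < y"
    using E ab ord by (auto simp: sides_def chords_def)
  show ?thesis
  proof (cases "E \<in> chords S")
    case True
    then show ?thesis
      using completableD(3)[OF c] by blast
  next
    case False
    have "\<not> crossing E Z" if Z: "Z \<in> chords (closed_chain j)" for Z
    proof
      assume "crossing E Z"
      then obtain v where "v \<in> closed_chain j" "x < v" "v < y"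
        using crossing_between[of E Z] chordsD(1,2)[OF Z] xy by auto
      then show False
        using completableD(2)[OF c] xy False unfolding fills_gaps_def chords_def by blast
    qed
    then show ?thesis
      by blast
  qed
qed

lemma completable_induces:
  assumes c: "completable j S X R"
  shows "induces_cluster_theory (noncrossing (chords S - X))"
proof (rule induces_noncrossing)
  fix a b c' d E assume "(a, b) \<in> chords S - X" "(c', d) \<in> chords S - X" "a < c'" "c' < b" "b < d"
    "E \<in> sides a c' b d"
  note s = completable_sides[OF c this]
  have "chords S \<subseteq> chords (closed_chain j)"
    using chords_mono completableD(1)[OF c] .
  then show "E \<in> chords S - X \<or> (\<forall>Z\<in>chords S - X. \<not> crossing Z E)"
    using s completableD(5)[OF c] crossing_sym by blast
qed

lemma complete_cluster_map:
  assumes c: "completable j S X R"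
  shows "cluster_map (noncrossing (chords S - X)) (noncrossing (chords (closed_chain j)))
    (\<lambda>Z. Z) (chord_completion j R)"
proof -
  have "cluster_map (noncrossing (chords S - X)) (noncrossing (chords (closed_chain j)))
    (map_prod (\<lambda>x. x) (\<lambda>x. x))
    (\<lambda>T. greedy (noncrossing (chords (closed_chain j))) (Wellfounded.measure chord_rank) (map_prod (\<lambda>x. x) (\<lambda>x. x) ` T \<union> R))"
  proof (rule greedy_cluster_map[where V = UNIV])
    show "mutation_closed (noncrossing (chords S - X))"
      using induces_mutation_closed[OF completable_induces[OF c]] .
    show "map_prod (\<lambda>x. x) (\<lambda>x. x) ` (chords S - X) \<subseteq> chords (closed_chain j)"
      using chords_mono[OF completableD(1)[OF c]] by (auto simp: map_prod_ident)
    show "R \<subseteq> chords (closed_chain j)"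
      using completableD(4)[OF c] .
    fix T Y Z assume T: "cluster (noncrossing (chords S - X)) T"
      and YZ: "Y \<in> chords (closed_chain j)" "Z \<in> chords (closed_chain j)" "crossing Y Z"
        "\<forall>W\<in>map_prod (\<lambda>x. x) (\<lambda>x. x) ` T \<union> R. \<not> crossing W Y \<and> \<not> crossing W Z"
    have n: "\<not> crossing W Y" "\<not> crossing W Z" if "W \<in> T \<union> R" for W
      using YZ(4) that by (auto simp: map_prod_ident)
    \<comment> \<open>Crossing candidates have different rank: those of equal positive rank share an end, and those of rank 0 are in \<open>T \<union> R\<close>.\<close>
    have "chord_rank Y \<noteq> chord_rank Z"
    proof
      assume eq: "chord_rank Y = chord_rank Z"
      then have "chord_rank Y = 0"
        using same_rank_noncrossing YZ(3) by metis
      then have "Y \<in> chords S \<union> R"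
        using completableD(6)[OF c YZ(1)] n by blast
      then have "Y \<in> (chords S - X) \<union> R"
        using completableD(3)[OF c] by blast
      moreover have "Y \<in> T" if "Y \<in> chords S - X"
        using cluster_noncrossing_mem[OF T that] n by blast
      ultimately have "Y \<in> T \<union> R"
        by blast
      then show False
        using n YZ(3) by blast
    qed
    then show "(Y, Z) \<in> Wellfounded.measure chord_rank \<or> (Z, Y) \<in> Wellfounded.measure chord_rank"
      by auto
  next
    fix a b c' d E assume "(a, b) \<in> chords S - X" "(c', d) \<in> chords S - X" "a < c'" "c' < b" "b < d"
      "E \<in> sides a c' b d"
    then show "E \<in> chords S - X \<or> (\<forall>Z\<in>chords (closed_chain j). (\<forall>W\<in>R. \<not> crossing W Z) \<longrightarrow>
        \<not> crossing (map_prod (\<lambda>x. x) (\<lambda>x. x) E) Z)"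
      using completable_sides[OF c] by (simp add: map_prod_ident)
  qed (use completableD(5)[OF c] in \<open>auto simp: map_prod_ident\<close>)
  then show ?thesis
    by (simp add: map_prod_ident chord_completion_def[abs_def])
qed

lemma complete_factors:
  assumes c: "completable j S X R" and c': "completable j S' X' R'"
    and sub: "chords S - X \<subseteq> chords S' - X'" "R \<subseteq> (chords S' - X') \<union> R'"
    and R': "\<And>T. cluster (noncrossing (chords S - X)) T \<Longrightarrow> R' \<subseteq> chord_completion j R T"
    and late: "\<And>Y Z. Z \<in> chords S' - X' \<Longrightarrow> Y \<in> chords (closed_chain j) \<Longrightarrow> \<forall>W\<in>R. \<not> crossing W Y \<Longrightarrow>
      chord_rank Y < chord_rank Z \<Longrightarrow> crossing Y Z \<Longrightarrow> Y \<in> chords S' - X'"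
  shows "factors (noncrossing (chords S - X)) (\<lambda>Z. Z) (chord_completion j R)
    (noncrossing (chords S' - X')) (\<lambda>Z. Z) (chord_completion j R')"
  unfolding chord_completion_def[abs_def]
proof (rule greedy_factors)
  show "chords S' - X' \<subseteq> chords (closed_chain j)"
    using chords_mono[OF completableD(1)[OF c']] by blast
  show "cluster_map (noncrossing (chords S - X)) (noncrossing (chords (closed_chain j))) (\<lambda>Z. Z)
     (\<lambda>T. greedy (noncrossing (chords (closed_chain j))) (Wellfounded.measure chord_rank) (T \<union> R))"
    using complete_cluster_map[OF c] by (simp add: chord_completion_def[abs_def])
  show "R \<subseteq> chords (closed_chain j)"
    using completableD(4)[OF c] .
  show "Y \<in> chords S' - X'" if "Z \<in> chords S' - X'" "Y \<in> chords (closed_chain j)"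
    "\<forall>W\<in>R. \<not> crossing W Y" "(Y, Z) \<in> Wellfounded.measure chord_rank" "crossing Y Z" for Y Z
    by (rule late[OF that(1-3) _ that(5)]) (use that(4) in simp)
  show "\<not> crossing U W" if "U \<in> R" "W \<in> R \<union> (chords S - X)" for U W
    using completableD(5)[OF c that(1)] that(2) by blast
  show "\<not> crossing U W" if "U \<in> R'" "W \<in> chords S' - X'" for U W
    using completableD(5)[OF c' that(1)] that(2) by blast
  show "R' \<subseteq> greedy (noncrossing (chords (closed_chain j))) (Wellfounded.measure chord_rank) (T \<union> R)"
    if "cluster (noncrossing (chords S - X)) T" for T
    using R'[OF that] by (simp add: chord_completion_def)
qed (use sub in auto)

section \<open>Completions along the chains of copies\<close>

lemma zigzag_fst_snd: "W \<in> zigzag r \<Longrightarrow> (\<exists>k. fst W = pt (Fin k) r) \<and> (\<exists>k. snd W = pt (Fin k) r)"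
  by (auto simp: zigzag_def)

lemma zigzags_chords: "zigzags i j \<subseteq> chords (open_chain j)"
  using zigzags_chord by (fastforce simp: zigzags_iff)

lemma zigzags_mono: "i \<le> i' \<Longrightarrow> zigzags i' j \<subseteq> zigzags i j"
  by (meson order.trans subsetI zigzags_iff)

lemma zigzags_noncrossing:
  assumes S: "S \<subseteq> closed_chain j" "\<And>k r. pt (Fin k) r \<in> S \<Longrightarrow> r < i"
    and U: "U \<in> zigzags i j" and W: "W \<in> zigzags i j \<union> chords S"
  shows "\<not> crossing U W"
proof -
  obtain r where r: "i \<le> r" "U \<in> zigzag r"
    using U by (auto simp: zigzags_iff)
  consider "W \<in> zigzag r" | s where "s \<noteq> r" "W \<in> zigzag s" "W \<in> zigzags i j" | "W \<in> chords S"
    using W unfolding Un_iff zigzags_iff by metis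
  then show ?thesis
  proof cases
    case 1
    then show ?thesis
      using zigzag_noncrossing r by blast
  next
    case 2
    then have "W \<in> chords (closed_chain j)"
      using zigzags_chords chords_mono[OF open_chain_subset] by blast
    then show ?thesis
      using zigzag_noncrossing_chord[OF r(2), of W j] chordsD zigzag_fst_snd[OF 2(2)] 2(1) by auto
  next
    case 3
    then show ?thesis
      using zigzag_noncrossing_chord[OF r(2), of W j] chordsD(1,2)[OF 3] S r(1)
      by (metis not_le subsetD)
  qed
qed

lemma zigzags_absorb:
  assumes Z: "Z \<in> chords (closed_chain j)" and n: "\<forall>W\<in>zigzags i j. \<not> crossing W Z" and "Z \<notin> zigzags i j"
    and k: "fst Z = pt (Fin k) r \<or> snd Z = pt (Fin k) r"
  shows "r < i"
proof (rule ccontr)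
  assume "\<not> r < i"
  moreover have "r < j"
    using k chordsD(1,2)[OF Z] by auto
  ultimately have "zigzag r \<subseteq> zigzags i j"
    unfolding subset_iff zigzags_iff by (metis not_less)
  then show False
    using zigzag_absorbs[OF Z _ k] n assms(3) by blast
qed

lemma rank_zero_chord:
  assumes Z: "Z \<in> chords (closed_chain j)" "\<forall>W\<in>zigzags i j. \<not> crossing W Z" "chord_rank Z = 0"
  shows "Z \<in> chords (open_chain i) \<or> Z \<in> zigzags i j"
proof (rule disjCI)
  assume nz: "Z \<notin> zigzags i j"
  have "level (fst Z) = 0" "level (snd Z) = 0"
    using Z(3) by (auto simp: chord_rank_def)
  then obtain a r b s where ab: "fst Z = pt (Fin a) r" "snd Z = pt (Fin b) s"
    using chordsD(1,2)[OF Z(1)] by (metis closed_chainE level_Pinf nat.distinct(1))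
  then have "r < i" "s < i"
    using zigzags_absorb[OF Z(1,2) nz] by blast+
  then have "fst Z \<in> open_chain i" "snd Z \<in> open_chain i"
    using ab by (auto simp: open_chain_def)
  moreover have "fills_gaps (open_chain i)"
    by (rule fills_gapsI[of i]) auto
  ultimately show "Z \<in> chords (open_chain i)"
    using chords_restrict Z(1) by blast
qed

lemma fills_gaps_closed: "fills_gaps (closed_chain i)"
proof (rule fills_gapsI[OF open_chain_subset])
  fix x assume "x \<in> closed_chain i"
  then show "x \<in> open_chain i \<or> (\<exists>r\<le>i. x = pt Pinf r)"
    by (cases rule: closed_chainE) (auto simp: open_chain_def less_imp_le)
qed

text \<open>The zigzags cut off all copies of depth at least \<open>i\<close>, and the bound on the rank excludes limit points
of such depth.\<close>

lemma low_rank_chord: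
  assumes Z: "Z \<in> chords (closed_chain j)" "\<forall>W\<in>zigzags i j. \<not> crossing W Z" "chord_rank Z \<le> i"
  shows "Z \<in> chords (closed_chain i) \<or> Z \<in> zigzags i j"
proof (rule disjCI)
  assume nz: "Z \<notin> zigzags i j"
  have "z \<in> closed_chain i" if z: "z = fst Z \<or> z = snd Z" for z
  proof -
    have "z \<in> closed_chain j"
      using z chordsD(1,2)[OF Z(1)] by auto
    then show ?thesis
    proof (cases rule: closed_chainE)
      case (1 k r)
      then have "r < i"
        using zigzags_absorb[OF Z(1,2) nz] z by metis
      then show ?thesis
        using 1 by simp
    next
      case (2 r)
      have "level z \<le> i"
        using z Z(3) by (auto simp: chord_rank_def)
      then show ?thesis
        using 2 by simp
    qed
  qed
  then show "Z \<in> chords (closed_chain i)"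
    using chords_restrict[OF fills_gaps_closed Z(1)] by blast
qed

text \<open>Complements the triangulations of the polygon on \<open>1, \<dots>, n\<close> to triangulations of the integers: all
outer chords emanate from 1. The bound \<open>3 \<le> k\<close> matters for \<open>n = 2\<close> only, when \<open>(1, 2)\<close> is not a
chord. The fans for different \<open>n\<close> are nested, which makes the embeddings of polygons composable.\<close>

definition double_fan :: "nat \<Rightarrow> (real \<times> real) set" where
  "double_fan n = {(pt (Fin 1) 0, pt (Fin k) 0) | k. int n \<le> k \<and> 3 \<le> k} \<union>
     {(pt (Fin a) 0, pt (Fin 1) 0) | a. a \<le> -1}"

definition segment :: "nat \<Rightarrow> real set" where
  "segment n = {pt (Fin k) 0 | k. 1 \<le> k \<and> k \<le> int n}"

abbreviation "edge n \<equiv> (pt (Fin 1) 0, pt (Fin (int n)) 0)"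
abbreviation "ext_edge \<equiv> (pt Pinf 1, pt Pinf 0)"

lemma double_fan_chords: "double_fan n \<subseteq> chords (open_chain 1)"
proof
  fix Z assume "Z \<in> double_fan n"
  then consider k where "Z = (pt (Fin 1) 0, pt (Fin k) 0)" "3 \<le> k"
    | a where "Z = (pt (Fin a) 0, pt (Fin 1) 0)" "a \<le> -1"
    by (auto simp: double_fan_def)
  then show "Z \<in> chords (open_chain 1)"
  proof cases
    case 1
    then show ?thesis
      unfolding chords_def by (auto intro!: bexI[of _ "pt (Fin 2) 0"])
  next
    case 2
    then show ?thesis
      unfolding chords_def by (auto intro!: bexI[of _ "pt (Fin 0) 0"])
  qed
qed

lemma double_fan_noncrossing:
  assumes "U \<in> double_fan n" "W \<in> double_fan n \<union> chords (segment n)"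
  shows "\<not> crossing U W"
proof -
  obtain a b where U: "U = (pt (Fin a) 0, pt (Fin b) 0)" "a = 1 \<and> int n \<le> b \<or> b = 1"
    using assms(1) unfolding double_fan_def by blast
  obtain c d where W: "W = (pt (Fin c) 0, pt (Fin d) 0)" "c = 1 \<or> d = 1 \<or> 1 \<le> c \<and> d \<le> int n"
    using assms(2) unfolding double_fan_def chords_def segment_def by blast
  show ?thesis
    unfolding U(1) W(1) crossing_Pair using U(2) W(2) by simp linarith
qed

lemma double_fan_maximal:
  assumes n: "2 \<le> n" and Z: "Z \<in> chords (open_chain 1)" and nc: "\<forall>W\<in>double_fan n. \<not> crossing W Z"
  shows "Z \<in> chords (segment n) \<union> double_fan n"
proof -
  obtain a b c where Zab: "Z = (pt (Fin a) 0, pt (Fin b) 0)" "a < c" "c < b"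
    using Z by (auto simp: chords_def open_chain_def)
  have right: "\<not> (1 < a \<and> a < k \<and> k < b) \<and> \<not> (a < 1 \<and> 1 < b \<and> b < k)" if "int n \<le> k" "3 \<le> k" for k
    using nc[rule_format, of "(pt (Fin 1) 0, pt (Fin k) 0)"] that
    unfolding Zab(1) by (auto simp: double_fan_def crossing_Pair)
  have left: "\<not> (d < a \<and> a < 1 \<and> 1 < b) \<and> \<not> (a < d \<and> d < b \<and> b < 1)" if "d \<le> -1" for d
    using nc[rule_format, of "(pt (Fin d) 0, pt (Fin 1) 0)"] that
    unfolding Zab(1) by (auto simp: double_fan_def crossing_Pair)
  consider "a < 1" "b < 1" | "a < 1" "b = 1" | "a < 1" "1 < b" | "a = 1" "int n \<le> b"
    | "1 \<le> a" "b \<le> int n" | "1 < a" "int n < b"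
    by linarith
  then show ?thesis
  proof cases
    case 1
    then show ?thesis
      using left[of "a + 1"] Zab by auto
  next
    case 2
    then show ?thesis
      using Zab by (auto simp: double_fan_def)
  next
    case 3
    then show ?thesis
      using right[of "b + 3 + int n"] by auto
  next
    case 4
    then show ?thesis
      using Zab by (auto simp: double_fan_def)
  next
    case 5
    then have "pt (Fin a) 0 \<in> segment n" "pt (Fin b) 0 \<in> segment n" "pt (Fin c) 0 \<in> segment n"
      using Zab by (auto simp: segment_def)
    then show ?thesis
      using Zab by (auto simp: chords_def intro!: bexI[of _ "pt (Fin c) 0"])
  next
    case 6
    then have "int n \<le> max (a + 1) (int n)" "3 \<le> max (a + 1) (int n)" "a < max (a + 1) (int n)"
      "max (a + 1) (int n) < b"
      using Zab(2,3) by linarith+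
    then show ?thesis
      using right[of "max (a + 1) (int n)"] 6 by blast
  qed
qed

lemma segment_subset: "segment n \<subseteq> open_chain 1"
  by (auto simp: segment_def open_chain_def)

lemma edge_chord: "edge n \<in> chords (segment n) \<Longrightarrow> 3 \<le> n"
  by (auto simp: chords_def segment_def)

lemma completable_chain: "i \<le> j \<Longrightarrow> completable j (open_chain i) {} (zigzags i j)"
  unfolding completable_def
proof (intro conjI ballI impI)
  assume ij: "i \<le> j"
  show sub: "open_chain i \<subseteq> closed_chain j"
    using open_chain_subset open_chain_mono[OF ij] by blast
  show "fills_gaps (open_chain i)"
    by (rule fills_gapsI[of i]) auto
  show "zigzags i j \<subseteq> chords (closed_chain j)"
    using zigzags_chords chords_mono[OF open_chain_subset] by blast
  show "\<not> crossing U W" if "U \<in> zigzags i j" "W \<in> zigzags i j \<union> chords (open_chain i)" for U W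
    by (rule zigzags_noncrossing[OF sub _ that]) auto
  show "Z \<in> chords (open_chain i) \<union> zigzags i j" if "Z \<in> chords (closed_chain j)" "chord_rank Z = 0"
    "\<forall>W\<in>zigzags i j. \<not> crossing W Z" for Z
    using rank_zero_chord that by blast
qed auto

lemma completable_closed_chain: "i \<le> j \<Longrightarrow> completable j (closed_chain i) {} (zigzags i j)"
  unfolding completable_def
proof (intro conjI ballI impI)
  assume ij: "i \<le> j"
  show sub: "closed_chain i \<subseteq> closed_chain j"
    using closed_chain_mono[OF ij] .
  show "fills_gaps (closed_chain i)"
    by (rule fills_gaps_closed)
  show "zigzags i j \<subseteq> chords (closed_chain j)"
    using zigzags_chords chords_mono[OF open_chain_subset] by blast
  show "\<not> crossing U W" if "U \<in> zigzags i j" "W \<in> zigzags i j \<union> chords (closed_chain i)" for U W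
    by (rule zigzags_noncrossing[OF sub _ that]) auto
  show "Z \<in> chords (closed_chain i) \<union> zigzags i j" if "Z \<in> chords (closed_chain j)" "chord_rank Z = 0"
    "\<forall>W\<in>zigzags i j. \<not> crossing W Z" for Z
    using rank_zero_chord[OF that(1,3,2)] chords_mono[OF open_chain_subset] by blast
qed auto

lemma ext_chain_bounds:
  assumes "x \<in> insert (pt Pinf 1) (closed_chain 1)"
  shows "pt Pinf 1 \<le> x" "x \<le> pt Pinf 0"
proof -
  have "x = pt Pinf 1 \<or> (\<exists>k. x = pt (Fin k) 0) \<or> x = pt Pinf 0"
    using assms by (auto elim: closed_chainE)
  then show "pt Pinf 1 \<le> x" "x \<le> pt Pinf 0"
    by (auto simp: less_imp_le)
qed

lemma ext_edge_noncrossing: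
  assumes "W \<in> chords (insert (pt Pinf 1) (closed_chain 1))"
  shows "\<not> crossing ext_edge W"
proof -
  obtain x y where "W = (x, y)" "x \<in> insert (pt Pinf 1) (closed_chain 1)"
    "y \<in> insert (pt Pinf 1) (closed_chain 1)"
    using assms by (auto simp: chords_def)
  then show ?thesis
    using ext_chain_bounds[of x] ext_chain_bounds[of y] by (auto simp: crossing_Pair)
qed

lemma ext_edge_chord: "ext_edge \<in> chords (insert (pt Pinf 1) (closed_chain 1))"
  unfolding chords_def by (auto intro!: bexI[of _ "pt (Fin 0) 0"])

lemma completable_ext:
  assumes j: "2 \<le> j"
  shows "completable j (insert (pt Pinf 1) (closed_chain 1)) {ext_edge} (insert ext_edge (zigzags 1 j))"
  unfolding completable_def
proof (intro conjI ballI impI)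
  let ?S = "insert (pt Pinf 1) (closed_chain 1)"
  show sub: "?S \<subseteq> closed_chain j"
    using closed_chain_mono[of 1 j] j by simp
  show "fills_gaps ?S"
  proof (rule fills_gapsI[of 1])
    show "open_chain 1 \<subseteq> ?S"
      using open_chain_subset by blast
    show "x \<in> open_chain 1 \<or> (\<exists>r\<le>1. x = pt Pinf r)" if "x \<in> ?S" for x
      using that by (auto simp: open_chain_def elim!: closed_chainE)
  qed
  show "insert ext_edge (zigzags 1 j) \<subseteq> chords (closed_chain j)"
    using zigzags_chords chords_mono[OF open_chain_subset] ext_edge_chord chords_mono[OF sub] by blast
  show "\<not> crossing U W" if "U \<in> insert ext_edge (zigzags 1 j)"
    "W \<in> insert ext_edge (zigzags 1 j) \<union> chords ?S" for U W
  proof -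
    have z: "\<not> crossing U W" if "U \<in> zigzags 1 j" "W \<in> zigzags 1 j \<union> chords ?S" for U W
      by (rule zigzags_noncrossing[OF sub _ that]) auto
    then show ?thesis
      using that ext_edge_noncrossing ext_edge_chord crossing_sym by (metis Un_iff insert_iff)
  qed
  show "Z \<in> chords ?S \<union> insert ext_edge (zigzags 1 j)" if "Z \<in> chords (closed_chain j)" "chord_rank Z = 0"
    "\<forall>W\<in>insert ext_edge (zigzags 1 j). \<not> crossing W Z" for Z
    using rank_zero_chord[of Z j 1] that chords_mono[OF open_chain_subset[of 1]]
      chords_mono[OF subset_insertI[of "closed_chain 1" "pt Pinf 1"]] by blast
qed auto

lemma completable_segment:
  assumes n: "2 \<le> n" and j: "1 \<le> j"
  shows "completable j (segment n) {edge n} (double_fan n \<union> zigzags 1 j)"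
  unfolding completable_def
proof (intro conjI ballI impI)
  have c1: "open_chain 1 \<subseteq> closed_chain j"
    using open_chain_subset open_chain_mono[OF j] by blast
  show sub: "segment n \<subseteq> closed_chain j"
    using segment_subset c1 by blast
  show "fills_gaps (segment n)"
    unfolding segment_def using fills_gaps_segment[of "int n"] .
  show "{edge n} \<inter> chords (segment n) \<subseteq> double_fan n \<union> zigzags 1 j"
    using edge_chord by (auto simp: double_fan_def)
  show "double_fan n \<union> zigzags 1 j \<subseteq> chords (closed_chain j)"
    using zigzags_chords chords_mono[OF open_chain_subset] double_fan_chords chords_mono[OF c1] by blast
  show "\<not> crossing U W" if "U \<in> double_fan n \<union> zigzags 1 j"
    "W \<in> double_fan n \<union> zigzags 1 j \<union> chords (segment n)" for U W
  proof -
    have z: "\<not> crossing U W" if "U \<in> zigzags 1 j" "W \<in> zigzags 1 j \<union> chords (open_chain 1)" for U W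
      by (rule zigzags_noncrossing[OF c1 _ that]) auto
    have s: "chords (segment n) \<subseteq> chords (open_chain 1)"
      using chords_mono segment_subset .
    have f: "\<not> crossing U W" if "U \<in> double_fan n" "W \<in> double_fan n \<union> zigzags 1 j \<union> chords (segment n)" for U W
    proof (cases "W \<in> zigzags 1 j")
      case True
      then show ?thesis
        using z[OF True, of U] double_fan_chords that(1) crossing_sym[of U W] by blast
    next
      case False
      then show ?thesis
        using double_fan_noncrossing that by blast
    qed
    show ?thesis
    proof (cases "U \<in> double_fan n")
      case False
      then show ?thesis
        using that z[of U W] s double_fan_chords by blast
    qed (use f that in blast)
  qed
  show "Z \<in> chords (segment n) \<union> (double_fan n \<union> zigzags 1 j)" if "Z \<in> chords (closed_chain j)"
    "chord_rank Z = 0" "\<forall>W\<in>double_fan n \<union> zigzags 1 j. \<not> crossing W Z" for Z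
    using rank_zero_chord[of Z j 1] that double_fan_maximal[OF n, of Z] by blast
qed

lemma complete_superset:
  assumes c: "completable j S X R" and T: "cluster (noncrossing (chords S - X)) T"
  shows "R \<subseteq> chord_completion j R T"
proof
  fix U assume U: "U \<in> R"
  note K = cluster_mapD(3)[OF complete_cluster_map[OF c] T]
  show "U \<in> chord_completion j R T"
  proof (rule cluster_noncrossing_mem[OF K])
    show "U \<in> chords (closed_chain j)"
      using completableD(4)[OF c] U by blast
    fix W assume "W \<in> chord_completion j R T"
    then show "\<not> crossing W U"
      using U crossing_sym[of W U] unfolding chord_completion_def by (subst (asm) greedy_iff) auto
  qed
qed

lemma rank_zero_chain: "Z \<in> chords (open_chain i) \<Longrightarrow> chord_rank Z = 0"
  by (auto simp: chords_def open_chain_def chord_rank_def)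

lemma rank_closed_chain: "Z \<in> chords (closed_chain i) \<Longrightarrow> chord_rank Z \<le> i"
  using chordsD(1,2)[of Z] by (fastforce simp: chord_rank_def elim: closed_chainE)

lemma rank_ext: "Z \<in> chords (insert (pt Pinf 1) (closed_chain 1)) \<Longrightarrow> chord_rank Z \<le> 2"
  using chordsD(1,2)[of Z] by (fastforce simp: chord_rank_def elim: closed_chainE)

text \<open>The notion \<open>factors\<close> for completions in a closed chain of \<open>j\<close> copies.\<close>

definition lower_factors where
  "lower_factors j S X R S' X' R' \<longleftrightarrow>
     factors (noncrossing (chords S - X)) (\<lambda>Z. Z) (chord_completion j R)
       (noncrossing (chords S' - X')) (\<lambda>Z. Z) (chord_completion j R')"

lemma factors_segment:
  assumes "2 \<le> m" "m < n" "1 \<le> j"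
  shows "lower_factors j (segment m) {edge m} (double_fan m \<union> zigzags 1 j)
    (segment n) {edge n} (double_fan n \<union> zigzags 1 j)"
  unfolding lower_factors_def
proof (rule complete_factors)
  show c: "completable j (segment m) {edge m} (double_fan m \<union> zigzags 1 j)"
    and "completable j (segment n) {edge n} (double_fan n \<union> zigzags 1 j)"
    using completable_segment assms by auto
  have "segment m \<subseteq> segment n" "pt (Fin (int n)) 0 \<notin> segment m"
    using assms by (auto simp: segment_def)
  then show "chords (segment m) - {edge m} \<subseteq> chords (segment n) - {edge n}"
    using chords_mono by (fastforce simp: chords_def)
  have "double_fan m \<subseteq> (chords (segment n) - {edge n}) \<union> double_fan n"
proof
    fix Z assume "Z \<in> double_fan m"
    moreover have "Z \<in> chords (segment n) - {edge n}"
      if "Z = (pt (Fin 1) 0, pt (Fin k) 0)" "3 \<le> k" "k < int n" for k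
      using that unfolding chords_def by (auto simp: segment_def intro!: exI[of _ "pt (Fin 2) 0"])
    ultimately show "Z \<in> (chords (segment n) - {edge n}) \<union> double_fan n"
      unfolding double_fan_def using not_le by blast
  qed
  then show "double_fan m \<union> zigzags 1 j \<subseteq> chords (segment n) - {edge n} \<union> (double_fan n \<union> zigzags 1 j)"
    by blast
  have "double_fan n \<subseteq> double_fan m"
    using assms by (auto simp: double_fan_def)
  then show "double_fan n \<union> zigzags 1 j \<subseteq> chord_completion j (double_fan m \<union> zigzags 1 j) T"
    if "cluster (noncrossing (chords (segment m) - {edge m})) T" for T
    using complete_superset[OF c that] by blast
  show "Y \<in> chords (segment n) - {edge n}" if "Z \<in> chords (segment n) - {edge n}" "chord_rank Y < chord_rank Z" for Y Z
    using rank_zero_chain[of Z 1] chords_mono[OF segment_subset[of n]] that by auto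
qed

lemma factors_segment_chain:
  assumes "2 \<le> n" "1 \<le> j"
  shows "lower_factors j (segment n) {edge n} (double_fan n \<union> zigzags 1 j) (open_chain 1) {} (zigzags 1 j)"
  unfolding lower_factors_def
proof (rule complete_factors)
  show c: "completable j (segment n) {edge n} (double_fan n \<union> zigzags 1 j)"
    using completable_segment assms by auto
  show "completable j (open_chain 1) {} (zigzags 1 j)"
    using completable_chain assms by auto
  show "chords (segment n) - {edge n} \<subseteq> chords (open_chain 1) - {}"
    using chords_mono segment_subset by blast
  show "double_fan n \<union> zigzags 1 j \<subseteq> chords (open_chain 1) - {} \<union> zigzags 1 j"
    using double_fan_chords by blast
  show "zigzags 1 j \<subseteq> chord_completion j (double_fan n \<union> zigzags 1 j) T"
    if "cluster (noncrossing (chords (segment n) - {edge n})) T" for T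
    using complete_superset[OF c that] by blast
  show "Y \<in> chords (open_chain 1) - {}" if "Z \<in> chords (open_chain 1) - {}" "chord_rank Y < chord_rank Z" for Y Z
    using rank_zero_chain[of Z 1] that by auto
qed

lemma zigzags_split: "zigzags a j \<subseteq> chords (open_chain b) \<union> zigzags b j"
proof
  fix W assume "W \<in> zigzags a j"
  then obtain r where "a \<le> r" "r < j" "W \<in> zigzag r"
    by (auto simp: zigzags_iff)
  then show "W \<in> chords (open_chain b) \<union> zigzags b j"
    using zigzags_chord[of r b] unfolding zigzags_iff Un_iff by (cases "r < b") (auto simp: not_less)
qed

lemma factors_chain:
  assumes "a \<le> b" "b \<le> j"
  shows "lower_factors j (open_chain a) {} (zigzags a j) (open_chain b) {} (zigzags b j)"
  unfolding lower_factors_def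
proof (rule complete_factors)
  show c: "completable j (open_chain a) {} (zigzags a j)" and "completable j (open_chain b) {} (zigzags b j)"
    using completable_chain assms by auto
  show "chords (open_chain a) - {} \<subseteq> chords (open_chain b) - {}"
    using chords_mono open_chain_mono assms by blast
  show "zigzags a j \<subseteq> chords (open_chain b) - {} \<union> zigzags b j"
    using zigzags_split assms by blast
  show "zigzags b j \<subseteq> chord_completion j (zigzags a j) T"
    if "cluster (noncrossing (chords (open_chain a) - {})) T" for T
    using complete_superset[OF c that] zigzags_mono assms by blast
  show "Y \<in> chords (open_chain b) - {}" if "Z \<in> chords (open_chain b) - {}" "chord_rank Y < chord_rank Z" for Y Z
    using rank_zero_chain[of Z b] that by auto
qed

text \<open>An obstacle has smaller rank than the chord it refuses, hence small depth, unless it belongs to a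
zigzag, which crosses nothing of the upper copies.\<close>

lemma late_closed_chain:
  assumes R: "zigzags b j \<subseteq> R" and b: "b \<le> j" and Z: "Z \<in> chords (closed_chain b)"
    and Y: "Y \<in> chords (closed_chain j)" "\<forall>W\<in>R. \<not> crossing W Y" "chord_rank Y < chord_rank Z" "crossing Y Z"
  shows "Y \<in> chords (closed_chain b)"
proof -
  have "chord_rank Y \<le> b"
    using Y(3) rank_closed_chain[OF Z] by auto
  then have "Y \<in> chords (closed_chain b) \<or> Y \<in> zigzags b j"
    using low_rank_chord[OF Y(1)] Y(2) R by blast
  moreover have "\<not> crossing Y Z" if "Y \<in> zigzags b j"
    using completableD(5)[OF completable_closed_chain[OF b] that] Z by blast
  ultimately show ?thesis
    using Y(4) by blast
qed

lemma factors_chain_closed_chain: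
  assumes "a \<le> j"
  shows "lower_factors j (open_chain a) {} (zigzags a j) (closed_chain a) {} (zigzags a j)"
  unfolding lower_factors_def
proof (rule complete_factors)
  show c: "completable j (open_chain a) {} (zigzags a j)" and "completable j (closed_chain a) {} (zigzags a j)"
    using completable_chain completable_closed_chain assms by auto
  show "chords (open_chain a) - {} \<subseteq> chords (closed_chain a) - {}"
    using chords_mono open_chain_subset by blast
  show "zigzags a j \<subseteq> chord_completion j (zigzags a j) T"
    if "cluster (noncrossing (chords (open_chain a) - {})) T" for T
    using complete_superset[OF c that] by blast
  show "Y \<in> chords (closed_chain a) - {}" if "Z \<in> chords (closed_chain a) - {}"
    "Y \<in> chords (closed_chain j)" "\<forall>W\<in>zigzags a j. \<not> crossing W Y" "chord_rank Y < chord_rank Z" "crossing Y Z" for Y Z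
    using late_closed_chain[OF subset_refl assms _ that(2-5)] that(1) by blast
qed auto

lemma factors_closed_chain:
  assumes "a \<le> b" "b \<le> j"
  shows "lower_factors j (closed_chain a) {} (zigzags a j) (closed_chain b) {} (zigzags b j)"
  unfolding lower_factors_def
proof (rule complete_factors)
  show c: "completable j (closed_chain a) {} (zigzags a j)"
    and "completable j (closed_chain b) {} (zigzags b j)"
    using completable_closed_chain assms by auto
  show "chords (closed_chain a) - {} \<subseteq> chords (closed_chain b) - {}"
    using chords_mono closed_chain_mono assms by blast
  show "zigzags a j \<subseteq> chords (closed_chain b) - {} \<union> zigzags b j"
    using zigzags_split assms chords_mono[OF open_chain_subset] by blast
  show "zigzags b j \<subseteq> chord_completion j (zigzags a j) T"
    if "cluster (noncrossing (chords (closed_chain a) - {})) T" for T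
    using complete_superset[OF c that] zigzags_mono assms by blast
  show "Y \<in> chords (closed_chain b) - {}" if "Z \<in> chords (closed_chain b) - {}"
    "Y \<in> chords (closed_chain j)" "\<forall>W\<in>zigzags a j. \<not> crossing W Y" "chord_rank Y < chord_rank Z" "crossing Y Z" for Y Z
    using late_closed_chain[OF zigzags_mono[OF assms(1)] assms(2) _ that(2-5)] that(1) by blast
qed

lemma late_ext:
  assumes R: "zigzags 1 j \<subseteq> R" and j: "2 \<le> j" and Z: "Z \<in> chords (insert (pt Pinf 1) (closed_chain 1))"
    and Y: "Y \<in> chords (closed_chain j)" "\<forall>W\<in>R. \<not> crossing W Y" "chord_rank Y < chord_rank Z" "crossing Y Z"
  shows "Y \<in> chords (closed_chain 1)"
proof -
  have "chord_rank Y \<le> 1"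
    using Y(3) rank_ext[OF Z] by auto
  then have "Y \<in> chords (closed_chain 1) \<or> Y \<in> zigzags 1 j"
    using low_rank_chord[OF Y(1)] Y(2) R by blast
  moreover have "\<not> crossing Y Z" if "Y \<in> zigzags 1 j"
    using completableD(5)[OF completable_ext[OF j]] that Z by blast
  ultimately show ?thesis
    using Y(4) by blast
qed

lemma pt_Pinf_1_notin: "pt Pinf 1 \<notin> closed_chain 1"
  by simp

text \<open>The additional limit point doubles the limit point of the single copy, and the edge joining the two
is not an arc of \<open>N_extbar\<close>. That edge is always admitted: it is crossed only by chords that end
below the top copy, and among the chords of smaller rank the zigzags leave none of these outside the
unused copies.\<close>

lemma factors_closed_chain_ext:
  assumes j: "2 \<le> j"
  shows "lower_factors j (closed_chain 1) {} (zigzags 1 j)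
    (insert (pt Pinf 1) (closed_chain 1)) {ext_edge} (insert ext_edge (zigzags 1 j))"
  unfolding lower_factors_def
proof (rule complete_factors)
  let ?S = "insert (pt Pinf 1) (closed_chain 1)"
  show c: "completable j (closed_chain 1) {} (zigzags 1 j)"
    using completable_closed_chain j by auto
  show e: "completable j ?S {ext_edge} (insert ext_edge (zigzags 1 j))"
    using completable_ext[OF j] .
  have sub: "chords (closed_chain 1) \<subseteq> chords ?S"
    by (rule chords_mono) blast
  have no: "ext_edge \<notin> chords (closed_chain 1)"
    using pt_Pinf_1_notin by (auto simp: chords_def)
  then show "chords (closed_chain 1) - {} \<subseteq> chords ?S - {ext_edge}"
    using sub by blast
  show "zigzags 1 j \<subseteq> chords ?S - {ext_edge} \<union> insert ext_edge (zigzags 1 j)"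
    by blast
  show "insert ext_edge (zigzags 1 j) \<subseteq> chord_completion j (zigzags 1 j) T"
    if T: "cluster (noncrossing (chords (closed_chain 1) - {})) T" for T
  proof -
    have "T \<subseteq> chords (closed_chain 1)"
      using clusterD(1)[OF T] by simp
    then have 1: "\<not> crossing W ext_edge" if "W \<in> T \<union> zigzags 1 j" for W
      using that completableD(5)[OF e, of W ext_edge] ext_edge_noncrossing sub crossing_sym by blast
    have K: "chord_completion j (zigzags 1 j) T \<subseteq> chords (closed_chain j)"
      "\<And>U W. U \<in> chord_completion j (zigzags 1 j) T \<Longrightarrow> W \<in> chord_completion j (zigzags 1 j) T \<Longrightarrow> \<not> crossing U W"
      using cluster_mapD(3)[OF complete_cluster_map[OF c] T] clusterD by (force, metis clusterD(2) crossing_irrefl noncrossing_simps(2))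
    have 2: "\<not> crossing Y ext_edge" if "Y \<in> chord_completion j (zigzags 1 j) T" "chord_rank Y < chord_rank ext_edge" for Y
    proof
      assume "crossing Y ext_edge"
      moreover have "\<forall>W\<in>zigzags 1 j. \<not> crossing W Y"
        using K(2) complete_superset[OF c T] that by blast
      ultimately have "Y \<in> chords (closed_chain 1)"
        using late_ext[OF subset_refl j ext_edge_chord _ _ that(2)] K that(1) by blast
      then show False
        using \<open>crossing Y ext_edge\<close> ext_edge_noncrossing sub crossing_sym by blast
    qed
    have "ext_edge \<in> chords (closed_chain j)"
      using completableD(4)[OF e] by blast
    then have "ext_edge \<in> chord_completion j (zigzags 1 j) T"
      unfolding chord_completion_def by (subst greedy_iff) (use 1 2 in \<open>auto simp: chord_completion_def\<close>)
    then show ?thesis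
      using complete_superset[OF c T] by blast
  qed
  show "Y \<in> chords ?S - {ext_edge}" if "Z \<in> chords ?S - {ext_edge}"
    "Y \<in> chords (closed_chain j)" "\<forall>W\<in>zigzags 1 j. \<not> crossing W Y" "chord_rank Y < chord_rank Z" "crossing Y Z" for Y Z
    using late_ext[OF subset_refl j _ that(2-5)] that(1) sub no by blast
qed

text \<open>The edge between the two limit points becomes an arc of the closed chain of two copies, and the copy
below it is filled with its zigzag.\<close>

lemma factors_ext_closed_chain:
  assumes j: "2 \<le> j"
  shows "lower_factors j (insert (pt Pinf 1) (closed_chain 1)) {ext_edge} (insert ext_edge (zigzags 1 j))
    (closed_chain 2) {} (zigzags 2 j)"
  unfolding lower_factors_def
proof (rule complete_factors)
  let ?S = "insert (pt Pinf 1) (closed_chain 1)"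
  show e: "completable j ?S {ext_edge} (insert ext_edge (zigzags 1 j))"
    using completable_ext[OF j] .
  show "completable j (closed_chain 2) {} (zigzags 2 j)"
    using completable_closed_chain j by auto
  have sub: "?S \<subseteq> closed_chain 2"
    using closed_chain_mono[of 1 2] by simp
  then show "chords ?S - {ext_edge} \<subseteq> chords (closed_chain 2) - {}"
    using chords_mono by blast
  show "insert ext_edge (zigzags 1 j) \<subseteq> chords (closed_chain 2) - {} \<union> zigzags 2 j"
    using zigzags_split[of 1 j 2] chords_mono[OF open_chain_subset[of 2]] chords_mono[OF sub] ext_edge_chord by blast
  show "zigzags 2 j \<subseteq> chord_completion j (insert ext_edge (zigzags 1 j)) T"
    if "cluster (noncrossing (chords ?S - {ext_edge})) T" for T
    using complete_superset[OF e that] zigzags_mono[of 1 2 j] by auto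
  show "Y \<in> chords (closed_chain 2) - {}" if "Z \<in> chords (closed_chain 2) - {}"
    "Y \<in> chords (closed_chain j)" "\<forall>W\<in>insert ext_edge (zigzags 1 j). \<not> crossing W Y"
    "chord_rank Y < chord_rank Z" "crossing Y Z" for Y Z
    using late_closed_chain[OF zigzags_mono j _ _ _ that(4,5), of 1] that(1-3) by auto
qed

section \<open>The arc conditions as noncrossing conditions\<close>

definition pcond_iso :: "('a \<Rightarrow> 'b) \<Rightarrow> 'a pcond \<Rightarrow> 'b pcond \<Rightarrow> bool" where
  "pcond_iso k P Q \<longleftrightarrow> bij_betw k (Ind P) (Ind Q) \<and>
     (\<forall>X\<in>Ind P. \<forall>Y\<in>Ind P. compat Q (k X) (k Y) \<longleftrightarrow> compat P X Y)"

text \<open>Arc coordinates \<open>k\<close> transported along the injective constructor \<open>c\<close>.\<close>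

definition unlabel :: "('a \<Rightarrow> 'c) \<Rightarrow> ('a \<Rightarrow> 'b) \<Rightarrow> 'c \<Rightarrow> 'b" where
  "unlabel c k = k \<circ> inv c"

lemma pcond_iso_relabel:
  assumes c: "inj c" and k: "inj_on k (Ind P)"
    and compat: "\<And>X Y. X \<in> Ind P \<Longrightarrow> Y \<in> Ind P \<Longrightarrow> compat P X Y \<longleftrightarrow> \<not> crossing (k X) (k Y)"
  shows "pcond_iso (unlabel c k) (relabel c P) (noncrossing (k ` Ind P))"
proof -
  have u: "unlabel c k (c X) = k X" for X
    using c by (simp add: unlabel_def)
  have "inj_on (unlabel c k) (c ` Ind P)"
    using k u by (auto simp: inj_on_def)
  moreover have "unlabel c k ` c ` Ind P = k ` Ind P"
    using u by (auto simp: image_image)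
  moreover have "compat (relabel c P) (c X) (c Y) \<longleftrightarrow> compat P X Y" if "X \<in> Ind P" "Y \<in> Ind P" for X Y
    using that c by (auto simp: relabel_def inj_eq)
  ultimately show ?thesis
    unfolding pcond_iso_def bij_betw_def using compat u by (auto simp: relabel_def)
qed

lemma pcond_iso_encoding:
  fixes pos :: "'e \<Rightarrow> 'l::linorder"
  assumes c: "inj c" and A: "A \<subseteq> E \<times> E" and inj: "inj_on pos E"
    and lt: "\<And>x y. x \<in> E \<Longrightarrow> y \<in> E \<Longrightarrow> lt x y \<longleftrightarrow> pos x < pos y"
  shows "pcond_iso (unlabel c (map_prod pos pos)) (relabel c (pairwise_encoding A (crossing_A lt)))
    (noncrossing (map_prod pos pos ` A))"
proof -
  let ?P = "pairwise_encoding A (crossing_A lt)"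
  have "pcond_iso (unlabel c (map_prod pos pos)) (relabel c ?P) (noncrossing (map_prod pos pos ` Ind ?P))"
  proof (rule pcond_iso_relabel[OF c])
    have "inj_on (map_prod pos pos) (E \<times> E)"
      using map_prod_inj_on[OF inj inj] .
    then show "inj_on (map_prod pos pos) (Ind ?P)"
      using A by (auto simp: pairwise_encoding_def intro: inj_on_subset)
    fix X Y assume XY: "X \<in> Ind ?P" "Y \<in> Ind ?P"
    obtain a b a' b' where p: "X = (a, b)" "Y = (a', b')"
      by (cases X; cases Y) auto
    have "a \<in> E" "b \<in> E" "a' \<in> E" "b' \<in> E"
      using XY A unfolding p by (auto simp: pairwise_encoding_def)
    then show "compat ?P X Y \<longleftrightarrow> \<not> crossing (map_prod pos pos X) (map_prod pos pos Y)"
      unfolding p by (auto simp: pairwise_encoding_def crossing_A_def crossing_Pair lt)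
  qed
  then show ?thesis
    by (simp add: pairwise_encoding_def)
qed

lemma map_prod_arcs_over:
  assumes lt: "\<And>x y. x \<in> E \<Longrightarrow> y \<in> E \<Longrightarrow> lt x y \<longleftrightarrow> pos x < pos y"
  shows "map_prod pos pos ` arcs_over lt E = chords (pos ` E)"
proof
  show "map_prod pos pos ` arcs_over lt E \<subseteq> chords (pos ` E)"
    using lt by (auto simp: arcs_over_def chords_def)
  show "chords (pos ` E) \<subseteq> map_prod pos pos ` arcs_over lt E"
  proof
    fix Z assume "Z \<in> chords (pos ` E)"
    then obtain a b c where "a \<in> E" "b \<in> E" "c \<in> E" "Z = (pos a, pos b)" "pos a < pos c" "pos c < pos b"
      by (auto simp: chords_def)
    then show "Z \<in> map_prod pos pos ` arcs_over lt E"
      using lt by (intro image_eqI[of _ _ "(a, b)"]) (auto simp: arcs_over_def)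
  qed
qed

lemma pcond_iso_arcs_over:
  fixes pos :: "'e \<Rightarrow> real"
  assumes c: "inj c" and inj: "inj_on pos E"
    and lt: "\<And>x y. x \<in> E \<Longrightarrow> y \<in> E \<Longrightarrow> lt x y \<longleftrightarrow> pos x < pos y"
  shows "pcond_iso (unlabel c (map_prod pos pos))
    (relabel c (pairwise_encoding (arcs_over lt E) (crossing_A lt))) (noncrossing (chords (pos ` E) - {}))"
proof -
  have sub: "arcs_over lt E \<subseteq> E \<times> E"
    by (auto simp: arcs_over_def)
  have eq: "map_prod pos pos ` arcs_over lt E = chords (pos ` E)"
    by (rule map_prod_arcs_over) (rule lt)
  show ?thesis
    using pcond_iso_encoding[OF c sub inj lt] unfolding eq by simp
qed

text \<open>The copies are numbered upwards, whereas \<open>pt\<close> counts depth from the top.\<close>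

definition arc_of :: "vertex \<Rightarrow> indec \<Rightarrow> real \<times> real" where
  "arc_of v = (case v of
       N n \<Rightarrow> unlabel Int_Arc (map_prod (\<lambda>k. pt (Fin k) 0) (\<lambda>k. pt (Fin k) 0))
     | N_inf \<Rightarrow> unlabel Int_Arc (map_prod (\<lambda>k. pt (Fin k) 0) (\<lambda>k. pt (Fin k) 0))
     | N_extbar \<Rightarrow> unlabel Ext_Arc (map_prod (\<lambda>p. pt p 0) (\<lambda>p. pt p 0))
     | N_copies i \<Rightarrow> unlabel Copies_Arc
         (map_prod (\<lambda>(k, l). pt (Fin k) (i - l)) (\<lambda>(k, l). pt (Fin k) (i - l)))
     | N_copiesbar i \<Rightarrow> unlabel Copiesbar_Arc
         (map_prod (\<lambda>(p, l). pt p (i - l)) (\<lambda>(p, l). pt p (i - l)))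
     | _ \<Rightarrow> unlabel Pi_Arc (map_prod (\<lambda>x. x) (\<lambda>x. x)))"

lemma inj_labels: "inj Int_Arc" "inj Ext_Arc" "inj Copies_Arc" "inj Copiesbar_Arc" "inj Pi_Arc"
  "inj Z_Point" "inj Interval"
  by (auto simp: inj_def)

lemma iso_N: "pcond_iso (arc_of (N n)) (cond (N n)) (noncrossing (chords (segment n) - {edge n}))"
proof -
  let ?pos = "\<lambda>k::int. pt (Fin k) 0"
  let ?A = "{(a, b). a \<in> {1..int n} \<and> b \<in> {1..int n} \<and> 2 \<le> b - a \<and> b - a \<le> int n - 2}"
  have "map_prod ?pos ?pos ` ?A = chords (segment n) - {edge n}"
  proof
    show "map_prod ?pos ?pos ` ?A \<subseteq> chords (segment n) - {edge n}"
    proof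
      fix Z assume "Z \<in> map_prod ?pos ?pos ` ?A"
      then obtain a b where ab: "Z = (?pos a, ?pos b)" "1 \<le> a" "b \<le> int n" "2 \<le> b - a" "b - a \<le> int n - 2"
        by auto
      then have "?pos a \<in> segment n" "?pos b \<in> segment n" "?pos (a + 1) \<in> segment n"
        by (auto simp: segment_def)
      then show "Z \<in> chords (segment n) - {edge n}"
        using ab by (auto simp: chords_def intro!: bexI[of _ "?pos (a + 1)"])
    qed
    show "chords (segment n) - {edge n} \<subseteq> map_prod ?pos ?pos ` ?A"
    proof
      fix Z assume Z: "Z \<in> chords (segment n) - {edge n}"
      then have "Z \<in> chords (segment n)"
        by blast
      then obtain a b c where ab: "Z = (?pos a, ?pos b)" "1 \<le> a" "b \<le> int n" "a < c" "c < b"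
        by (auto simp: chords_def segment_def)
      then have "a = 1 \<longrightarrow> b \<noteq> int n"
        using Z by auto
      with ab show "Z \<in> map_prod ?pos ?pos ` ?A"
        by (intro image_eqI[of _ _ "(a, b)"]) auto
    qed
  qed
  then show ?thesis
    using pcond_iso_encoding[of Int_Arc ?A UNIV ?pos "(<)"] inj_labels(1)
    by (simp add: arc_of_def cond_N_def inj_on_def)
qed

lemma iso_N_inf: "pcond_iso (arc_of N_inf) (cond N_inf) (noncrossing (chords (open_chain 1) - {}))"
proof -
  let ?pos = "\<lambda>k::int. pt (Fin k) 0"
  have "(2 \<le> b - a) \<longleftrightarrow> (\<exists>c. a < c \<and> c < b)" for a b :: int
    by (auto intro: exI[of _ "a + 1"])
  then have "{(a, b). 2 \<le> b - a} = arcs_over (<) (UNIV :: int set)"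
    by (auto simp: arcs_over_def)
  moreover have "range ?pos = open_chain 1"
    by (auto simp: open_chain_def)
  ultimately show ?thesis
    using pcond_iso_arcs_over[of Int_Arc ?pos UNIV "(<)"] inj_labels(1)
    by (simp add: arc_of_def cond_N_inf_def inj_on_def)
qed

lemma iso_N_copies:
  "pcond_iso (arc_of (N_copies i)) (cond (N_copies i)) (noncrossing (chords (open_chain i) - {}))"
proof -
  let ?pos = "\<lambda>(k, l). pt (Fin k) (i - l)" and ?E = "(UNIV :: int set) \<times> {1..i}"
  have lt: "copies_less x y \<longleftrightarrow> ?pos x < ?pos y" if "x \<in> ?E" "y \<in> ?E" for x y
    using that by (auto simp: copies_less_def)
  have inj: "inj_on ?pos ?E"
    by (auto simp: inj_on_def)
  have "?pos ` ?E = open_chain i"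
  proof
    show "?pos ` ?E \<subseteq> open_chain i"
      by auto
    show "open_chain i \<subseteq> ?pos ` ?E"
    proof
      fix x assume "x \<in> open_chain i"
      then obtain k r where "x = pt (Fin k) r" "r < i"
        by (auto simp: open_chain_def)
      then show "x \<in> ?pos ` ?E"
        by (intro image_eqI[of _ _ "(k, i - r)"]) auto
    qed
  qed
  then show ?thesis
    using pcond_iso_arcs_over[OF inj_labels(3) inj lt]
    by (simp add: arc_of_def cond_N_copies_def)
qed

lemma iso_N_copiesbar:
  "pcond_iso (arc_of (N_copiesbar i)) (cond (N_copiesbar i)) (noncrossing (chords (closed_chain i) - {}))"
proof -
  let ?pos = "\<lambda>(p, l). pt p (i - l)" and ?E = "(UNIV - {Minf} :: int extended set) \<times> {1..i}"
  have lt: "copies_less x y \<longleftrightarrow> ?pos x < ?pos y" if "x \<in> ?E" "y \<in> ?E" for x y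
    using that by (auto simp: copies_less_def)
  have inj: "inj_on ?pos ?E"
    by (auto simp: inj_on_def)
  have "?pos ` ?E = closed_chain i"
  proof
    show "?pos ` ?E \<subseteq> closed_chain i"
    proof
      fix x assume "x \<in> ?pos ` ?E"
      then obtain z where "z \<in> ?E" "x = ?pos z"
        by blast
      then obtain p l where "x = pt p (i - l)" "p \<noteq> Minf" "1 \<le> l" "l \<le> i"
        by (cases z) simp
      then show "x \<in> closed_chain i"
        by (cases p) auto
    qed
    show "closed_chain i \<subseteq> ?pos ` ?E"
    proof
      fix x assume "x \<in> closed_chain i"
      then obtain p r where "x = pt p r" "r < i" "p \<noteq> Minf"
        by (auto simp: closed_chain_def)
      then show "x \<in> ?pos ` ?E"
        by (intro image_eqI[of _ _ "(p, i - r)"]) auto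
    qed
  qed
  then show ?thesis
    using pcond_iso_arcs_over[OF inj_labels(4) inj lt]
    by (simp add: arc_of_def cond_N_copiesbar_def)
qed

text \<open>The lower end of the single copy is realised as the limit point of depth 1.\<close>

lemma iso_N_extbar:
  "pcond_iso (arc_of N_extbar) (cond N_extbar)
    (noncrossing (chords (insert (pt Pinf 1) (closed_chain 1)) - {ext_edge}))"
proof -
  let ?pos = "\<lambda>p. pt p 0"
  let ?A = "{(a, b). \<exists>l::int. a < Fin l \<and> Fin l < b}"
  have "(\<exists>l::int. a < Fin l \<and> Fin l < b) \<longleftrightarrow> (\<exists>c. a < c \<and> c < b)" for a b :: "int extended"
  proof
    assume "\<exists>c. a < c \<and> c < b"
    then obtain c where "a < c" "c < b"
      by blast
    then show "\<exists>l::int. a < Fin l \<and> Fin l < b"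
      by (cases c) auto
  qed blast
  then have A: "?A = arcs_over (<) UNIV"
    by (auto simp: arcs_over_def)
  have lt: "x < y \<longleftrightarrow> ?pos x < ?pos y" for x y
    by (simp add: pt_def)
  have inj: "inj ?pos"
    using lt by (auto simp: inj_def) (metis less_irrefl linorder_neqE)
  have "range ?pos = insert (pt Pinf 1) (closed_chain 1)"
  proof
    show "range ?pos \<subseteq> insert (pt Pinf 1) (closed_chain 1)"
    proof
      fix x assume "x \<in> range ?pos"
      then obtain p where "x = pt p 0"
        by auto
      then show "x \<in> insert (pt Pinf 1) (closed_chain 1)"
        using pt_Minf[of 0] by (cases p) auto
    qed
    show "insert (pt Pinf 1) (closed_chain 1) \<subseteq> range ?pos"
      using pt_Minf[of 0] by (auto simp: closed_chain_def image_iff) metis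
  qed
  then have "map_prod ?pos ?pos ` ?A = chords (insert (pt Pinf 1) (closed_chain 1))"
    unfolding A using map_prod_arcs_over[of UNIV "(<)" ?pos] lt by simp
  moreover have "map_prod ?pos ?pos ` (?A - {(Minf, Pinf)}) = map_prod ?pos ?pos ` ?A - {map_prod ?pos ?pos (Minf, Pinf)}"
    using image_set_diff[OF prod.inj_map[OF inj inj]] by simp
  ultimately have "map_prod ?pos ?pos ` (?A - {(Minf, Pinf)}) =
      chords (insert (pt Pinf 1) (closed_chain 1)) - {ext_edge}"
    using pt_Minf[of 0] by simp
  then show ?thesis
    using pcond_iso_encoding[of Ext_Arc "?A - {(Minf, Pinf)}" UNIV ?pos "(<)", OF inj_labels(2) _ inj lt]
    by (simp add: arc_of_def cond_N_extbar_def)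
qed

definition pi_arcs :: "(real \<times> real) set" where
  "pi_arcs = {(x, y). - pi/2 < x \<and> x < y \<and> y \<le> pi/2}"

lemma iso_N_pi: "pcond_iso (arc_of N_pi) (cond N_pi) (noncrossing pi_arcs)"
proof -
  have "{(x, y). x \<in> {- pi/2 <.. pi/2} \<and> y \<in> {- pi/2 <.. pi/2} \<and> x < y} = pi_arcs"
    by (auto simp: pi_arcs_def)
  then show ?thesis
    using pcond_iso_encoding[of Pi_Arc pi_arcs UNIV "\<lambda>x. x" "(<)"] inj_labels(5)
    by (simp add: arc_of_def cond_N_pi_def map_prod_ident)
qed

section \<open>Doubled cuts of the real line\<close>

definition lower :: "real set \<Rightarrow> bool" where
  "lower D \<longleftrightarrow> (\<forall>x\<in>D. \<forall>y\<le>x. y \<in> D)"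

lemma lower_total: "lower D \<Longrightarrow> lower D' \<Longrightarrow> D \<subseteq> D' \<or> D' \<subseteq> D"
  unfolding lower_def by (metis linear subsetI)

text \<open>The cuts of the real line as lower sets, each in two versions: as the left end of an arc
(\<open>False\<close>) and, immediately after it, as the right end of an arc (\<open>True\<close>).\<close>

typedef bound = "{(D, b :: bool). lower D}"
  by (auto intro!: exI[of _ "{}"] simp: lower_def)

definition cut_set :: "bound \<Rightarrow> real set" where "cut_set p = fst (Rep_bound p)"
definition is_finish :: "bound \<Rightarrow> bool" where "is_finish p = snd (Rep_bound p)"

lemma lower_cut_set: "lower (cut_set p)"
  using Rep_bound[of p] by (auto simp: cut_set_def)

lemma bound_eqI: "cut_set p = cut_set q \<Longrightarrow> is_finish p = is_finish q \<Longrightarrow> p = q"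
  using Rep_bound_inject[of p q] by (simp add: cut_set_def is_finish_def prod_eq_iff)

instantiation bound :: linorder
begin

definition less_eq_bound :: "bound \<Rightarrow> bound \<Rightarrow> bool" where
  "p \<le> q \<longleftrightarrow> cut_set p \<subset> cut_set q \<or> cut_set p = cut_set q \<and> (is_finish p \<longrightarrow> is_finish q)"

definition less_bound :: "bound \<Rightarrow> bound \<Rightarrow> bool" where
  "p < q \<longleftrightarrow> cut_set p \<subset> cut_set q \<or> cut_set p = cut_set q \<and> \<not> is_finish p \<and> is_finish q"

instance
proof
  fix p q s :: bound
  show "p < q \<longleftrightarrow> p \<le> q \<and> \<not> q \<le> p"
    by (auto simp: less_eq_bound_def less_bound_def)
  show "p \<le> p"
    by (simp add: less_eq_bound_def)
  show "p \<le> s" if "p \<le> q" "q \<le> s"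
    using that by (auto simp: less_eq_bound_def)
  show "p = q" if "p \<le> q" "q \<le> p"
    using that by (intro bound_eqI) (auto simp: less_eq_bound_def)
  show "p \<le> q \<or> q \<le> p"
    using lower_total[OF lower_cut_set lower_cut_set, of p q] by (auto simp: less_eq_bound_def)
qed

end

definition start :: "real set \<Rightarrow> bound" where "start D = Abs_bound (D, False)"
definition finish :: "real set \<Rightarrow> bound" where "finish D = Abs_bound (D, True)"

lemma start_finish_simps [simp]:
  assumes "lower D"
  shows "cut_set (start D) = D" "\<not> is_finish (start D)" "cut_set (finish D) = D" "is_finish (finish D)"
  using assms by (auto simp: cut_set_def is_finish_def start_def finish_def Abs_bound_inverse)

lemma bound_less [simp]:
  assumes "lower D" "lower D'"
  shows "start D < start D' \<longleftrightarrow> D \<subset> D'" "start D < finish D' \<longleftrightarrow> D \<subseteq> D'"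
    "finish D < start D' \<longleftrightarrow> D \<subset> D'" "finish D < finish D' \<longleftrightarrow> D \<subset> D'"
    "start D \<le> start D' \<longleftrightarrow> D \<subseteq> D'" "finish D \<le> start D' \<longleftrightarrow> D \<subset> D'"
    "finish D \<le> finish D' \<longleftrightarrow> D \<subseteq> D'"
    "start D = start D' \<longleftrightarrow> D = D'" "finish D = finish D' \<longleftrightarrow> D = D'"
proof -
  show "start D = start D' \<longleftrightarrow> D = D'" "finish D = finish D' \<longleftrightarrow> D = D'"
    using assms by (metis start_finish_simps(1), metis start_finish_simps(3))
qed (use assms in \<open>auto simp: less_eq_bound_def less_bound_def\<close>)

lemma lower_intervals [simp]: "lower {..x}" "lower {..<x}"
  by (auto simp: lower_def)

section \<open>Arcs in an interval and representations of the real line\<close>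

lemma well_order_exists:
  "\<exists>r :: 'a rel. wf r \<and> (\<forall>x y. x \<noteq> y \<longrightarrow> (x, y) \<in> r \<or> (y, x) \<in> r)"
proof -
  from well_ordering obtain r :: "'a rel" where "Well_order r \<and> Field r = UNIV" ..
  note r = conjunct1[OF this] conjunct2[OF this]
  have "wf (r - Id)"
    using r(1) unfolding well_order_on_def by (rule conjunct2)
  moreover have "total r"
    using r unfolding well_order_on_def linear_order_on_def by simp
  then have "(x, y) \<in> r - Id \<or> (y, x) \<in> r - Id" if "x \<noteq> y" for x y
    using that unfolding total_on_def by blast
  ultimately have "wf (r - Id) \<and> (\<forall>x y. x \<noteq> y \<longrightarrow> (x, y) \<in> r - Id \<or> (y, x) \<in> r - Id)"
    by simp
  then show ?thesis ..
qed

text \<open>With a well-order every conflict is decided, so any crossing-preserving map of arcs can be completed.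
This is enough for arrows into the ambient conditions, where nothing has to be compared.\<close>

lemma greedy_cluster_map_exists:
  fixes A :: "('l::linorder \<times> 'l) set" and B :: "('k::linorder \<times> 'k) set" and s e :: "'l \<Rightarrow> 'k"
  assumes "mutation_closed (noncrossing A)" "A \<subseteq> V \<times> V"
    and "\<And>x. x \<in> V \<Longrightarrow> e x \<le> s x" "\<And>x y. x \<in> V \<Longrightarrow> y \<in> V \<Longrightarrow> x < y \<Longrightarrow> s x < e y"
    and "map_prod s e ` A \<subseteq> B" "R \<subseteq> B"
    and "\<And>U W. U \<in> R \<Longrightarrow> W \<in> R \<Longrightarrow> \<not> crossing U W"
      "\<And>U X. U \<in> R \<Longrightarrow> X \<in> A \<Longrightarrow> \<not> crossing U (map_prod s e X)"
    and "\<And>p q X v. (p, q) \<in> B \<Longrightarrow> \<forall>W\<in>R. \<not> crossing W (p, q) \<Longrightarrow> X \<in> A \<Longrightarrow>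
      crossing (map_prod s e X) (p, q) \<Longrightarrow> v \<in> V \<Longrightarrow> (p < e v \<or> s v \<le> p) \<and> (q \<le> e v \<or> s v < q)"
    and "\<And>a b c d E. (a, b) \<in> A \<Longrightarrow> (c, d) \<in> A \<Longrightarrow> a < c \<Longrightarrow> c < b \<Longrightarrow> b < d \<Longrightarrow>
      E \<in> sides a c b d \<Longrightarrow> E \<in> A \<or> (\<forall>Z\<in>B. (\<forall>W\<in>R. \<not> crossing W Z) \<longrightarrow> \<not> crossing (map_prod s e E) Z)"
  shows "\<exists>K. cluster_map (noncrossing A) (noncrossing B) (map_prod s e) K"
proof -
  from well_order_exists obtain r :: "('k \<times> 'k) rel"
    where r: "wf r \<and> (\<forall>x y. x \<noteq> y \<longrightarrow> (x, y) \<in> r \<or> (y, x) \<in> r)" ..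
  have cr: "(Y, Z) \<in> r \<or> (Z, Y) \<in> r" if "crossing Y Z" for Y Z
  proof (rule r[THEN conjunct2, rule_format])
    show "Y \<noteq> Z"
      using that by auto
  qed
  have "cluster_map (noncrossing A) (noncrossing B) (map_prod s e)
      (\<lambda>T. greedy (noncrossing B) r (map_prod s e ` T \<union> R))"
    by (rule greedy_cluster_map[where V = V, OF assms(1) conjunct1[OF r] assms(2-8) _ assms(9,10)])
      (assumption | rule cr)+
  then show ?thesis
    by blast
qed

text \<open>The adjoined arcs join the images of neighbouring vertices. They protect those sides of
quadrilaterals that are not arcs of the chain but become arcs of the interval.\<close>

lemma closed_chain_pi:
  "\<exists>K. cluster_map (noncrossing (chords (closed_chain j) - {})) (noncrossing pi_arcs)
    (map_prod arctan arctan) K"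
proof -
  let ?C = "closed_chain j"
  define R where "R = {(arctan x, arctan y) | x y. x \<in> ?C \<and> y \<in> ?C \<and> x < y \<and> (x, y) \<notin> chords ?C}"
  have no: "\<not> crossing (arctan x, arctan y) (arctan c, arctan d)"
    if "x \<in> ?C" "y \<in> ?C" "(x, y) \<notin> chords ?C" "c \<in> ?C" "d \<in> ?C" for x y c d
    using that by (auto simp: crossing_Pair arctan_less_iff chords_def)
  have bd: "arctan x \<le> pi / 2" "- (pi / 2) < arctan x" for x
    using arctan_bounded[of x] by auto
  show ?thesis
  proof (rule greedy_cluster_map_exists[of "chords ?C - {}" ?C arctan arctan pi_arcs R])
    show "mutation_closed (noncrossing (chords ?C - {}))"
      using induces_mutation_closed completable_induces completable_closed_chain[OF order_refl] by blast
    show "chords ?C - {} \<subseteq> ?C \<times> ?C"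
      by (auto simp: chords_def)
    show "map_prod arctan arctan ` (chords ?C - {}) \<subseteq> pi_arcs"
      using bd by (auto simp: chords_def pi_arcs_def arctan_less_iff)
    show "R \<subseteq> pi_arcs"
      using bd by (auto simp: R_def pi_arcs_def arctan_less_iff)
    show "\<not> crossing U W" if "U \<in> R" "W \<in> R" for U W
      using that no unfolding R_def by blast
    show "\<not> crossing U (map_prod arctan arctan X)" if "U \<in> R" "X \<in> chords ?C - {}" for U X
    proof -
      obtain x y where U: "U = (arctan x, arctan y)" "x \<in> ?C" "y \<in> ?C" "(x, y) \<notin> chords ?C"
        using \<open>U \<in> R\<close> unfolding R_def by blast
      have X: "fst X \<in> ?C" "snd X \<in> ?C" "map_prod arctan arctan X = (arctan (fst X), arctan (snd X))"
        using chordsD(1,2)[of X ?C] that(2) by (auto simp: map_prod_def case_prod_beta)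
      show ?thesis
        unfolding U(1) X(3) using no[OF U(2-4) X(1,2)] .
    qed
    fix a b c d E assume ab: "(a, b) \<in> chords ?C - {}" "(c, d) \<in> chords ?C - {}" "a < c" "c < b" "b < d"
      "E \<in> sides a c b d"
    then have "E \<in> ?C \<times> ?C" "fst E < snd E"
      by (auto simp: sides_def chords_def)
    then show "E \<in> chords ?C - {} \<or> (\<forall>Z\<in>pi_arcs. (\<forall>W\<in>R. \<not> crossing W Z) \<longrightarrow>
        \<not> crossing (map_prod arctan arctan E) Z)"
      unfolding R_def by (cases E) auto
  qed (auto simp: arctan_less_iff not_less)
qed

lemma pi_mutation_closed: "mutation_closed (noncrossing pi_arcs)"
  by (intro induces_mutation_closed induces_noncrossing) (auto simp: pi_arcs_def sides_def)

definition below :: "real set \<Rightarrow> real set" where "below I = {x. \<forall>y\<in>I. x < y}"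
text \<open>The support of the projective cover of \<open>M_I\<close>, whereas \<open>below I\<close> is the support of the kernel of
this cover, or empty if the kernel vanishes.\<close>

definition down_closure :: "real set \<Rightarrow> real set" where "down_closure I = {x. \<exists>y\<in>I. x \<le> y}"

definition interval_arc :: "real set \<Rightarrow> bound \<times> bound" where
  "interval_arc I = (start (below I), finish (down_closure I))"

lemma lower_below [simp]: "lower (below I)" and lower_upto [simp]: "lower (down_closure I)"
  by (auto simp: lower_def below_def down_closure_def intro: le_less_trans order.trans)

lemma below_psubset_upto: "I \<noteq> {} \<Longrightarrow> below I \<subset> down_closure I"
  by (force simp: below_def down_closure_def)

lemma interval_eq_diff:
  assumes "is_interval I"
  shows "I = down_closure I - below I"
proof
  show "down_closure I - below I \<subseteq> I"
  proof
    fix x assume "x \<in> down_closure I - below I"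
    then obtain y z where "y \<in> I" "z \<in> I" "y \<le> x" "x \<le> z"
      by (auto simp: down_closure_def below_def not_less)
    then show "x \<in> I"
      using assms unfolding is_interval_1 by blast
  qed
qed (auto simp: down_closure_def below_def)

text \<open>With supports \<open>B \<subset> U\<close> of the two projectives for each interval, the pairing is
\<open>[U \<subseteq> U'] - [U \<subseteq> B'] - [B \<subseteq> U'] + [B \<subseteq> B']\<close>, where terms with an empty lower set are left out. As lower
sets form a chain, this is negative only if \<open>B' \<subset> B \<subseteq> U' \<subset> U\<close>.\<close>

lemma pairing_gvec:
  assumes I: "I \<noteq> {}" and J: "J \<noteq> {}"
  shows "pairing (gvec I) (gvec J) < 0 \<longleftrightarrow>
    below J \<subset> below I \<and> below I \<subseteq> down_closure J \<and> down_closure J \<subset> down_closure I"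
proof -
  have lk: "Poly_Mapping.lookup (gvec I) D =
      (if D = down_closure I then 1 else 0) - (if below I \<noteq> {} \<and> D = below I then 1 else 0)" for I D
    unfolding gvec_def Let_def below_def[symmetric] down_closure_def[symmetric]
    by (auto simp: lookup_minus lookup_single when_def)
  have keys: "Poly_Mapping.keys (gvec I) \<subseteq> {down_closure I, below I}" for I
    by (auto simp: in_keys_iff lk split: if_splits)
  have ne: "down_closure I \<noteq> below I" "down_closure J \<noteq> below J"
    using below_psubset_upto I J by blast+
  have "pairing (gvec I) (gvec J) = (\<Sum>P\<in>{down_closure I, below I}. \<Sum>Q\<in>{down_closure J, below J}.
      Poly_Mapping.lookup (gvec I) P * Poly_Mapping.lookup (gvec J) Q * hom_dim P Q)"
  proof -
    have "pairing (gvec I) (gvec J) = (\<Sum>P\<in>Poly_Mapping.keys (gvec I). \<Sum>Q\<in>{down_closure J, below J}.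
        Poly_Mapping.lookup (gvec I) P * Poly_Mapping.lookup (gvec J) Q * hom_dim P Q)"
      unfolding pairing_def using keys[of J]
      by (intro sum.cong refl sum.mono_neutral_left) (auto simp: in_keys_iff)
    also have "\<dots> = (\<Sum>P\<in>{down_closure I, below I}. \<Sum>Q\<in>{down_closure J, below J}.
        Poly_Mapping.lookup (gvec I) P * Poly_Mapping.lookup (gvec J) Q * hom_dim P Q)"
      using keys[of I] by (intro sum.mono_neutral_left) (auto simp: in_keys_iff)
    finally show ?thesis .
  qed
  also have "\<dots> = hom_dim (down_closure I) (down_closure J) - (if below J \<noteq> {} then hom_dim (down_closure I) (below J) else 0)
      - (if below I \<noteq> {} then hom_dim (below I) (down_closure J) else 0)
      + (if below I \<noteq> {} \<and> below J \<noteq> {} then hom_dim (below I) (below J) else 0)"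
    using ne by (auto simp: lk)
  finally have eq: "pairing (gvec I) (gvec J) = \<dots>" .
  have t: "below I \<subseteq> below J \<or> below J \<subseteq> below I" "down_closure I \<subseteq> down_closure J \<or> down_closure J \<subseteq> down_closure I"
    "below I \<subseteq> down_closure J \<or> down_closure J \<subseteq> below I" "down_closure I \<subseteq> below J \<or> below J \<subseteq> down_closure I"
    by (rule lower_total; simp)+
  show ?thesis
    unfolding eq hom_dim_def
    using t below_psubset_upto[OF I] below_psubset_upto[OF J]
    by (cases "below I \<subseteq> below J"; cases "down_closure I \<subseteq> down_closure J"; cases "below I \<subseteq> down_closure J"; cases "down_closure I \<subseteq> below J";
        cases "below I = {}"; cases "below J = {}") (simp; blast)+
qed

definition E_arcs :: "(bound \<times> bound) set" where
  "E_arcs = interval_arc ` {I. is_interval I \<and> I \<noteq> {}}"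

lemma iso_E: "pcond_iso (unlabel Interval interval_arc) (cond E_R) (noncrossing E_arcs)"
proof -
  have "pcond_iso (unlabel Interval interval_arc) (relabel Interval cond_E)
     (noncrossing (interval_arc ` Ind cond_E))"
  proof (rule pcond_iso_relabel[OF inj_labels(7)])
    show "inj_on interval_arc (Ind cond_E)"
    proof (rule inj_onI)
      fix I J assume "I \<in> Ind cond_E" "J \<in> Ind cond_E" "interval_arc I = interval_arc J"
      then show "I = J"
        using interval_eq_diff[of I] interval_eq_diff[of J] by (simp add: interval_arc_def cond_E_def)
    qed
    fix I J assume "I \<in> Ind cond_E" "J \<in> Ind cond_E"
    then have ne: "I \<noteq> {}" "J \<noteq> {}"
      by (simp_all add: cond_E_def)
    have "compat cond_E I J \<longleftrightarrow> \<not> pairing (gvec I) (gvec J) < 0 \<and> \<not> pairing (gvec J) (gvec I) < 0"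
      by (simp add: cond_E_def not_less)
    also have "\<dots> \<longleftrightarrow> \<not> crossing (interval_arc I) (interval_arc J)"
      unfolding pairing_gvec[OF ne] pairing_gvec[OF ne(2,1)] interval_arc_def crossing_Pair
      by simp blast
    finally show "compat cond_E I J \<longleftrightarrow> \<not> crossing (interval_arc I) (interval_arc J)" .
  qed
  then show ?thesis
    by (simp add: E_arcs_def cond_E_def)
qed

lemma open_interval_arc:
  assumes "x < y"
  shows "interval_arc {x<..<y} = (start {..x}, finish {..<y})"
proof -
  have "below {x<..<y} = {..x}"
  proof
    show "below {x<..<y} \<subseteq> {..x}"
    proof
      fix z assume z: "z \<in> below {x<..<y}"
      show "z \<in> {..x}"
      proof (rule ccontr)
        assume "z \<notin> {..x}"
        then obtain w where "x < w" "w < min y z"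
          using dense[of x "min y z"] assms by auto
        then show False
          using z by (auto simp: below_def dest!: bspec[of _ _ w])
      qed
    qed
  qed (auto simp: below_def)
  moreover have "down_closure {x<..<y} = {..<y}"
  proof
    show "{..<y} \<subseteq> down_closure {x<..<y}"
    proof
      fix z assume "z \<in> {..<y}"
      then obtain w where "max x z < w" "w < y"
        using dense[of "max x z" y] assms by auto
      then show "z \<in> down_closure {x<..<y}"
        by (auto simp: down_closure_def intro!: bexI[of _ w])
    qed
  qed (auto simp: down_closure_def)
  ultimately show ?thesis
    by (simp add: interval_arc_def)
qed

lemma lower_gap: "lower D \<Longrightarrow> D \<subseteq> {..<v} \<or> {..v} \<subseteq> D"
  unfolding lower_def by (metis atMost_iff lessThan_iff linorder_not_less subsetI)

text \<open>Arcs become open intervals. Consecutive open intervals leave out their common end point, so they do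
not touch, and no cut lies strictly between the two cuts at a point. Hence nothing has to be adjoined.\<close>

lemma pi_E:
  "\<exists>K. cluster_map (noncrossing pi_arcs) (noncrossing E_arcs)
    (map_prod (\<lambda>x. start {..x}) (\<lambda>x. finish {..<x})) K"
proof (rule greedy_cluster_map_exists[of pi_arcs UNIV "\<lambda>x. finish {..<x}" "\<lambda>x. start {..x}" E_arcs "{}"])
  show "map_prod (\<lambda>x. start {..x}) (\<lambda>x. finish {..<x}) ` pi_arcs \<subseteq> E_arcs"
  proof
    fix Z assume "Z \<in> map_prod (\<lambda>x. start {..x}) (\<lambda>x. finish {..<x}) ` pi_arcs"
    then obtain x y where "x < y" "Z = (start {..x}, finish {..<y})"
      by (auto simp: pi_arcs_def)
    then have "Z = interval_arc {x<..<y}" "is_interval {x<..<y}" "{x<..<y} \<noteq> {}"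
      using open_interval_arc is_interval_oo[of x y] by auto
    then show "Z \<in> E_arcs"
      by (auto simp: E_arcs_def)
  qed
  fix p q v assume "(p, q) \<in> E_arcs"
  then obtain I where I: "p = start (below I)" "q = finish (down_closure I)"
    by (auto simp: E_arcs_def interval_arc_def)
  show "(p < finish {..<v} \<or> start {..v} \<le> p) \<and> (q \<le> finish {..<v} \<or> start {..v} < q)"
    unfolding I using lower_gap[of "below I" v] lower_gap[of "down_closure I" v] by simp
next
  show "mutation_closed (noncrossing pi_arcs)"
    by (rule pi_mutation_closed)
  fix a b c d E assume "(a, b) \<in> pi_arcs" "(c, d) \<in> pi_arcs" "a < c" "c < b" "b < d" "E \<in> sides a c b d"
  then have "E \<in> pi_arcs"
    by (auto simp: pi_arcs_def sides_def)
  then show "E \<in> pi_arcs \<or> (\<forall>Z\<in>E_arcs. (\<forall>W\<in>{}. \<not> crossing W Z) \<longrightarrow>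
      \<not> crossing (map_prod (\<lambda>x. start {..x}) (\<lambda>x. finish {..<x}) E) Z)"
    by blast
next
  fix x y :: real
  have "x \<in> {..x} - {..<x}"
    by simp
  then have "{..<x} \<subset> {..x}"
    by auto
  then show "finish {..<x} \<le> start {..x}"
    by simp
  show "start {..x} < finish {..<y}" if "x < y"
    using that by auto
qed simp_all

section \<open>The triangle of the condition T\<close>

definition point_arc :: "real \<times> real \<Rightarrow> bound \<times> bound" where
  "point_arc = (\<lambda>(x, y). (start {..x - y}, finish {..x + y + pi}))"

definition T_arcs :: "(bound \<times> bound) set" where
  "T_arcs = {(start {..a}, finish {..b}) | a b. 0 \<le> a \<and> a < b \<and> b \<le> 2 * pi \<and> (a, b) \<noteq> (0, 2 * pi)}"

text \<open>In the coordinates \<open>x - y\<close> and \<open>x + y + pi\<close> this is the set of pairs \<open>0 \<le> a < b \<le> 2 * pi\<close> other than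
\<open>(0, 2 * pi)\<close>.\<close>

lemma Ind_Z_iff: "(x, y) \<in> Ind_Z \<longleftrightarrow> - pi/2 < y \<and> y < pi/2 \<and> y \<le> x \<and> x \<le> pi - y"
proof -
  have "(x1, y) \<in> Z_one \<longleftrightarrow> x1 = pi - y \<and> - pi/2 < y \<and> y < pi/2" for x1
    by (auto simp: Z_one_def Z_zero_def intro!: exI[of _ "- y"])
  then show ?thesis
    by (auto simp: Ind_Z_def Z_zero_def)
qed

lemma crossing_start_finish:
  "crossing (start {..a}, finish {..b}) (start {..c}, finish {..d}) \<longleftrightarrow>
    a < c \<and> c \<le> b \<and> b < d \<or> c < a \<and> a \<le> d \<and> d < (b :: real)"
proof -
  have "{..x} \<subset> {..y} \<longleftrightarrow> x < y" for x y :: real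
    by (auto simp: psubset_eq)
  then show ?thesis
    by (simp add: crossing_Pair)
qed

text \<open>The rectangle is a product of intervals in the coordinates \<open>x - y\<close> and \<open>x + y\<close>. The enlarged region
is the full triangle, and of the bounds that define it only the lower one has to be checked, at the
bottom corner.\<close>

lemma rectangle_between_iff:
  assumes p: "(x, y) \<in> Ind_Z" and q: "(x', y') \<in> Ind_Z"
  shows "rectangle_between (x, y) (x', y') \<longleftrightarrow>
    x - y < x' - y' \<and> x' - y' \<le> x + y + pi \<and> x + y < x' + y'"
proof
  assume "rectangle_between (x, y) (x', y')"
  then obtain s t where st: "0 < s" "0 < t" "x' = x + s + t" "y' = y + s - t" and
    sub: "slope_rectangle (x, y) s t \<subseteq>
       Ind_Z \<union> {(pi/2, pi/2)} \<union> {(x, - pi/2) | x. - pi/2 \<le> x \<and> x \<le> 3 * pi/2}"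
    by (auto simp: rectangle_between_def)
  have "(x + t, y - t) \<in> slope_rectangle (x, y) s t"
    unfolding slope_rectangle_def
    by (intro CollectI exI[of _ 0] exI[of _ t]) (use st in simp)
  then have "(x + t, y - t) \<in> Ind_Z \<union> {(pi/2, pi/2)} \<union> {(x, - pi/2) | x. - pi/2 \<le> x \<and> x \<le> 3 * pi/2}"
    using sub by blast
  then have "- pi/2 < y - t \<or> y - t = pi/2 \<or> y - t = - pi/2"
    by (auto simp: Ind_Z_iff)
  then have "- pi/2 \<le> y - t"
    using pi_gt_zero by linarith
  then show "x - y < x' - y' \<and> x' - y' \<le> x + y + pi \<and> x + y < x' + y'"
    using st by auto
next
  assume a: "x - y < x' - y' \<and> x' - y' \<le> x + y + pi \<and> x + y < x' + y'"
  define s t where "s = (x' + y' - (x + y)) / 2" and "t = (x' - y' - (x - y)) / 2"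
  have st: "0 < s" "0 < t" "x' = x + s + t" "y' = y + s - t"
    using a by (auto simp: s_def t_def field_simps)
  have "slope_rectangle (x, y) s t \<subseteq>
       Ind_Z \<union> {(pi/2, pi/2)} \<union> {(x, - pi/2) | x. - pi/2 \<le> x \<and> x \<le> 3 * pi/2}"
  proof
    fix z assume "z \<in> slope_rectangle (x, y) s t"
    then obtain b c where z: "z = (x + b + c, y + b - c)" "0 \<le> b" "b \<le> s" "0 \<le> c" "c \<le> t"
      by (auto simp: slope_rectangle_def)
    define X Y where XY: "X = x + b + c" "Y = y + b - c"
    have "2 * s = x' + y' - (x + y)" "2 * t = x' - y' - (x - y)"
      by (simp_all add: s_def t_def)
    moreover have "y \<le> x" "x' \<le> pi - y'" "x' - y' \<le> x + y + pi"
      using p q a by (auto simp: Ind_Z_iff)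
    ultimately have 1: "Y \<le> X" "X \<le> pi - Y" "- pi/2 \<le> Y"
      using z(2-5) unfolding XY by linarith+
    then consider "Y = - pi/2" | "- pi/2 < Y" "Y < pi/2" | "Y = pi/2" "X = pi/2"
      by linarith
    then have "(X, Y) \<in> Ind_Z \<union> {(pi/2, pi/2)} \<union> {(x, - pi/2) | x. - pi/2 \<le> x \<and> x \<le> 3 * pi/2}"
      using 1 by cases (auto simp: Ind_Z_iff)
    then show "z \<in> Ind_Z \<union> {(pi/2, pi/2)} \<union> {(x, - pi/2) | x. - pi/2 \<le> x \<and> x \<le> 3 * pi/2}"
      by (simp add: z XY)
  qed
  then show "rectangle_between (x, y) (x', y')"
    unfolding rectangle_between_def using st by auto
qed

lemma iso_T: "pcond_iso (unlabel Z_Point point_arc) (cond T_Z) (noncrossing T_arcs)"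
proof -
  have "pcond_iso (unlabel Z_Point point_arc) (relabel Z_Point cond_T) (noncrossing (point_arc ` Ind cond_T))"
  proof (rule pcond_iso_relabel[OF inj_labels(6)])
    show "inj_on point_arc (Ind cond_T)"
      by (auto simp: inj_on_def point_arc_def)
    fix p q assume "p \<in> Ind cond_T" "q \<in> Ind cond_T"
    moreover obtain x y x' y' where "p = (x, y)" "q = (x', y')"
      by (cases p; cases q) auto
    ultimately show "compat cond_T p q \<longleftrightarrow> \<not> crossing (point_arc p) (point_arc q)"
      using rectangle_between_iff[of x y x' y'] rectangle_between_iff[of x' y' x y]
      by (auto simp: cond_T_def point_arc_def crossing_start_finish)
  qed
  moreover have "point_arc ` Ind cond_T = T_arcs"
  proof
    show "point_arc ` Ind cond_T \<subseteq> T_arcs"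
    proof
      fix Z assume "Z \<in> point_arc ` Ind cond_T"
      then obtain x y where "(x, y) \<in> Ind_Z" "Z = (start {..x - y}, finish {..x + y + pi})"
        by (auto simp: cond_T_def point_arc_def)
      then show "Z \<in> T_arcs"
        unfolding T_arcs_def Ind_Z_iff
        by (intro CollectI exI[of _ "x - y"] exI[of _ "x + y + pi"]) auto
    qed
    show "T_arcs \<subseteq> point_arc ` Ind cond_T"
    proof
      fix Z assume "Z \<in> T_arcs"
      then obtain a b where ab: "Z = (start {..a}, finish {..b})" "0 \<le> a" "a < b" "b \<le> 2 * pi"
        "(a, b) \<noteq> (0, 2 * pi)"
        by (auto simp: T_arcs_def)
      let ?x = "(a + b - pi) / 2" and ?y = "(b - pi - a) / 2"
      have "b - a < 2 * pi"
        using ab by (cases "a = 0") auto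
      then have "- pi/2 < ?y" "?y < pi/2" "?y \<le> ?x" "?x \<le> pi - ?y"
        using ab(2-4) by (simp_all add: field_simps)
      then have "(?x, ?y) \<in> Ind_Z"
        unfolding Ind_Z_iff by blast
      moreover have "?x - ?y = a" "?x + ?y + pi = b"
        by (auto simp: field_simps)
      then have "point_arc (?x, ?y) = Z"
        unfolding point_arc_def prod.case ab(1) by simp
      ultimately show "Z \<in> point_arc ` Ind cond_T"
        by (auto simp: cond_T_def intro: rev_image_eqI)
    qed
  qed
  ultimately show ?thesis
    by simp
qed

lemma segment_bounds: "x \<in> segment n \<Longrightarrow> 0 < x \<and> x < 1"
proof -
  assume "x \<in> segment n"
  then obtain k where k: "x = pt (Fin k) 0" "1 \<le> k"
    by (auto simp: segment_def)
  have "0 < arctan (real_of_int k)"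
    using k by simp
  then show "0 < x \<and> x < 1"
    using height_Fin_bounds(2)[of k] unfolding k(1) pt_def by simp
qed

lemma finite_segment: "finite (segment n)"
proof -
  have "segment n = (\<lambda>k. pt (Fin k) 0) ` {1..int n}"
    by (auto simp: segment_def)
  then show ?thesis
    by simp
qed

text \<open>Provides the room for two separate positions at every vertex of the polygon.\<close>

lemma finite_spacing:
  fixes V :: "real set"
  assumes "finite V"
  obtains d where "0 < d" "\<And>x y. x \<in> V \<Longrightarrow> y \<in> V \<Longrightarrow> x < y \<Longrightarrow> d < y - x"
proof -
  let ?D = "insert 1 {y - x | x y. x \<in> V \<and> y \<in> V \<and> x < y}"
  have fin: "finite ?D"
    by (rule finite_subset[of _ "insert 1 ((\<lambda>(x, y). y - x) ` (V \<times> V))"]) (use assms in auto)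
  have "0 < Min ?D"
    using fin by (subst Min_gr_iff) auto
  moreover have "Min ?D / 2 < y - x" if "x \<in> V" "y \<in> V" "x < y" for x y
  proof -
    have "Min ?D \<le> y - x"
      using fin that by (intro Min_le) auto
    then show ?thesis
      using that by linarith
  qed
  ultimately show thesis
    using that[of "Min ?D / 2"] by simp
qed

text \<open>The vertex \<open>x\<close> is realised by \<open>x\<close> as a left end and by \<open>x - d\<close> as a right end, since touching arcs
cross. The set \<open>R1\<close> consists of the edges of the polygon. The nested arcs of \<open>R2\<close> fill the gap between
\<open>x - d\<close> and \<open>x\<close>: for every point strictly inside the gap some of them is crossed by all arcs that leave the gap
from there.\<close>

lemma segment_T:
  assumes n: "2 \<le> n"
  shows "\<exists>f K. cluster_map (noncrossing (chords (segment n) - {edge n})) (noncrossing T_arcs) f K"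
proof -
  let ?V = "segment n" and ?A = "chords (segment n) - {edge n}"
  have "finite (insert 0 ?V)"
    using finite_segment by simp
  then obtain d where d: "0 < d" "\<And>x y. x \<in> insert 0 ?V \<Longrightarrow> y \<in> insert 0 ?V \<Longrightarrow> x < y \<Longrightarrow> d < y - x"
    using finite_spacing by metis
  have dV: "d < x" "x < 1" if "x \<in> ?V" for x
    using d(2)[of 0 x] segment_bounds[OF that] that by auto
  have dd: "d < y - x" if "x \<in> ?V" "y \<in> ?V" "x < y" for x y
    using d(2)[of x y] that by auto
  let ?s = "\<lambda>x. start {..x}" and ?e = "\<lambda>x::real. finish {..x - d}"
  define R1 where "R1 = {(?s x, ?e y) | x y. x \<in> ?V \<and> y \<in> ?V \<and> x < y \<and> (x, y) \<notin> ?A}"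
  \<comment> \<open>The parameter stays below \<open>d / 2\<close> to keep left ends before right ends.\<close>
  define R2 where "R2 = {(start {..x - d + t}, finish {..x - t}) | x t. x \<in> ?V \<and> 0 < t \<and> t < d / 2}"
  have arcT: "(start {..a}, finish {..b}) \<in> T_arcs" if "0 \<le> a" "a < b" "b \<le> 1" for a b
    using that pi_gt3 unfolding T_arcs_def by force
  have uncrossed: "\<not> (x < c \<and> c < y \<and> y < z \<or> c < x \<and> x < z \<and> z < y)"
    if "x \<in> ?V" "y \<in> ?V" "x < y" "(x, y) \<notin> ?A" "c \<in> ?V" "z \<in> ?V" for x y c z
  proof (cases "(x, y) \<in> chords ?V")
    case True
    then have "(x, y) = edge n"
      using that by blast
    then show ?thesis
      using that by (auto simp: segment_def)
  next
    case False
    then show ?thesis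
      using that unfolding chords_def by blast
  qed
  have shift: "x \<le> y - d \<longleftrightarrow> x < y" if "x \<in> ?V" "y \<in> ?V" for x y
    using dd[OF that] d(1) by linarith
  have n11: "\<not> crossing (?s x, ?e y) (?s c, ?e z)"
    if "x \<in> ?V" "y \<in> ?V" "x < y" "(x, y) \<notin> ?A" "c \<in> ?V" "z \<in> ?V" for x y c z
    using uncrossed[OF that] shift that unfolding crossing_start_finish by auto
  have n21: "\<not> crossing (start {..x - d + t}, finish {..x - t}) (?s c, ?e z)"
    if "x \<in> ?V" "0 < t" "t < d / 2" "c \<in> ?V" "z \<in> ?V" for x t c z
  proof -
    have "c \<le> x - d \<or> x \<le> c" "z \<le> x \<or> x \<le> z - d"
      using dd[of c x] dd[of x z] that by linarith+
    then show ?thesis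
      unfolding crossing_start_finish using that by linarith
  qed
  have n22: "\<not> crossing (start {..x - d + t}, finish {..x - t}) (start {..y - d + u}, finish {..y - u})"
    if "x \<in> ?V" "0 < t" "t < d / 2" "y \<in> ?V" "0 < u" "u < d / 2" for x t y u
  proof -
    have "x = y \<or> x < y - d \<or> y < x - d"
      using dd[of x y] dd[of y x] that by linarith
    then show ?thesis
      unfolding crossing_start_finish using that by linarith
  qed
  have lt_A: "x \<in> ?V" "y \<in> ?V" "x < y" if "(x, y) \<in> ?A" for x y
    using that by (auto simp: chords_def)
  have "\<exists>K. cluster_map (noncrossing ?A) (noncrossing T_arcs) (map_prod ?s ?e) K"
  proof (rule greedy_cluster_map_exists[of ?A ?V ?e ?s T_arcs "R1 \<union> R2"])
    show "mutation_closed (noncrossing ?A)"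
      using induces_mutation_closed completable_induces completable_segment[OF n order_refl] by blast
    show "?A \<subseteq> ?V \<times> ?V"
      using lt_A by auto
    show "?e x \<le> ?s x" if "x \<in> ?V" for x
      using d(1) by auto
    show "?s x < ?e y" if "x \<in> ?V" "y \<in> ?V" "x < y" for x y
      using shift that by simp
    show "map_prod ?s ?e ` ?A \<subseteq> T_arcs"
    proof
      fix Z assume "Z \<in> map_prod ?s ?e ` ?A"
      then obtain x y where "Z = (?s x, ?e y)" "(x, y) \<in> ?A"
        by auto
      then show "Z \<in> T_arcs"
        using arcT[of x "y - d"] dd[of x y] dV[of x] dV[of y] lt_A[of x y] d(1) by auto
    qed
    have "R1 \<subseteq> T_arcs"
    proof
      fix Z assume "Z \<in> R1"
      then obtain x y where "Z = (?s x, ?e y)" "x \<in> ?V" "y \<in> ?V" "x < y"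
        by (auto simp: R1_def)
      then show "Z \<in> T_arcs"
        using arcT[of x "y - d"] dd[of x y] dV[of x] dV[of y] d(1) by auto
    qed
    moreover have "R2 \<subseteq> T_arcs"
    proof
      fix Z assume "Z \<in> R2"
      then obtain x t where "Z = (start {..x - d + t}, finish {..x - t})" "x \<in> ?V" "0 < t" "t < d / 2"
        by (auto simp: R2_def)
      then show "Z \<in> T_arcs"
        using arcT[of "x - d + t" "x - t"] dV[of x] by auto
    qed
    ultimately show "R1 \<union> R2 \<subseteq> T_arcs"
      by blast
    show "\<not> crossing U W" if "U \<in> R1 \<union> R2" "W \<in> R1 \<union> R2" for U W
    proof -
      consider "U \<in> R1" "W \<in> R1" | "U \<in> R2" "W \<in> R2" | "U \<in> R2" "W \<in> R1" | "U \<in> R1" "W \<in> R2"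
        using \<open>U \<in> R1 \<union> R2\<close> \<open>W \<in> R1 \<union> R2\<close> by blast
      then show ?thesis
      proof cases
        case 1
        then show ?thesis using n11 unfolding R1_def by blast
      next
        case 2
        then show ?thesis using n22 unfolding R2_def by blast
      next
        case 3
        then show ?thesis using n21 unfolding R1_def R2_def by blast
      next
        case 4
        then show ?thesis using n21 crossing_sym[of U W] unfolding R1_def R2_def by blast
      qed
    qed
    show "\<not> crossing U (map_prod ?s ?e X)" if "U \<in> R1 \<union> R2" "X \<in> ?A" for U X
    proof -
      obtain c z where X: "X = (c, z)" "c \<in> ?V" "z \<in> ?V"
        using \<open>X \<in> ?A\<close> lt_A by (cases X) auto
      consider "U \<in> R1" | "U \<in> R2"
        using \<open>U \<in> R1 \<union> R2\<close> by blast
      then show ?thesis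
      proof cases
        case 1
        then show ?thesis using n11 X unfolding R1_def map_prod_simp X(1) by blast
      next
        case 2
        then show ?thesis using n21 X unfolding R2_def map_prod_simp X(1) by blast
      qed
    qed
  next
    fix p q X v assume pq: "(p, q) \<in> T_arcs" and un: "\<forall>W\<in>R1 \<union> R2. \<not> crossing W (p, q)" and X: "X \<in> ?A"
      and cr: "crossing (map_prod ?s ?e X) (p, q)" and v: "v \<in> ?V"
    obtain a b where ab: "p = start {..a}" "q = finish {..b}" "a < b"
      using pq by (auto simp: T_arcs_def)
    obtain c z where cz: "X = (c, z)" "c \<in> ?V" "z \<in> ?V" "c < z"
      using X lt_A by (cases X) auto
    have un2: "\<not> (v - d + t < a \<and> a \<le> v - t \<and> v - t < b \<or> a < v - d + t \<and> v - d + t \<le> b \<and> b < v - t)"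
      if "0 < t" "t < d / 2" for t
    proof -
      have "(start {..v - d + t}, finish {..v - t}) \<in> R2"
        using v that by (auto simp: R2_def)
      then have "\<not> crossing (start {..v - d + t}, finish {..v - t}) (p, q)"
        using un by blast
      then show ?thesis
        unfolding ab crossing_start_finish .
    qed
    have cr': "c < a \<and> a \<le> z - d \<and> z - d < b \<or> a < c \<and> c \<le> b \<and> b < z - d"
      using cr unfolding cz ab map_prod_simp crossing_start_finish .
    \<comment> \<open>An arc that lies inside a gap crosses no arc of the polygon.\<close>
    have in_gap: "\<not> (v - d < a \<and> b < v)"
    proof
      assume "v - d < a \<and> b < v"
      moreover have "c \<le> v - d \<or> v \<le> c" "z \<le> v \<or> v \<le> z - d"
        using dd[of c v] dd[of v z] cz v by linarith+
      ultimately show False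
        using cr' ab(3) by linarith
    qed
    have a: "\<not> (v - d < a \<and> a < v)"
    proof
      assume av: "v - d < a \<and> a < v"
      then have vb: "v \<le> b"
        using in_gap by auto
      let ?t = "min (a - (v - d)) (v - a) / 2"
      have "0 < ?t" "2 * ?t \<le> a - (v - d)" "2 * ?t \<le> v - a"
        using av by auto
      then have "?t < d / 2" "v - d + ?t < a" "a \<le> v - ?t" "v - ?t < b"
        using av vb by linarith+
      then show False
        using un2[of ?t] \<open>0 < ?t\<close> by blast
    qed
    have b: "\<not> (v - d < b \<and> b < v)"
    proof
      assume bv: "v - d < b \<and> b < v"
      then have va: "a \<le> v - d"
        using in_gap by auto
      let ?t = "min (b - (v - d)) (v - b) / 2"
      have "0 < ?t" "2 * ?t \<le> b - (v - d)" "2 * ?t \<le> v - b"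
        using bv by auto
      then have "?t < d / 2" "a < v - d + ?t" "v - d + ?t \<le> b" "b < v - ?t"
        using bv va by linarith+
      then show False
        using un2[of ?t] \<open>0 < ?t\<close> by blast
    qed
    show "(p < ?e v \<or> ?s v \<le> p) \<and> (q \<le> ?e v \<or> ?s v < q)"
      unfolding ab using a b by (auto simp: not_less)
  next
    fix a b c z E assume "(a, b) \<in> ?A" "(c, z) \<in> ?A" "a < c" "c < b" "b < z" "E \<in> sides a c b z"
    then have "fst E \<in> ?V" "snd E \<in> ?V" "fst E < snd E"
      using lt_A[of a b] lt_A[of c z] unfolding sides_def by auto
    then have "E \<in> ?A \<or> map_prod ?s ?e E \<in> R1"
      unfolding R1_def by (cases E) auto
    then show "E \<in> ?A \<or> (\<forall>Z\<in>T_arcs. (\<forall>W\<in>R1 \<union> R2. \<not> crossing W Z) \<longrightarrow> \<not> crossing (map_prod ?s ?e E) Z)"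
      by blast
  qed
  then show ?thesis
    by blast
qed

section \<open>The two diagrams\<close>

lemma cluster_map_pull:
  "pcond_iso a P' P \<Longrightarrow> cluster_map P M k K \<Longrightarrow> cluster_map P' M (k \<circ> a) (K \<circ> image a)"
  unfolding pcond_iso_def by (intro cluster_map_comp[where Q = P] cluster_map_iso) blast+

lemma factors_pull_iso:
  "pcond_iso a P' P \<Longrightarrow> pcond_iso b Q' Q \<Longrightarrow> factors P k K Q l L \<Longrightarrow>
    factors P' (k \<circ> a) (K \<circ> image a) Q' (l \<circ> b) (L \<circ> image b)"
  unfolding pcond_iso_def by (intro factors_pull[where P = P and Q = Q]) blast+

lemma mutation_closed_pull: "pcond_iso a P' P \<Longrightarrow> mutation_closed P \<Longrightarrow> mutation_closed P'"
  unfolding pcond_iso_def by (intro mutation_closed_iso[of a P' P]) blast+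

fun ends :: "vertex \<Rightarrow> real set" where
  "ends (N n) = segment n"
| "ends N_inf = open_chain 1"
| "ends N_extbar = insert (pt Pinf 1) (closed_chain 1)"
| "ends (N_copies i) = open_chain i"
| "ends (N_copiesbar i) = closed_chain i"
| "ends _ = {}"

fun excluded :: "vertex \<Rightarrow> (real \<times> real) set" where
  "excluded (N n) = {edge n}"
| "excluded N_extbar = {ext_edge}"
| "excluded _ = {}"

text \<open>The set of arcs adjoined to a cluster of a vertex before completing it in a closed chain of \<open>j\<close>
copies. The additional edge of \<open>N_extbar\<close> is adjoined at this vertex only; at the vertices before it
the completion admits the edge by itself.\<close>

fun filling :: "nat \<Rightarrow> vertex \<Rightarrow> (real \<times> real) set" where
  "filling j (N n) = double_fan n \<union> zigzags 1 j"
| "filling j N_extbar = insert ext_edge (zigzags 1 j)"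
| "filling j (N_copies i) = zigzags i j"
| "filling j (N_copiesbar i) = zigzags i j"
| "filling j _ = zigzags 1 j"

text \<open>The vertices whose arcs are chords of a closed chain of \<open>j \<ge> 2\<close> copies.\<close>

fun in_chain :: "nat \<Rightarrow> vertex \<Rightarrow> bool" where
  "in_chain j (N n) \<longleftrightarrow> 2 \<le> n"
| "in_chain j N_inf \<longleftrightarrow> True"
| "in_chain j N_extbar \<longleftrightarrow> True"
| "in_chain j (N_copies i) \<longleftrightarrow> i \<le> j"
| "in_chain j (N_copiesbar i) \<longleftrightarrow> i \<le> j"
| "in_chain j _ \<longleftrightarrow> False"

abbreviation chord_cond :: "vertex \<Rightarrow> (real \<times> real) pcond" where
  "chord_cond v \<equiv> noncrossing (chords (ends v) - excluded v)"

lemma completable_vertex: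
  "in_chain j v \<Longrightarrow> 2 \<le> j \<Longrightarrow> completable j (ends v) (excluded v) (filling j v)"
  using completable_segment[of _ j] completable_ext[of j] completable_chain[of _ j]
    completable_closed_chain[of _ j]
  by (cases v) auto

lemma iso_vertex: "in_chain j v \<Longrightarrow> pcond_iso (arc_of v) (cond v) (chord_cond v)"
  using iso_N iso_N_inf iso_N_extbar iso_N_copies iso_N_copiesbar by (cases v) (simp_all del: cond.simps)

abbreviation vertex_factors :: "nat \<Rightarrow> vertex \<Rightarrow> vertex \<Rightarrow> bool" where
  "vertex_factors j v w \<equiv>
     lower_factors j (ends v) (excluded v) (filling j v) (ends w) (excluded w) (filling j w)"

definition main_arrows :: "nat \<Rightarrow> nat \<Rightarrow> nat \<Rightarrow> nat \<Rightarrow> (vertex \<times> vertex) set" where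
  "main_arrows m n i j =
        ({(N m, N_inf), (N_inf, N_copies 1), (N_copies 1, N_copies i),
          (N_copies i, N_copies j), (N_copies j, N_pi)} \<union>
         {(N n, N_copiesbar 1), (N_copiesbar 1, N_copiesbar i),
          (N_copiesbar i, N_copiesbar j), (N_copiesbar j, E_R)} \<union>
         {(N m, N n), (N n, N_inf), (N_copies 1, N_copiesbar 1),
          (N_copies i, N_copiesbar i), (N_copies j, N_copiesbar j),
          (N_pi, E_R), (N_copiesbar j, N_pi)} \<union>
         {(N_copiesbar 1, N_extbar), (N_extbar, N_copiesbar 2),
          (N_copiesbar 2, N_copiesbar i)})"

text \<open>The ambient condition is \<open>E\<close>. The chain of \<open>j\<close> copies reaches it through \<open>N_pi\<close>, by \<open>\<alpha>\<close> and \<open>\<beta>\<close> on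
arcs. The two squares between chains and closed chains need no argument of their own, since both
ways around are determined by the completions in \<open>E\<close>.\<close>

lemma first_diagram:
  fixes m n i j :: nat
  assumes mn: "2 \<le> m" "m < n" and ij: "2 \<le> i" "i < j"
  shows "\<exists>D. commutative_diagram (main_arrows m n i j) D
      \<and> is_isomorphism (cond N_inf) (cond (N_copies 1)) (D N_inf (N_copies 1))"
proof -
  let ?M = "noncrossing E_arcs" and ?B = "noncrossing (chords (closed_chain j))"
  have j: "2 \<le> j"
    using ij by simp
  define \<alpha> :: "real \<times> real \<Rightarrow> real \<times> real" where "\<alpha> = map_prod arctan arctan"
  obtain L where L: "cluster_map ?B (noncrossing pi_arcs) \<alpha> L"
    using closed_chain_pi[of j] by (auto simp: \<alpha>_def)
  define \<beta> :: "real \<times> real \<Rightarrow> bound \<times> bound"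
    where "\<beta> = map_prod (\<lambda>x. start {..x}) (\<lambda>x. finish {..<x})"
  obtain H where H: "cluster_map (noncrossing pi_arcs) ?M \<beta> H"
    using pi_E by (auto simp: \<beta>_def)
  let ?C = "\<lambda>v. chord_completion j (filling j v)"
  define k where "k v = (case v of
      E_R \<Rightarrow> (\<lambda>X. X) \<circ> unlabel Interval interval_arc
    | N_pi \<Rightarrow> \<beta> \<circ> arc_of N_pi
    | _ \<Rightarrow> ((\<beta> \<circ> \<alpha>) \<circ> (\<lambda>Z. Z)) \<circ> arc_of v)" for v
  define K where "K v = (case v of
      E_R \<Rightarrow> (\<lambda>T. T) \<circ> image (unlabel Interval interval_arc)
    | N_pi \<Rightarrow> H \<circ> image (arc_of N_pi)
    | _ \<Rightarrow> ((H \<circ> L) \<circ> ?C v) \<circ> image (arc_of v))" for v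
  have kE: "k E_R = (\<lambda>X. X) \<circ> unlabel Interval interval_arc"
    "K E_R = (\<lambda>T. T) \<circ> image (unlabel Interval interval_arc)"
    and kpi: "k N_pi = \<beta> \<circ> arc_of N_pi" "K N_pi = H \<circ> image (arc_of N_pi)"
    by (simp_all add: k_def K_def)
  have kv: "k v = ((\<beta> \<circ> \<alpha>) \<circ> (\<lambda>Z. Z)) \<circ> arc_of v" "K v = ((H \<circ> L) \<circ> ?C v) \<circ> image (arc_of v)"
    if "in_chain j v" for v
    using that by (cases v; simp add: k_def K_def)+
  note HL = cluster_map_comp[OF L H]
  have C: "cluster_map (chord_cond v) ?B (\<lambda>Z. Z) (?C v)" if "in_chain j v" for v
    using complete_cluster_map[OF completable_vertex[OF that j]] .
  have mapv: "cluster_map (cond v) ?M (k v) (K v)" if v: "in_chain j v" for v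
    unfolding kv[OF v] by (rule cluster_map_pull[OF iso_vertex[OF v] cluster_map_comp[OF C[OF v] HL]])
  have mappi: "cluster_map (cond N_pi) ?M (k N_pi) (K N_pi)"
    unfolding kpi by (rule cluster_map_pull[OF iso_N_pi H])
  have mapE: "cluster_map (cond E_R) ?M (k E_R) (K E_R)"
    unfolding kE by (rule cluster_map_pull[OF iso_E cluster_map_id])
  have mutv: "mutation_closed (cond v)" if v: "in_chain j v" for v
    using mutation_closed_pull[OF iso_vertex[OF v]] induces_mutation_closed
      completable_induces[OF completable_vertex[OF v j]] by blast
  have mutpi: "mutation_closed (cond N_pi)"
    by (rule mutation_closed_pull[OF iso_N_pi pi_mutation_closed])
  define fac where "fac v w \<longleftrightarrow> factors (cond v) (k v) (K v) (cond w) (k w) (K w)" for v w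
  have fac_trans: "fac u w" if "fac u v" "fac v w" for u v w
    using that unfolding fac_def by (rule factors_trans)
  have facv: "fac v w" if v: "in_chain j v" and w: "in_chain j w" and vw: "vertex_factors j v w" for v w
    unfolding fac_def kv[OF v] kv[OF w]
    using factors_push[OF C[OF w] HL vw[unfolded lower_factors_def] C[OF v]]
    by (rule factors_pull_iso[OF iso_vertex[OF v] iso_vertex[OF w]])
  \<comment> \<open>The short arrows from which all others are composed.\<close>
  have g1: "fac (N m) (N n)" and g2: "fac (N n) N_inf"
    using facv[of "N m" "N n"] facv[of "N n" N_inf] factors_segment[of m n j]
      factors_segment_chain[of n j] mn j by simp_all
  have g3: "fac N_inf (N_copies 1)"
    using facv[of N_inf "N_copies 1"] factors_chain[of 1 1 j] j by simp
  have g4: "fac (N_copies a) (N_copies b)" if "a \<le> b" "b \<le> j" for a b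
    using facv[of "N_copies a" "N_copies b"] factors_chain[of a b j] that by simp
  have g5: "fac (N_copies a) (N_copiesbar a)" if "a \<le> j" for a
    using facv[of "N_copies a" "N_copiesbar a"] factors_chain_closed_chain[of a j] that by simp
  have g6: "fac (N_copiesbar 1) N_extbar" and g7: "fac N_extbar (N_copiesbar 2)"
    using facv[of "N_copiesbar 1" N_extbar] facv[of N_extbar "N_copiesbar 2"]
      factors_closed_chain_ext[OF j] factors_ext_closed_chain[OF j] j by simp_all
  have g8: "fac (N_copiesbar a) (N_copiesbar b)" if "a \<le> b" "b \<le> j" for a b
    using facv[of "N_copiesbar a" "N_copiesbar b"] factors_closed_chain[of a b j] that by simp
  have g9: "fac (N_copiesbar j) N_pi"
  proof -
    have v: "in_chain j (N_copiesbar j)"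
      by simp
    show ?thesis
      using factors_pull_iso[OF iso_vertex[OF v] iso_N_pi factors_comp[OF cluster_map_comp[OF C[OF v] L] H]]
      unfolding fac_def kv[OF v] kpi comp_assoc .
  qed
  have g10: "fac N_pi E_R"
    using factors_pull_iso[OF iso_N_pi iso_E factors_comp[OF H cluster_map_id]]
    unfolding fac_def kE kpi by (simp add: comp_def)
  let ?A = "main_arrows m n i j"
  have edges: "fac v w" if "(v, w) \<in> ?A" for v w
  proof -
    have "fac (N m) N_inf" "fac (N_copies j) N_pi" "fac (N n) (N_copiesbar 1)" "fac (N_copiesbar j) E_R"
      using fac_trans[OF g1 g2] fac_trans[OF g5 g9] fac_trans[OF fac_trans[OF g2 g3] g5]
        fac_trans[OF g9 g10] j by auto
    then show ?thesis
      using that g1 g2 g3 g4 g5 g6 g7 g8 g9 g10 ij unfolding main_arrows_def by auto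
  qed
  have "commutative_diagram ?A (cocone_diagram k K)"
  proof (rule cocone_commutes)
    show "cluster_map (cond v) ?M (k v) (K v)" if "v \<in> fst ` ?A \<union> snd ` ?A" for v
    proof -
      have "in_chain j v \<or> v = N_pi \<or> v = E_R"
        using that mn ij unfolding main_arrows_def by auto
      then show ?thesis
        using mapv mappi mapE by blast
    qed
    show "mutation_closed (cond v)" if "v \<in> fst ` ?A" for v
    proof -
      have "in_chain j v \<or> v = N_pi"
        using that mn ij unfolding main_arrows_def by auto
      then show ?thesis
        using mutv mutpi by blast
    qed
    show "factors (cond v) (k v) (K v) (cond w) (k w) (K w)" if "(v, w) \<in> ?A" for v w
      using edges[OF that] unfolding fac_def .
  qed
  moreover have "is_isomorphism (cond N_inf) (cond (N_copies 1)) (cocone_diagram k K N_inf (N_copies 1))"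
  proof -
    have v: "in_chain j N_inf" "in_chain j (N_copies 1)"
      using j by simp_all
    note m1 = mapv[OF v(1)] and m2 = mapv[OF v(2)]
    let ?f = "inv_into (Ind (cond (N_copies 1))) (k (N_copies 1)) \<circ> k N_inf"
    note f = cluster_map_of_factors[OF m1 m2 g3[unfolded fac_def]]
    have im: "k u ` Ind (cond u) = (\<beta> \<circ> \<alpha>) ` chords (open_chain 1)" if "u = N_inf \<or> u = N_copies 1" for u
    proof -
      have u: "in_chain j u" "chords (ends u) - excluded u = chords (open_chain 1)"
        using that v by auto
      have "arc_of u ` Ind (cond u) = chords (open_chain 1)"
        using iso_vertex[OF u(1)] unfolding pcond_iso_def bij_betw_def noncrossing_simps u(2) by blast
      then show ?thesis
        unfolding kv[OF u(1)] image_comp[symmetric] by simp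
    qed
    have "k N_inf ` Ind (cond N_inf) = k (N_copies 1) ` Ind (cond (N_copies 1))"
      unfolding im[OF disjI1[OF refl]] im[OF disjI2[OF refl]] ..
    then have "?f ` Ind (cond N_inf) = Ind (cond (N_copies 1))"
      unfolding image_comp[symmetric] using inv_into_image_cancel[OF cluster_mapD(2)[OF m2] subset_refl]
      by metis
    then have "bij_betw ?f (Ind (cond N_inf)) (Ind (cond (N_copies 1)))"
      using cluster_mapD(2)[OF f] by (simp add: bij_betw_def)
    then show ?thesis
      unfolding cocone_diagram_def by (rule is_isomorphism_emb_of[OF _ mutv[OF v(1)] f])
  qed
  ultimately show ?thesis
    by blast
qed

text \<open>Only the map from the larger polygon to \<open>T\<close> has to be chosen; the smaller polygon is completed
through the larger one.\<close>

lemma second_diagram: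
  fixes m n :: nat
  assumes mn: "2 \<le> m" "m < n"
  shows "\<exists>D. commutative_diagram {(N m, N n), (N n, T_Z), (N m, T_Z)} D"
proof -
  let ?M = "noncrossing T_arcs"
  have cm: "completable 1 (ends (N m)) (excluded (N m)) (filling 1 (N m))"
    and cn: "completable 1 (ends (N n)) (excluded (N n)) (filling 1 (N n))"
    using completable_segment[of _ 1] mn by simp_all
  obtain g G where g: "cluster_map (chord_cond (N n)) ?M g G"
    using segment_T[of n] mn by auto
  have "vertex_factors 1 (N m) (N n)"
    using factors_segment[of m n 1] mn by simp
  then obtain f F where f: "cluster_map (chord_cond (N m)) (chord_cond (N n)) f F"
    using cluster_map_of_factors[OF complete_cluster_map[OF cm] complete_cluster_map[OF cn]]
    unfolding lower_factors_def by blast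
  define k where "k v = (if v = N m then (g \<circ> f) \<circ> arc_of v else if v = N n then g \<circ> arc_of v
    else (\<lambda>X. X) \<circ> unlabel Z_Point point_arc)" for v
  define K where "K v = (if v = N m then (G \<circ> F) \<circ> image (arc_of v) else if v = N n then G \<circ> image (arc_of v)
    else (\<lambda>T. T) \<circ> image (unlabel Z_Point point_arc))" for v
  have k: "k (N m) = (g \<circ> f) \<circ> arc_of (N m)" "k (N n) = g \<circ> arc_of (N n)"
    "k T_Z = (\<lambda>X. X) \<circ> unlabel Z_Point point_arc"
    and K: "K (N m) = (G \<circ> F) \<circ> image (arc_of (N m))" "K (N n) = G \<circ> image (arc_of (N n))"
    "K T_Z = (\<lambda>T. T) \<circ> image (unlabel Z_Point point_arc)"
    using mn by (simp_all add: k_def K_def)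
  have iso: "pcond_iso (arc_of (N p)) (cond (N p)) (chord_cond (N p))" for p
    using iso_N[of p] by (simp del: cond.simps)
  have 1: "factors (cond (N m)) (k (N m)) (K (N m)) (cond (N n)) (k (N n)) (K (N n))"
    unfolding k K by (rule factors_pull_iso[OF iso iso factors_comp[OF f g]])
  have 2: "factors (cond (N n)) (k (N n)) (K (N n)) (cond T_Z) (k T_Z) (K T_Z)"
    using factors_pull_iso[OF iso iso_T factors_comp[OF g cluster_map_id]]
    unfolding k K by (simp add: comp_def del: cond.simps)
  have map: "cluster_map (cond (N m)) ?M (k (N m)) (K (N m))" "cluster_map (cond (N n)) ?M (k (N n)) (K (N n))"
    "cluster_map (cond T_Z) ?M (k T_Z) (K T_Z)"
    unfolding k K
    by (rule cluster_map_pull[OF iso cluster_map_comp[OF f g]] cluster_map_pull[OF iso g]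
        cluster_map_pull[OF iso_T cluster_map_id])+
  have mut: "mutation_closed (cond (N m))" "mutation_closed (cond (N n))"
    using mutation_closed_pull[OF iso] induces_mutation_closed completable_induces[OF cm]
      completable_induces[OF cn] by blast+
  let ?A = "{(N m, N n), (N n, T_Z), (N m, T_Z)}"
  have "commutative_diagram ?A (cocone_diagram k K)"
  proof (rule cocone_commutes)
    show "cluster_map (cond v) ?M (k v) (K v)" if "v \<in> fst ` ?A \<union> snd ` ?A" for v
    proof -
      have "v = N m \<or> v = N n \<or> v = T_Z"
        using that by auto
      then show ?thesis
        using map by blast
    qed
    show "mutation_closed (cond v)" if "v \<in> fst ` ?A" for v
    proof -
      have "v = N m \<or> v = N n"
        using that by auto
      then show ?thesis
        using mut by blast
    qed
    show "factors (cond v) (k v) (K v) (cond w) (k w) (K w)" if "(v, w) \<in> ?A" for v w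
    proof -
      have "v = N m \<and> w = N n \<or> v = N n \<and> w = T_Z \<or> v = N m \<and> w = T_Z"
        using that by auto
      then show ?thesis
        using 1 2 factors_trans[OF 1 2] by blast
    qed
  qed
  then show ?thesis
    by blast
qed

theorem theorem1:
  fixes m n i j :: nat
  assumes "2 \<le> m" and "m < n" and "2 \<le> i" and "i < j"
  shows
    "(\<exists>D. commutative_diagram
        ({(N m, N_inf), (N_inf, N_copies 1), (N_copies 1, N_copies i),
          (N_copies i, N_copies j), (N_copies j, N_pi)} \<union>
         {(N n, N_copiesbar 1), (N_copiesbar 1, N_copiesbar i),
          (N_copiesbar i, N_copiesbar j), (N_copiesbar j, E_R)} \<union>
         {(N m, N n), (N n, N_inf), (N_copies 1, N_copiesbar 1),
          (N_copies i, N_copiesbar i), (N_copies j, N_copiesbar j),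
          (N_pi, E_R), (N_copiesbar j, N_pi)} \<union>
         {(N_copiesbar 1, N_extbar), (N_extbar, N_copiesbar 2),
          (N_copiesbar 2, N_copiesbar i)}) D
      \<and> is_isomorphism (cond N_inf) (cond (N_copies 1)) (D N_inf (N_copies 1)))
   \<and> (\<exists>D. commutative_diagram {(N m, N n), (N n, T_Z), (N m, T_Z)} D)"
  using first_diagram[OF assms, unfolded main_arrows_def] second_diagram[OF assms(1,2)] by blast

end
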